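(* Let $\lambda\in\mathbb C/\mathbb Z$ with $\lambda\neq\mathbb Z$. Every indecomposable object in $\mathcal C_{\beta\gamma,\lambda}$ is isomorphic to $\sigma^n\mathcal W_\lambda^k$ for some $n\in\mathbb Z$ and $k\in\mathbb Z_{\ge0}$.
   Context: $\beta\gamma$ is the unital $\mathbb C$-algebra generated by $\beta_n,\gamma_n$ ($n\in\mathbb Z$) with $[\beta_m,\beta_n]=[\gamma_m,\gamma_n]=0$, $[\beta_m,\gamma_n]=-\delta_{m,-n}$. Modules of the $\beta\gamma$ vertex operator algebra are smooth $\beta\gamma$-modules (each vector is killed by $\beta_n,\gamma_n$ for $n\gg0$) graded by generalized eigenvalues of $L_0=\sum_{k\ge1}k(\beta_{-k}\gamma_k-\gamma_{-k}\beta_k)$. Put $J_0=\sum_{n\ge0}\gamma_{-n}\beta_n+\sum_{n\ge1}\beta_{-n}\gamma_n$; then $[J_0,\beta_k]=\beta_k$, $[J_0,\gamma_k]=-\gamma_k$. Let $\beta\gamma_{\ge0}$ be the subalgebra generated by $\beta_n,\gamma_n$, $n\ge0$. In all inductions below $\beta_n,\gamma_n$ for $n\ge1$ act by $0$ on the inducing space and $\beta_0$ acts as $-\partial/\partial\gamma_0$. Define $\mathcal V=\mathrm{Ind}_{\beta\gamma_{\ge0}}^{\beta\gamma}\mathbb C[\gamma_0]$, and for $\lambda=\mu+\mathbb Z$ with $\mu\in\mathbb C\setminus\mathbb Z$ and $k\ge1$, $$\mathcal W_\lambda^k=\mathrm{Ind}_{\beta\gamma_{\ge0}}^{\beta\gamma}\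 \bigoplus_{j=0}^{k-1}\gamma_0^{-\mu}\,\mathbb C[\gamma_0,\gamma_0^{-1}]\,(\log\gamma_0)^j,\qquad \mathcal W_\lambda=\mathcal W_\lambda^1,\quad \mathcal W^0_\lambda=0$$ (independent up to isomorphism of $\mu\in\lambda$); the generalized $J_0$-eigenvalues on $\mathcal W_\lambda^k$ lie in $\lambda$. Spectral flow: $\sigma(\beta_n)=\beta_{n-1}$, $\sigma(\gamma_n)=\gamma_{n+1}$; $\sigma^nM$ is $M$ with action $\alpha\star v=\sigma^{-n}(\alpha)v$. $\mathcal C_{\beta\gamma}$ is the abelian category of smooth finite-length modules generated by $\sigma^n\mathcal V$, $\sigma^n\mathcal W_\lambda$ ($n\in\mathbb Z$, $\lambda\in(\mathbb C\setminus\mathbb Z)/\mathbb Z$) and closed under extensions (modules with a finite filtration whose subquotients are among these simple modules). $\mathcal C_{\beta\gamma,\lambda}$ is the full subcategory of objects on which all generalized eigenvalues of $J_0$ lie in $\lambda$. *)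

theory Defs
  imports
    Complex_Main
    "HOL-Library.Poly_Mapping"
    "HOL-Computational_Algebra.Polynomial"
    "HOL-Algebra.AbelCoset"
    "HOL-Algebra.Module"
begin

section \<open>The algebra and its modules\<close>

datatype bg_gen = Beta int | Gamma int

primrec mode :: "bg_gen \<Rightarrow> int" where
  "mode (Beta n) = n"
| "mode (Gamma n) = n"

fun bg_comm :: "bg_gen \<Rightarrow> bg_gen \<Rightarrow> complex" where
  "bg_comm (Beta m) (Gamma n) = (if m = - n then -1 else 0)"
| "bg_comm (Gamma m) (Beta n) = (if n = - m then 1 else 0)"
| "bg_comm (Beta m) (Beta n) = 0"
| "bg_comm (Gamma m) (Gamma n) = 0"

definition complex_ring :: "complex ring" where
  "complex_ring = \<lparr>carrier = UNIV, mult = (*), one = 1, zero = 0, add = (+)\<rparr>"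

text \<open>
  A module over the algebra with generators \<open>bg_gen\<close> and relations \<open>g h - h g = bg_comm g h\<close>
  is a complex vector space on which the generators act by linear maps satisfying the relations.
  The fields \<open>mult\<close> and \<open>one\<close> are inherited from the library record for modules and carry no meaning.
\<close>

record 'v bg_rep = "(complex, 'v) module" +
  act :: "bg_gen \<Rightarrow> 'v \<Rightarrow> 'v"

locale bg_module = module complex_ring M for M :: "'v bg_rep" (structure) +
  assumes act_closed: "x \<in> carrier M \<Longrightarrow> act M g x \<in> carrier M"
    and act_add: "x \<in> carrier M \<Longrightarrow> y \<in> carrier M \<Longrightarrow> act M g (x \<oplus> y) = act M g x \<oplus> act M g y"
    and act_smult: "x \<in> carrier M \<Longrightarrow> act M g (c \<odot> x) = c \<odot> act M g x"
    and act_comm: "x \<in> carrier M \<Longrightarrow>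
      act M g (act M h x) \<ominus> act M h (act M g x) = bg_comm g h \<odot> x"

definition bg_submodule :: "'v set \<Rightarrow> 'v bg_rep \<Rightarrow> bool" where
  "bg_submodule H M \<longleftrightarrow> submodule H complex_ring M \<and> (\<forall>g. \<forall>x\<in>H. act M g x \<in> H)"

definition bg_quot :: "'v bg_rep \<Rightarrow> 'v set \<Rightarrow> 'v set bg_rep" where
  "bg_quot M H = \<lparr>carrier = a_rcosets\<^bsub>M\<^esub> H, mult = undefined, one = undefined,
     zero = H, add = set_add M,
     smult = (\<lambda>c A. \<Union>a\<in>A. H +>\<^bsub>M\<^esub> (c \<odot>\<^bsub>M\<^esub> a)),
     act = (\<lambda>g A. \<Union>a\<in>A. H +>\<^bsub>M\<^esub> act M g a)\<rparr>"

definition bg_hom :: "'v bg_rep \<Rightarrow> 'w bg_rep \<Rightarrow> ('v \<Rightarrow> 'w) set" where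
  "bg_hom M N = {f. f \<in> carrier M \<rightarrow> carrier N \<and>
     (\<forall>x\<in>carrier M. \<forall>y\<in>carrier M. f (x \<oplus>\<^bsub>M\<^esub> y) = f x \<oplus>\<^bsub>N\<^esub> f y) \<and>
     (\<forall>c. \<forall>x\<in>carrier M. f (c \<odot>\<^bsub>M\<^esub> x) = c \<odot>\<^bsub>N\<^esub> f x) \<and>
     (\<forall>g. \<forall>x\<in>carrier M. f (act M g x) = act N g (f x))}"

definition bg_iso :: "'v bg_rep \<Rightarrow> 'w bg_rep \<Rightarrow> bool" where
  "bg_iso M N \<longleftrightarrow> (\<exists>f\<in>bg_hom M N. bij_betw f (carrier M) (carrier N))"

section \<open>Spectral flow\<close>

fun bg_sigma :: "int \<Rightarrow> bg_gen \<Rightarrow> bg_gen" where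
  "bg_sigma k (Beta n) = Beta (n - k)"
| "bg_sigma k (Gamma n) = Gamma (n + k)"

definition bg_flow :: "int \<Rightarrow> 'v bg_rep \<Rightarrow> 'v bg_rep" where
  "bg_flow n M = M\<lparr>act := (\<lambda>g. act M (bg_sigma (- n) g))\<rparr>"

section \<open>Induction from the subalgebra of non-negative modes\<close>

definition pm_scale :: "complex \<Rightarrow> ('k \<Rightarrow>\<^sub>0 complex) \<Rightarrow> ('k \<Rightarrow>\<^sub>0 complex)" where
  "pm_scale c = Poly_Mapping.map ((*) c)"

definition pm_extend :: "('k \<Rightarrow> ('l \<Rightarrow>\<^sub>0 complex)) \<Rightarrow> ('k \<Rightarrow>\<^sub>0 complex) \<Rightarrow> ('l \<Rightarrow>\<^sub>0 complex)" where
  "pm_extend f p = (\<Sum>k\<in>Poly_Mapping.keys p. pm_scale (Poly_Mapping.lookup p k) (f k))"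

text \<open>
  The tensor product of the algebra with \<open>N\<close> over the subalgebra generated by the non-negative
  modes, by generators and relations.  The pair \<open>(w, x)\<close> stands for the pure tensor of the word
  \<open>w\<close> in the generators with the vector \<open>x\<close>.  The four families of relations below are additivity
  and homogeneity in \<open>x\<close>, the two-sided ideal of relations of the algebra, and balancedness over
  the subalgebra.  The space \<open>N\<close> only needs to be a module over the subalgebra: the action of
  generators of negative mode on \<open>N\<close> is never used.
\<close>

definition bg_free :: "'v bg_rep \<Rightarrow> (bg_gen list \<times> 'v \<Rightarrow>\<^sub>0 complex) bg_rep" where
  "bg_free N = \<lparr>carrier = {p. snd ` Poly_Mapping.keys p \<subseteq> carrier N},
     mult = undefined, one = undefined, zero = 0, add = (+), smult = pm_scale,
     act = (\<lambda>g. pm_extend (\<lambda>(w, x). Poly_Mapping.single (g # w, x) 1))\<rparr>"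

definition bg_ind_rels :: "'v bg_rep \<Rightarrow> (bg_gen list \<times> 'v \<Rightarrow>\<^sub>0 complex) set" where
  "bg_ind_rels N =
     {Poly_Mapping.single (w, x \<oplus>\<^bsub>N\<^esub> y) 1 - Poly_Mapping.single (w, x) 1 - Poly_Mapping.single (w, y) 1
        | w x y. x \<in> carrier N \<and> y \<in> carrier N}
   \<union> {Poly_Mapping.single (w, c \<odot>\<^bsub>N\<^esub> x) 1 - Poly_Mapping.single (w, x) c
        | w c x. x \<in> carrier N}
   \<union> {Poly_Mapping.single (u @ [g, h] @ v, x) 1 - Poly_Mapping.single (u @ [h, g] @ v, x) 1
          - Poly_Mapping.single (u @ v, x) (bg_comm g h)
        | u g h v x. x \<in> carrier N}
   \<union> {Poly_Mapping.single (w @ [g], x) 1 - Poly_Mapping.single (w, act N g x) 1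
        | w g x. mode g \<ge> 0 \<and> x \<in> carrier N}"

definition bg_ind :: "'v bg_rep \<Rightarrow> (bg_gen list \<times> 'v \<Rightarrow>\<^sub>0 complex) set bg_rep" where
  "bg_ind N = bg_quot (bg_free N) (Modules.module.span pm_scale (bg_ind_rels N))"

section \<open>The modules V and W\<close>

definition V_top :: "complex poly bg_rep" where
  "V_top = \<lparr>carrier = UNIV, mult = undefined, one = undefined, zero = 0, add = (+),
     smult = Polynomial.smult,
     act = (\<lambda>g p. case g of
         Beta n \<Rightarrow> if n = 0 then - pderiv p else 0
       | Gamma n \<Rightarrow> if n = 0 then [:0, 1:] * p else 0)\<rparr>"

definition bg_V :: "(bg_gen list \<times> complex poly \<Rightarrow>\<^sub>0 complex) set bg_rep" where
  "bg_V = bg_ind V_top"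

text \<open>
  The basis vector indexed by \<open>(n, j)\<close> is \<open>\<gamma>\<^sub>0\<close> to the power \<open>n - \<mu>\<close> times the \<open>j\<close>-th power of
  \<open>log \<gamma>\<^sub>0\<close>.  For \<open>j = 0\<close> the coefficient \<open>j\<close> vanishes, so the truncated \<open>j - 1\<close> is harmless.
\<close>

definition W_top :: "complex \<Rightarrow> nat \<Rightarrow> (int \<times> nat \<Rightarrow>\<^sub>0 complex) bg_rep" where
  "W_top \<mu> k = \<lparr>carrier = {p. Poly_Mapping.keys p \<subseteq> UNIV \<times> {..<k}},
     mult = undefined, one = undefined, zero = 0, add = (+), smult = pm_scale,
     act = (\<lambda>g p. case g of
         Beta n \<Rightarrow> if n = 0
           then - pm_extend (\<lambda>(n, j). Poly_Mapping.single (n - 1, j) (of_int n - \<mu>)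
                                   + Poly_Mapping.single (n - 1, j - 1) (of_nat j)) p
           else 0
       | Gamma n \<Rightarrow> if n = 0
           then pm_extend (\<lambda>(n, j). Poly_Mapping.single (n + 1, j) 1) p
           else 0)\<rparr>"

definition bg_W :: "complex \<Rightarrow> nat \<Rightarrow>
    (bg_gen list \<times> (int \<times> nat \<Rightarrow>\<^sub>0 complex) \<Rightarrow>\<^sub>0 complex) set bg_rep" where
  "bg_W \<mu> k = bg_ind (W_top \<mu> k)"

section \<open>The category\<close>

definition smooth :: "'v bg_rep \<Rightarrow> bool" where
  "smooth M \<longleftrightarrow> (\<forall>x\<in>carrier M. \<exists>N. \<forall>n\<ge>N. act M (Beta n) x = \<zero>\<^bsub>M\<^esub> \<and> act M (Gamma n) x = \<zero>\<^bsub>M\<^esub>)"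

definition bg_simple_generator :: "'v bg_rep \<Rightarrow> bool" where
  "bg_simple_generator S \<longleftrightarrow>
     (\<exists>n. bg_iso S (bg_flow n bg_V)) \<or> (\<exists>n \<mu>. \<mu> \<notin> \<int> \<and> bg_iso S (bg_flow n (bg_W \<mu> 1)))"

definition bg_filtered :: "'v bg_rep \<Rightarrow> bool" where
  "bg_filtered M \<longleftrightarrow> (\<exists>(r::nat) F. F 0 = {\<zero>\<^bsub>M\<^esub>} \<and> F r = carrier M \<and>
     (\<forall>i\<le>r. bg_submodule (F i) M) \<and>
     (\<forall>i<r. F i \<subseteq> F (Suc i) \<and>
        bg_simple_generator (bg_quot (M\<lparr>carrier := F (Suc i)\<rparr>) (F i))))"

text \<open>
  The filtration is a composition series, so the finite-length condition is part of it; so is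
  local finiteness of \<open>L\<^sub>0\<close>, which holds on the generators and passes to extensions.  Smoothness,
  in contrast, does not pass to extensions.
\<close>

definition bg_cat :: "'v bg_rep \<Rightarrow> bool" where
  "bg_cat M \<longleftrightarrow> bg_module M \<and> smooth M \<and> bg_filtered M"

text \<open>
  On a smooth module only finitely many terms of the sums are nonzero; they are restricted to those
  terms because \<open>finsum\<close> takes a default value on infinite index sets.
\<close>

definition J0 :: "'v bg_rep \<Rightarrow> 'v \<Rightarrow> 'v" where
  "J0 M x =
     (\<Oplus>\<^bsub>M\<^esub>n\<in>{n. n \<ge> 0 \<and> act M (Beta n) x \<noteq> \<zero>\<^bsub>M\<^esub>}. act M (Gamma (- n)) (act M (Beta n) x)) \<oplus>\<^bsub>M\<^esub>
     (\<Oplus>\<^bsub>M\<^esub>n\<in>{n. n \<ge> 1 \<and> act M (Gamma n) x \<noteq> \<zero>\<^bsub>M\<^esub>}. act M (Beta (- n)) (act M (Gamma n) x))"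

definition J0_gen_eigenvalue :: "'v bg_rep \<Rightarrow> complex \<Rightarrow> bool" where
  "J0_gen_eigenvalue M c \<longleftrightarrow> (\<exists>x\<in>carrier M. x \<noteq> \<zero>\<^bsub>M\<^esub> \<and>
     (\<exists>m. ((\<lambda>y. J0 M y \<ominus>\<^bsub>M\<^esub> (c \<odot>\<^bsub>M\<^esub> y)) ^^ m) x = \<zero>\<^bsub>M\<^esub>))"

definition bg_cat_at :: "complex set \<Rightarrow> 'v bg_rep \<Rightarrow> bool" where
  "bg_cat_at \<Lambda> M \<longleftrightarrow> bg_cat M \<and> (\<forall>c. J0_gen_eigenvalue M c \<longrightarrow> c \<in> \<Lambda>)"

text \<open>
  An object of the category which is not the direct sum of two nonzero objects of the category;
  with this convention the zero module is indecomposable.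
\<close>

definition bg_indecomposable_at :: "complex set \<Rightarrow> 'v bg_rep \<Rightarrow> bool" where
  "bg_indecomposable_at \<Lambda> M \<longleftrightarrow> bg_cat_at \<Lambda> M \<and>
     (\<forall>A B. bg_submodule A M \<and> bg_submodule B M \<and>
        bg_cat_at \<Lambda> (M\<lparr>carrier := A\<rparr>) \<and> bg_cat_at \<Lambda> (M\<lparr>carrier := B\<rparr>) \<and>
        A \<inter> B = {\<zero>\<^bsub>M\<^esub>} \<and> A <+>\<^bsub>M\<^esub> B = carrier M
        \<longrightarrow> A = {\<zero>\<^bsub>M\<^esub>} \<or> B = {\<zero>\<^bsub>M\<^esub>})"

definition C_mod_Z :: "complex set set" where
  "C_mod_Z = UNIV // {(a, b). a - b \<in> \<int>}"

end

theory Submission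
  imports Defs
begin

text \<open>
  For each \<open>m\<close> the operator \<open>\<gamma>\<^sub>-\<^sub>m\<beta>\<^sub>m\<close> shifts \<open>\<beta>\<^sub>m\<close> and \<open>\<gamma>\<^sub>-\<^sub>m\<close> by \<open>\<plusminus>1\<close> and commutes with
  the other generators, so the part of a module on which its generalized eigenvalues lie in a fixed
  class modulo the integers is a submodule.  On the flow by \<open>n\<close> of \<open>W\<close> its eigenvalues are integers
  except for \<open>m = -n\<close>, where they form the class \<open>\<Lambda>\<close>; on the flows of \<open>V\<close> they are always integers.
  The eigenvalue of \<open>J\<^sub>0\<close> on a vector in the bottom composition factor shows that this factor is a flow
  of some \<open>W\<close> for the class \<open>\<Lambda>\<close>, so an indecomposable module is concentrated in \<open>\<Lambda>\<close> for one value of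
  \<open>n\<close>.  After undoing the flow the positive modes act locally nilpotently, and Kashiwara's argument
  shows that the module is generated by the space \<open>E\<close> of those vectors killed by all positive modes
  which have generalized \<open>\<gamma>\<^sub>0\<beta>\<^sub>0\<close>-eigenvalue \<open>\<mu>\<close>.  Decompositions of \<open>E\<close> that are stable under the
  nilpotent operator \<open>\<gamma>\<^sub>0\<beta>\<^sub>0 - \<mu>\<close> induce decompositions of the module, so \<open>E\<close> is a single Jordan block,
  and its size is \<open>k\<close>.
\<close>

section \<open>Generalized eigenvectors of a linear operator\<close>

text \<open>Two obstacles shape the proof. No basis of ordered monomials is constructed for an
  induced module. The substitute is \<open>induced_meets\<close>: positive modes shorten words in
  the negative modes, so a nonzero submodule of a module generated by its inducing space meets that
  space. Simplicity of V and W, the independence of the two parts of a decomposition and the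
  injectivity of maps out of W are all reduced to the inducing space in this way. The second
  obstacle is that a module lives on a carrier in an arbitrary type, while linear algebra is stated
  for types that are abelian groups. Each module is replaced by a copy inside the formal linear
  combinations of its elements, and a quotient X / Y is realized in the same type as the image of X
  under a projection with kernel Y. J_0 is computed on a single vector only, a joint eigenvector of
  all gamma_(-m) beta_m. Non-integrality of \<mu> enters through gamma_0 beta_0 and beta_0 gamma_0:
  their eigenvalues avoid the integers, so gamma_0 is invertible on the space killed by the positive
  modes.\<close>

locale linear_operator = vector_space scale
  for scale :: "complex \<Rightarrow> 'a::ab_group_add \<Rightarrow> 'a" (infixr \<open>*s\<close> 75) +
  fixes h :: "'a \<Rightarrow> 'a"
  assumes h_add: "h (x + y) = h x + h y"
    and h_scale: "h (c *s x) = c *s h x"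
begin

lemma h_zero [simp]: "h 0 = 0"
  using h_scale[of 0 0] by simp

lemma h_minus: "h (- x) = - h x"
  using h_scale[of "-1" x] by simp

lemma h_diff: "h (x - y) = h x - h y"
  using h_add[of x "- y"] by (simp add: h_minus)

lemma h_sum: "h (sum f A) = (\<Sum>a\<in>A. h (f a))"
  by (induction A rule: infinite_finite_induct) (auto simp: h_add)

definition shift :: "complex \<Rightarrow> 'a \<Rightarrow> 'a" where
  "shift c x = h x - c *s x"

lemma shift_add: "shift c (x + y) = shift c x + shift c y"
  by (simp add: shift_def h_add algebra_simps)

lemma shift_scale: "shift c (d *s x) = d *s shift c x"
  by (simp add: shift_def h_scale algebra_simps)

lemma shift_zero [simp]: "shift c 0 = 0"
  by (simp add: shift_def)

lemma shift_diff: "shift c (x - y) = shift c x - shift c y"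
  by (simp add: shift_def h_diff algebra_simps)

lemma shift_commute: "shift c (shift d x) = shift d (shift c x)"
  by (simp add: shift_def h_diff h_scale algebra_simps)

lemma shift_eigen: "h x = d *s x \<Longrightarrow> shift c x = (d - c) *s x"
  by (simp add: shift_def algebra_simps)

primrec shifts :: "complex list \<Rightarrow> 'a \<Rightarrow> 'a" where
  "shifts [] x = x"
| "shifts (c # cs) x = shifts cs (shift c x)"

lemma shifts_add: "shifts cs (x + y) = shifts cs x + shifts cs y"
  by (induction cs arbitrary: x y) (simp_all add: shift_add)

lemma shifts_scale: "shifts cs (d *s x) = d *s shifts cs x"
  by (induction cs arbitrary: x) (simp_all add: shift_scale)

lemma shifts_zero [simp]: "shifts cs 0 = 0"
  by (induction cs) simp_all

lemma shifts_shift: "shifts cs (shift d x) = shift d (shifts cs x)"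
proof (induction cs arbitrary: x)
  case (Cons c cs)
  show ?case by (simp only: shifts.simps shift_commute[of c d] Cons.IH)
qed simp

lemma shifts_append: "shifts (cs @ ds) x = shifts ds (shifts cs x)"
  by (induction cs arbitrary: x) simp_all

lemma shifts_commute: "shifts cs (shifts ds x) = shifts ds (shifts cs x)"
proof (induction cs arbitrary: x)
  case (Cons c cs)
  show ?case by (simp only: shifts.simps Cons.IH flip: shifts_shift)
qed simp

lemma shifts_replicate: "shifts (replicate n c) x = (shift c ^^ n) x"
  by (induction n arbitrary: x) (simp_all add: funpow_swap1)

text \<open>The sum of the generalized eigenspaces for the eigenvalues in \<Gamma>, encoded by a
  product of factors h - c that kills the vector. For \<open>UNIV\<close> it expresses that h is
  locally finite on x.\<close>

definition geig :: "complex set \<Rightarrow> 'a set" where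
  "geig \<Gamma> = {x. \<exists>cs. set cs \<subseteq> \<Gamma> \<and> shifts cs x = 0}"

lemma geigI: "set cs \<subseteq> \<Gamma> \<Longrightarrow> shifts cs x = 0 \<Longrightarrow> x \<in> geig \<Gamma>"
  by (auto simp: geig_def)

lemma geig_eigenvector: "h x = c *s x \<Longrightarrow> c \<in> \<Gamma> \<Longrightarrow> x \<in> geig \<Gamma>"
  by (rule geigI[of "[c]"]) (auto simp: shift_def)

lemma geig_mono: "\<Gamma> \<subseteq> \<Delta> \<Longrightarrow> geig \<Gamma> \<subseteq> geig \<Delta>"
  by (auto simp: geig_def)

lemma subspace_geig: "subspace (geig \<Gamma>)"
proof (rule subspaceI)
  show "0 \<in> geig \<Gamma>" by (rule geigI[of "[]"]) auto
  fix x y assume "x \<in> geig \<Gamma>" "y \<in> geig \<Gamma>"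
  then obtain cs ds where "set cs \<subseteq> \<Gamma>" "shifts cs x = 0" "set ds \<subseteq> \<Gamma>" "shifts ds y = 0"
    by (auto simp: geig_def)
  then have "shifts (cs @ ds) (x + y) = 0" "set (cs @ ds) \<subseteq> \<Gamma>"
    by (auto simp: shifts_add shifts_append shifts_commute[of ds cs])
  then show "x + y \<in> geig \<Gamma>" by (rule geigI[rotated])
next
  fix c x assume "x \<in> geig \<Gamma>"
  then show "c *s x \<in> geig \<Gamma>" by (auto simp: geig_def shifts_scale) 
qed

lemma geig_single: "x \<in> geig {c} \<longleftrightarrow> (\<exists>n. (shift c ^^ n) x = 0)"
proof
  assume "x \<in> geig {c}"
  then obtain cs where cs: "set cs \<subseteq> {c}" "shifts cs x = 0" by (auto simp: geig_def)
  then have "cs = replicate (length cs) c" by (simp add: replicate_length_same subset_iff)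
  with cs show "\<exists>n. (shift c ^^ n) x = 0" by (metis shifts_replicate)
next
  assume "\<exists>n. (shift c ^^ n) x = 0"
  then obtain n where "(shift c ^^ n) x = 0" by blast
  then show "x \<in> geig {c}"
    by (intro geigI[of "replicate n c"]) (auto simp: shifts_replicate)
qed

text \<open>Coprimality of \<open>X - d\<close> and the polynomial with roots \<open>cs\<close>.\<close>

lemma shift_invertible:
  assumes "subspace K" "\<And>x. x \<in> K \<Longrightarrow> h x \<in> K"
    and "x \<in> K" "shifts cs x = 0" "d \<notin> set cs"
  obtains y where "y \<in> K" "shifts cs y = 0" "shift d y = x"
proof -
  have "\<exists>y\<in>K. shifts cs y = 0 \<and> shift d y = x"
    using assms(3-5)
  proof (induction cs arbitrary: x)
    case Nil
    then show ?case by auto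
  next
    case (Cons c cs)
    have "shift c x \<in> K"
      using Cons.prems assms(1,2) by (auto simp: shift_def intro: subspace_diff subspace_scale)
    with Cons obtain y where y: "y \<in> K" "shifts cs y = 0" "shift d y = shift c x" by auto
    have cd: "c - d \<noteq> 0" using Cons.prems by auto
    \<comment> \<open>Since \<open>shift d y = shift c x\<close>, applying \<open>shift d\<close> to
      x - y leaves (c - d) x, so x - y only has to be divided by c - d.\<close>
    let ?z = "(1 / (c - d)) *s (x - y)"
    have "shift d (x - y) = (c - d) *s x"
      using y(3) by (simp add: shift_diff) (simp add: shift_def algebra_simps)
    then have "shift d ?z = x" using cd by (simp add: shift_scale)
    moreover have "shift c (x - y) = (c - d) *s y"
    proof -
      have "shift c (x - y) = shift d y - shift c y" by (simp add: shift_diff y(3))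
      then show ?thesis by (simp add: shift_def algebra_simps)
    qed
    then have "shift c ?z = y" using cd by (simp add: shift_scale)
    then have "shifts (c # cs) ?z = 0" using y by simp
    moreover have "?z \<in> K" using assms(1) Cons.prems y by (auto intro: subspace_diff subspace_scale)
    ultimately show ?case by blast
  qed
  then show thesis using that by blast
qed

lemma shifts_eigen:
  "h x = d *s x \<Longrightarrow> \<exists>a. shifts cs x = a *s x \<and> (d \<notin> set cs \<longrightarrow> a \<noteq> 0)"
proof (induction cs)
  case Nil
  then show ?case by (intro exI[of _ 1]) simp
next
  case (Cons c cs)
  then obtain a where "shifts cs x = a *s x" "d \<notin> set cs \<longrightarrow> a \<noteq> 0" by auto
  moreover have "shifts (c # cs) x = (d - c) *s shifts cs x"
    using shift_eigen[OF Cons.prems] by (simp add: shifts_scale)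
  ultimately show ?case by (intro exI[of _ "(d - c) * a"]) auto
qed

lemma shift_injective:
  assumes "shift d x = 0" "shifts cs x = 0" "d \<notin> set cs"
  shows "x = 0"
  using shifts_eigen[of x d cs] assms by (auto simp: shift_def)

text \<open>Induction on the factors for \<Gamma> shows that \<open>shift c x\<close> vanishes, so x
  is an eigenvector for some c in \<Gamma>. A product of factors h - d with all d in \<Delta>
  multiplies it by a nonzero number and yet kills it.\<close>

lemma geig_disjoint:
  assumes "\<Gamma> \<inter> \<Delta> = {}" "x \<in> geig \<Gamma>" "x \<in> geig \<Delta>"
  shows "x = 0"
proof -
  obtain cs ds where cs: "set cs \<subseteq> \<Gamma>" "shifts cs x = 0" and ds: "set ds \<subseteq> \<Delta>" "shifts ds x = 0"
    using assms by (auto simp: geig_def)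
  from cs ds(2) show ?thesis
  proof (induction cs arbitrary: x)
    case (Cons c cs)
    have "shift c x = 0" by (rule Cons.IH) (use Cons.prems in \<open>auto simp: shifts_shift\<close>)
    then show ?case
      by (rule shift_injective[OF _ Cons.prems(3)]) (use Cons.prems ds(1) assms(1) in auto)
  qed simp
qed

text \<open>The subspace K keeps the components inside an invariant subspace; it is used for whole
  modules, for submodules and for the space killed by the positive modes.\<close>

lemma geig_split:
  assumes K: "subspace K" "\<And>x. x \<in> K \<Longrightarrow> h x \<in> K"
    and x: "x \<in> K" "x \<in> geig (\<Gamma> \<union> \<Delta>)" and disj: "\<Gamma> \<inter> \<Delta> = {}"
  obtains y z where "x = y + z" "y \<in> K" "y \<in> geig \<Gamma>" "z \<in> K" "z \<in> geig \<Delta>"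
proof -
  \<comment> \<open>Undoes one factor h - c with c in \<Gamma>: it is invertible on the \<Delta>
    part z, and subtracting a preimage z' of z from x leaves a vector that h - c sends to y.\<close>
  have step: "\<exists>y\<in>K \<inter> geig \<Gamma>. \<exists>z\<in>K \<inter> geig \<Delta>. x = y + z"
    if x: "x \<in> K" "c \<in> \<Gamma>" and disj: "\<Gamma> \<inter> \<Delta> = {}"
      and eq: "shift c x = y + z" "y \<in> K" "y \<in> geig \<Gamma>" "z \<in> K" "z \<in> geig \<Delta>"
    for x c y z \<Gamma> \<Delta>
  proof -
    obtain ds where ds: "set ds \<subseteq> \<Delta>" "shifts ds z = 0" using eq by (auto simp: geig_def)
    then have "c \<notin> set ds" using x disj by auto
    then obtain z' where z': "z' \<in> K" "shifts ds z' = 0" "shift c z' = z"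
      using shift_invertible[OF K, of z ds c] ds eq by blast
    have "shift c (x - z') = y" using eq z' by (simp add: shift_diff)
    moreover obtain cs where "set cs \<subseteq> \<Gamma>" "shifts cs y = 0" using eq by (auto simp: geig_def)
    ultimately have "x - z' \<in> geig \<Gamma>" using x by (intro geigI[of "c # cs"]) auto
    moreover have "z' \<in> geig \<Delta>" using z' ds by (intro geigI[of ds])
    ultimately show ?thesis using x z' K(1)
      by (intro bexI[of _ "x - z'"] bexI[of _ z']) (auto intro: subspace_diff)
  qed
  obtain cs where "set cs \<subseteq> \<Gamma> \<union> \<Delta>" "shifts cs x = 0" using x by (auto simp: geig_def)
  with x(1) have "\<exists>y\<in>K \<inter> geig \<Gamma>. \<exists>z\<in>K \<inter> geig \<Delta>. x = y + z"
  proof (induction cs arbitrary: x)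
    case Nil
    then show ?case using K(1) subspace_geig
      by (intro bexI[of _ 0] bexI[of _ 0]) (auto simp: subspace_0)
  next
    case (Cons c cs)
    have "shift c x \<in> K"
      using Cons.prems K by (auto simp: shift_def intro: subspace_diff subspace_scale)
    then obtain y z where yz: "y \<in> K \<inter> geig \<Gamma>" "z \<in> K \<inter> geig \<Delta>" "shift c x = y + z"
      using Cons.IH[of "shift c x"] Cons.prems by auto
    from Cons.prems have "c \<in> \<Gamma> \<or> c \<in> \<Delta>" by auto
    then show ?case
    proof
      assume "c \<in> \<Gamma>"
      then show ?thesis using step[of x c \<Gamma> \<Delta> y z] Cons.prems yz disj by auto
    next
      assume "c \<in> \<Delta>"
      then have "\<exists>z\<in>K \<inter> geig \<Delta>. \<exists>y\<in>K \<inter> geig \<Gamma>. x = z + y"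
        using step[of x c \<Delta> \<Gamma> z y] Cons.prems yz disj by (auto simp: add.commute)
      then show ?thesis by (metis add.commute)
    qed
  qed
  then show thesis using that by blast
qed

text \<open>The sum is split inside K into its parts for c j and for all other eigenvalues. The
  summands themselves solve the same splitting problem, and disjointness of the two generalized
  eigenspaces makes the solutions equal.\<close>

lemma eigen_component:
  assumes K: "subspace K" "\<And>x. x \<in> K \<Longrightarrow> h x \<in> K"
    and "finite F" "\<And>i. i \<in> F \<Longrightarrow> x i \<in> geig {c i}" "inj_on c F" "sum x F \<in> K" "j \<in> F"
  shows "x j \<in> K"
proof -
  have rest: "(\<Sum>i\<in>F - {j}. x i) \<in> geig (- {c j})"
  proof (rule subspace_sum[OF subspace_geig])
    fix i assume i: "i \<in> F - {j}"
    then have "c i \<noteq> c j" using assms by (auto dest: inj_onD)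
    then show "x i \<in> geig (- {c j})" using assms(4)[of i] geig_mono[of "{c i}" "- {c j}"] i by auto
  qed
  have eq: "sum x F = x j + (\<Sum>i\<in>F - {j}. x i)" using assms by (simp add: sum.remove)
  have xj: "x j \<in> geig {c j}" using assms by auto
  have "sum x F \<in> geig ({c j} \<union> - {c j})"
    unfolding eq using xj rest geig_mono[of _ "{c j} \<union> - {c j}"]
    by (intro subspace_add[OF subspace_geig]) auto
  then obtain y z where yz: "sum x F = y + z" "y \<in> K" "y \<in> geig {c j}" "z \<in> geig (- {c j})"
    using geig_split[OF K assms(6), of "{c j}" "- {c j}"] by blast
  have "y - x j = (\<Sum>i\<in>F - {j}. x i) - z" using yz(1) eq by (simp add: algebra_simps)
  then have "y - x j \<in> geig (- {c j})" using rest yz(4) subspace_diff[OF subspace_geig] by metis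
  moreover have "y - x j \<in> geig {c j}" using xj yz(3) subspace_diff[OF subspace_geig] by metis
  ultimately have "y - x j = 0" by (intro geig_disjoint[of "{c j}" "- {c j}"]) auto
  then show ?thesis using yz by simp
qed

lemma geig_independent:
  assumes "finite F" "\<And>i. i \<in> F \<Longrightarrow> x i \<in> geig {c i}" "inj_on c F" "sum x F = 0" "j \<in> F"
  shows "x j = 0"
  using eigen_component[of "{0}" F x c j] assms by auto

text \<open>Meant for simple factors, on which gamma_(-m) beta_m is diagonalizable. The eigenvectors
  for other eigenvalues are collected in z; as z = x - y, it also lies in the generalized eigenspace
  of c, hence is zero.\<close>

lemma diagonalizable_geig:
  assumes "x \<in> span {y. \<exists>d. h y = d *s y}" "x \<in> geig {c}"
  shows "h x = c *s x"
proof -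
  have "\<exists>y z. x = y + z \<and> h y = c *s y \<and> z \<in> geig (- {c})"
    using assms(1)
  proof (induction rule: span_induct_alt)
    case base
    then show ?case using subspace_0[OF subspace_geig] by (intro exI[of _ 0]) auto
  next
    case (step a u v)
    then obtain y z d where *: "v = y + z" "h y = c *s y" "z \<in> geig (- {c})" "h u = d *s u" by auto
    show ?case
    proof (cases "d = c")
      case True
      then show ?thesis using *
        by (intro exI[of _ "a *s u + y"] exI[of _ z])
          (auto simp: h_add h_scale scale_right_distrib scale_left_commute add.assoc)
    next
      case False
      then have "a *s u + z \<in> geig (- {c})" using *
        by (auto intro!: subspace_add[OF subspace_geig] subspace_scale[OF subspace_geig]
            intro: geig_eigenvector[of u d])
      then show ?thesis using *
        by (intro exI[of _ y] exI[of _ "a *s u + z"]) (auto simp: add.left_commute)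
    qed
  qed
  then obtain y z where yz: "x = y + z" "h y = c *s y" "z \<in> geig (- {c})" by auto
  have "z = x - y" using yz by simp
  also have "\<dots> \<in> geig {c}"
    using assms(2) yz(2) by (intro subspace_diff[OF subspace_geig] geig_eigenvector[of y c]) auto
  finally have "z = 0" using yz(3) geig_disjoint[of "{c}" "- {c}" z] by auto
  with yz(1,2) show ?thesis by (metis add.right_neutral)
qed

end

section \<open>Projection along a subspace\<close>

text \<open>Gives a model of the quotient by Y without a new type: q is linear with kernel Y, and
  its image is a complement of Y.\<close>

lemma (in vector_space) projection_along:
  assumes "subspace Y"
  obtains q where "\<And>x y. q (x + y) = q x + q y" "\<And>c x. q (c *s x) = c *s q x"
    "\<And>x. x - q x \<in> Y" "\<And>y. y \<in> Y \<Longrightarrow> q y = 0"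
proof -
  interpret P: vector_space_pair scale scale by unfold_locales
  obtain B where B: "B \<subseteq> Y" "independent B" "span B = Y"
    using maximal_independent_subset[of Y] assms by (metis span_eq_iff span_mono subset_antisym)
  define q where "q = P.construct (extend_basis B) (\<lambda>b. if b \<in> B then 0 else b)"
  have lin: "Vector_Spaces.linear scale scale q" unfolding q_def using B independent_extend_basis P.linear_construct by blast
  interpret q: Vector_Spaces.linear scale scale q by (rule lin)
  have qb: "q b = (if b \<in> B then 0 else b)" if "b \<in> extend_basis B" for b
    unfolding q_def using P.construct_basis[OF independent_extend_basis[OF B(2)] that] .
  have sub: "B \<subseteq> extend_basis B" using B extend_basis_superset by blast
  have "x - q x \<in> Y" for x
  proof -
    have "x \<in> span (extend_basis B)" using B span_extend_basis by auto
    then show ?thesis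
    proof (induction rule: span_induct_alt)
      case base
      then show ?case using assms subspace_0 by auto
    next
      case (step c u v)
      have "u - q u \<in> Y" using qb[OF step(1)] B assms subspace_0 by (auto split: if_splits)
      then have "c *s (u - q u) + (v - q v) \<in> Y"
        using step assms by (intro subspace_add subspace_scale) auto
      then show ?case by (simp add: q.add q.scale algebra_simps)
    qed
  qed
  moreover have "q y = 0" if "y \<in> Y" for y
  proof -
    have "y \<in> span B" using B that by auto
    then show ?thesis
      using qb sub by (induction rule: span_induct_alt) (auto simp: q.add q.scale)
  qed
  ultimately show thesis using that q.add q.scale by blast
qed

section \<open>Modules on a subspace of a vector space\<close>

text \<open>The only generator that does not commute with g; the commutator is 1 or -1. Up to sign
  the two act like a variable and its derivative.\<close>

fun conj_gen :: "bg_gen \<Rightarrow> bg_gen" where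
  "conj_gen (Beta n) = Gamma (- n)"
| "conj_gen (Gamma n) = Beta (- n)"

lemma mode_conj_gen [simp]: "mode (conj_gen g) = - mode g"
  by (cases g) auto

lemma mode_zero_cases: "mode g = 0 \<longleftrightarrow> g = Beta 0 \<or> g = Gamma 0"
  by (cases g) auto

lemma bg_comm_conj_gen: "bg_comm (conj_gen g) h = (if h = g then bg_comm (conj_gen g) g else 0)"
  by (cases g; cases h) auto

lemma bg_comm_conj_gen_square: "bg_comm (conj_gen g) g * bg_comm (conj_gen g) g = 1"
  by (cases g) auto

lemma bg_comm_mode_zero: "mode g + mode h \<noteq> 0 \<Longrightarrow> bg_comm g h = 0"
  by (cases g; cases h) auto

text \<open>The eigenvalue of g under commutation with gamma_(-m) beta_m.\<close>

fun weight :: "int \<Rightarrow> bg_gen \<Rightarrow> complex" where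
  "weight m (Beta n) = (if n = m then 1 else 0)"
| "weight m (Gamma n) = (if n = - m then -1 else 0)"

lemma weight_int: "weight m g \<in> \<int>"
  by (cases g) auto

text \<open>The generators act linearly on the whole type, but the relations are required on C only.
  Submodules, and quotients realized by projections, then fit the same format without a new
  type.\<close>

locale bg_space = vector_space scale
  for scale :: "complex \<Rightarrow> 'a::ab_group_add \<Rightarrow> 'a" (infixr \<open>*s\<close> 75) +
  fixes C :: "'a set" and act :: "bg_gen \<Rightarrow> 'a \<Rightarrow> 'a"
  assumes subspace_C: "subspace C"
    and act_add: "act g (x + y) = act g x + act g y"
    and act_scale: "act g (c *s x) = c *s act g x"
    and act_closed: "x \<in> C \<Longrightarrow> act g x \<in> C"
    and act_comm: "x \<in> C \<Longrightarrow> act g (act h x) - act h (act g x) = bg_comm g h *s x"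
begin

lemma act_zero [simp]: "act g 0 = 0"
  using act_scale[of g 0 0] by simp

lemma act_minus: "act g (- x) = - act g x"
  using act_scale[of g "-1" x] by simp

lemma act_diff: "act g (x - y) = act g x - act g y"
  using act_add[of g x "- y"] by (simp add: act_minus)

lemma act_sum: "act g (sum f A) = (\<Sum>a\<in>A. act g (f a))"
  by (induction A rule: infinite_finite_induct) (auto simp: act_add)

lemma act_swap: "x \<in> C \<Longrightarrow> act g (act h x) = act h (act g x) + bg_comm g h *s x"
  using act_comm[of x g h] by (simp add: algebra_simps)

lemma act_span:
  assumes "x \<in> span B" "\<And>b. b \<in> B \<Longrightarrow> act g b \<in> span B'"
  shows "act g x \<in> span B'"
  using assms(1)
  by (induction rule: span_induct_alt)
    (auto simp: act_add act_scale span_zero intro!: span_add span_scale assms(2))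

text \<open>The summands of J_0 up to constants: for n \<ge> 1 the summand beta_(-n) gamma_n is
  \<open>H (- n)\<close> minus the identity.\<close>

definition H :: "int \<Rightarrow> 'a \<Rightarrow> 'a" where
  "H m x = act (Gamma (- m)) (act (Beta m) x)"

sublocale H: linear_operator scale "H m" for m
  by unfold_locales (auto simp: H_def act_add act_scale)

lemma H_closed: "x \<in> C \<Longrightarrow> H m x \<in> C"
  by (simp add: H_def act_closed)

lemma H_act: "x \<in> C \<Longrightarrow> H m (act g x) = act g (H m x) + weight m g *s act g x"
proof -
  assume x: "x \<in> C"
  have "H m (act g x) = act (Gamma (- m)) (act g (act (Beta m) x)) + bg_comm (Beta m) g *s act (Gamma (- m)) x"
    unfolding H_def act_swap[OF x, of "Beta m" g] by (simp add: act_add act_scale)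
  also have "act (Gamma (- m)) (act g (act (Beta m) x))
      = act g (H m x) + bg_comm (Gamma (- m)) g *s act (Beta m) x"
    unfolding H_def using x by (intro act_swap act_closed)
  finally show ?thesis by (cases g) (auto simp: minus_equation_iff)
qed

definition word :: "bg_gen list \<Rightarrow> 'a \<Rightarrow> 'a" where
  "word w x = foldr act w x"

lemma word_simps [simp]: "word [] x = x" "word (g # w) x = act g (word w x)"
  by (simp_all add: word_def)

lemma word_closed: "x \<in> C \<Longrightarrow> word w x \<in> C"
  by (induction w) (auto simp: act_closed)

lemma word_scale: "word w (c *s x) = c *s word w x"
  by (induction w) (auto simp: act_scale)

lemma word_add: "word w (x + y) = word w x + word w y"
  by (induction w) (auto simp: act_add)

lemma word_zero [simp]: "word w 0 = 0"
  by (induction w) auto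

lemma H_word:
  "x \<in> C \<Longrightarrow> H m (word w x) = word w (H m x) + (\<Sum>g\<leftarrow>w. weight m g) *s word w x"
  by (induction w) (auto simp: H_act word_closed act_add act_scale algebra_simps)

section \<open>Submodules, generation, and the parts of a module with weights in a given set\<close>

definition submod :: "'a set \<Rightarrow> bool" where
  "submod Y \<longleftrightarrow> subspace Y \<and> Y \<subseteq> C \<and> (\<forall>g. \<forall>y\<in>Y. act g y \<in> Y)"

lemma submodD:
  assumes "submod Y"
  shows submod_subspace: "subspace Y" and submod_subset: "x \<in> Y \<Longrightarrow> x \<in> C"
    and submod_act: "x \<in> Y \<Longrightarrow> act g x \<in> Y"
  using assms by (auto simp: submod_def)

lemma submod_zero: "submod {0}"
  by (simp add: submod_def subspace_0[OF subspace_C])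

lemma submod_H: "submod Y \<Longrightarrow> x \<in> Y \<Longrightarrow> H m x \<in> Y"
  by (simp add: H_def submod_act)

lemma submod_word: "submod Y \<Longrightarrow> x \<in> Y \<Longrightarrow> word w x \<in> Y"
  by (induction w) (auto simp: submod_act)

lemma submod_bg_space: "submod Y \<Longrightarrow> bg_space scale Y act"
  by unfold_locales (auto simp: submod_def act_add act_scale intro!: act_comm)

definition gen :: "'a set \<Rightarrow> 'a set" where
  "gen S = span {word w s | w s. s \<in> S}"

lemma gen_base: "x \<in> S \<Longrightarrow> x \<in> gen S"
  unfolding gen_def by (rule span_base) (auto intro!: exI[of _ "[]"])

lemma submod_gen:
  assumes "S \<subseteq> C"
  shows "submod (gen S)"
  unfolding submod_def
proof (intro conjI allI ballI)
  show "gen S \<subseteq> C"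
    unfolding gen_def using assms by (intro span_minimal subspace_C) (auto intro: word_closed)
  fix g x assume "x \<in> gen S"
  then show "act g x \<in> gen S" unfolding gen_def
  proof (rule act_span)
    fix b assume "b \<in> {word w s |w s. s \<in> S}"
    then obtain w s where "b = word w s" "s \<in> S" by auto
    then have "act g b = word (g # w) s" by simp
    then show "act g b \<in> span {word w s |w s. s \<in> S}" using \<open>s \<in> S\<close> by (intro span_base) blast
  qed
qed (simp add: gen_def)

lemma gen_minimal: "submod Y \<Longrightarrow> S \<subseteq> Y \<Longrightarrow> gen S \<subseteq> Y"
  unfolding gen_def by (intro span_minimal) (auto dest: submod_subspace submod_word)

lemma gen_mono: "S \<subseteq> T \<Longrightarrow> gen S \<subseteq> gen T"
  unfolding gen_def by (intro span_mono) auto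

lemma submod_Int: "submod Y \<Longrightarrow> submod Z \<Longrightarrow> submod (Y \<inter> Z)"
  by (auto simp: submod_def subspace_inter)

lemma submod_sum:
  assumes P: "submod P" and Q: "submod Q"
  shows "submod {x + y | x y. x \<in> P \<and> y \<in> Q}"
  unfolding submod_def
proof (intro conjI allI ballI)
  show "subspace {x + y | x y. x \<in> P \<and> y \<in> Q}"
    by (intro subspace_sums submod_subspace P Q)
  show "{x + y | x y. x \<in> P \<and> y \<in> Q} \<subseteq> C"
    using submod_subset[OF P] submod_subset[OF Q] subspace_add[OF subspace_C] by auto
  fix g z assume "z \<in> {x + y | x y. x \<in> P \<and> y \<in> Q}"
  then show "act g z \<in> {x + y | x y. x \<in> P \<and> y \<in> Q}"
    using submod_act[OF P] submod_act[OF Q] by (fastforce simp: act_add)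
qed

text \<open>The generator g moves past one factor \<open>H m\<close> - c at a time, each time
  raising c by the weight of g.\<close>

lemma act_geig:
  assumes "x \<in> C" "x \<in> H.geig m \<Gamma>"
  shows "act g x \<in> H.geig m ((\<lambda>c. c + weight m g) ` \<Gamma>)"
proof -
  obtain cs where cs: "set cs \<subseteq> \<Gamma>" "H.shifts m cs x = 0" using assms by (auto simp: H.geig_def)
  have "H.shifts m (map (\<lambda>c. c + weight m g) cs) (act g x) = act g (H.shifts m cs x)"
    using assms(1)
  proof (induction cs arbitrary: x)
    case (Cons c cs)
    have "H.shift m (c + weight m g) (act g x) = act g (H.shift m c x)"
      using Cons.prems by (simp add: H.shift_def H_act act_diff act_scale algebra_simps)
    moreover have "H.shift m c x \<in> C" using Cons.prems
      by (simp add: H.shift_def subspace_diff subspace_scale subspace_C H_closed)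
    ultimately show ?case using Cons.IH by simp
  qed simp
  with cs show ?thesis by (intro H.geigI[of "map (\<lambda>c. c + weight m g) cs"]) auto
qed

lemma submod_geig:
  assumes "\<And>c n. c \<in> \<Gamma> \<Longrightarrow> n \<in> \<int> \<Longrightarrow> c + n \<in> \<Gamma>"
  shows "submod (C \<inter> H.geig m \<Gamma>)"
  unfolding submod_def
proof (intro conjI allI ballI)
  fix g x assume "x \<in> C \<inter> H.geig m \<Gamma>"
  then have "act g x \<in> H.geig m ((\<lambda>c. c + weight m g) ` \<Gamma>)" by (intro act_geig) auto
  moreover have "(\<lambda>c. c + weight m g) ` \<Gamma> \<subseteq> \<Gamma>" using assms weight_int by auto
  ultimately show "act g x \<in> C \<inter> H.geig m \<Gamma>"
    using H.geig_mono[of "(\<lambda>c. c + weight m g) ` \<Gamma>" \<Gamma> m] \<open>x \<in> C \<inter> H.geig m \<Gamma>\<close>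
    by (blast intro: act_closed)
qed (auto simp: subspace_inter subspace_C H.subspace_geig)

section \<open>Modules induced from the non-negative modes\<close>

text \<open>Expresses that C is a quotient of the module induced from S. That the quotient is not
  proper is a consequence of \<open>induced_meets\<close>, drawn in
  \<open>bg_ind_iso\<close>.\<close>

definition induced_from :: "'a set \<Rightarrow> bool" where
  "induced_from S \<longleftrightarrow> subspace S \<and> S \<subseteq> C \<and> (\<forall>g. \<forall>s\<in>S. mode g = 0 \<longrightarrow> act g s \<in> S) \<and>
     (\<forall>g. \<forall>s\<in>S. mode g > 0 \<longrightarrow> act g s = 0) \<and> C \<subseteq> gen S"

definition creation_words :: "bg_gen list set" where
  "creation_words = {w. \<forall>g\<in>set w. mode g < 0}"

text \<open>The spanning half of the Poincare-Birkhoff-Witt theorem. A generator of non-negative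
  mode is moved to the right through a creation word, each commutator leaving a scalar times a
  shorter word, until it acts within S.\<close>

lemma induced_spanned:
  assumes "induced_from S"
  shows "C \<subseteq> span {word w s | w s. w \<in> creation_words \<and> s \<in> S}" (is "_ \<subseteq> span ?B")
proof -
  have "0 \<in> S" using assms by (simp add: induced_from_def subspace_0)
  then have S: "S \<subseteq> C" "\<And>g s. s \<in> S \<Longrightarrow> mode g \<ge> 0 \<Longrightarrow> act g s \<in> S"
    using assms by (auto simp: induced_from_def order_le_less)
  have neg: "act g x \<in> span ?B" if "mode g < 0" "x \<in> span ?B" for g x
    using that(2)
  proof (rule act_span)
    fix b assume "b \<in> ?B"
    then obtain w s where "b = word w s" "w \<in> creation_words" "s \<in> S" by blast
    then have "act g b = word (g # w) s" "g # w \<in> creation_words" using that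
      by (auto simp: creation_words_def)
    then show "act g b \<in> span ?B" using \<open>s \<in> S\<close> by (intro span_base) blast
  qed
  have nonneg: "act g (word w s) \<in> span ?B" if "mode g \<ge> 0" "w \<in> creation_words" "s \<in> S" for g w s
    using that(2)
  proof (induction w)
    case Nil
    have "act g s = word [] (act g s)" by simp
    then show ?case using S that by (intro span_base) (auto simp: creation_words_def intro!: exI[of _ "[]"])
  next
    case (Cons l w)
    have w: "w \<in> creation_words" "mode l < 0" using Cons.prems by (auto simp: creation_words_def)
    have "act g (act l (word w s)) = act l (act g (word w s)) + bg_comm g l *s word w s"
      using S that by (intro act_swap word_closed) auto
    moreover have "word w s \<in> span ?B" using w that by (intro span_base) blast
    ultimately show ?case using neg[OF w(2) Cons.IH[OF w(1)]] by (simp add: span_add span_scale)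
  qed
  have "submod (span ?B)"
    unfolding submod_def
  proof (intro conjI allI ballI)
    show "span ?B \<subseteq> C" using S by (intro span_minimal subspace_C) (auto intro: word_closed)
    fix g x assume x: "x \<in> span ?B"
    show "act g x \<in> span ?B"
    proof (cases "mode g < 0")
      case False
      then show ?thesis using x nonneg by (intro act_span[OF x]) auto
    qed (use neg x in auto)
  qed simp
  moreover have "S \<subseteq> span ?B"
    by (auto intro!: span_base exI[of _ "[]"] simp: creation_words_def)
  ultimately have "gen S \<subseteq> span ?B" by (rule gen_minimal)
  then show ?thesis using assms by (auto simp: induced_from_def)
qed

text \<open>The operators \<open>number l\<close> count the occurrences of a creation letter \<open>l\<close>.\<close>

definition number :: "bg_gen \<Rightarrow> 'a \<Rightarrow> 'a" where
  "number l x = bg_comm (conj_gen l) l *s act l (act (conj_gen l) x)"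

text \<open>Moving \<open>conj_gen l\<close> past l produces the commutator a second time; as it is
  1 or -1, its square is 1. Every other creation letter commutes with both l and
  \<open>conj_gen l\<close>.\<close>

lemma number_act:
  assumes "x \<in> C" "mode l < 0" "mode l' < 0"
  shows "number l (act l' x) = act l' (number l x) + (if l' = l then act l' x else 0)"
proof -
  have "act l (act l' y) = act l' (act l y)" if "y \<in> C" for y
    using act_swap[OF that, of l l'] bg_comm_mode_zero[of l l'] assms by simp
  then show ?thesis
    using assms(1) act_swap[OF assms(1), of "conj_gen l" l'] bg_comm_conj_gen[of l l'] bg_comm_conj_gen_square[of l]
    by (auto simp: number_def act_closed act_add act_scale scale_right_distrib)
qed

lemma sum_number_word:
  assumes "finite A" "\<And>l. l \<in> A \<Longrightarrow> mode l < 0" "set w \<subseteq> A"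
    and "s \<in> C" "\<And>g. mode g > 0 \<Longrightarrow> act g s = 0"
  shows "(\<Sum>l\<in>A. number l (word w s)) = of_nat (length w) *s word w s"
  using assms(3)
proof (induction w)
  case Nil
  have "number l s = 0" if "l \<in> A" for l
    using assms(2)[OF that] assms(5)[of "conj_gen l"] by (simp add: number_def)
  then show ?case by simp
next
  case (Cons g w)
  have "(\<Sum>l\<in>A. number l (act g (word w s)))
      = (\<Sum>l\<in>A. act g (number l (word w s)) + (if g = l then act g (word w s) else 0))"
    using Cons.prems assms by (intro sum.cong number_act) (auto intro: word_closed)
  also have "\<dots> = act g (\<Sum>l\<in>A. number l (word w s)) + act g (word w s)"
    using Cons.prems assms(1) by (simp add: sum.distrib act_sum)
  finally show ?case using Cons by (simp add: act_scale algebra_simps)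
qed

text \<open>A filtration by word length. In use the alphabet A is finite, so that the operators
  \<open>number l\<close> can be summed over it.\<close>

definition bounded_words :: "'a set \<Rightarrow> bg_gen set \<Rightarrow> nat \<Rightarrow> 'a set" where
  "bounded_words S A D = span {word w s | w s. set w \<subseteq> A \<and> length w \<le> D \<and> s \<in> S}"

lemma bounded_words_base: "set w \<subseteq> A \<Longrightarrow> length w \<le> D \<Longrightarrow> s \<in> S \<Longrightarrow> word w s \<in> bounded_words S A D"
  unfolding bounded_words_def by (rule span_base) blast

lemma bounded_words_mono: "A \<subseteq> A' \<Longrightarrow> D \<le> D' \<Longrightarrow> bounded_words S A D \<subseteq> bounded_words S A' D'"
  unfolding bounded_words_def by (rule span_mono) (use order_trans in blast)

lemma subspace_bounded_words: "subspace (bounded_words S A D)"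
  by (simp add: bounded_words_def)

lemma bounded_words_0: "subspace S \<Longrightarrow> bounded_words S A 0 \<subseteq> S"
  unfolding bounded_words_def by (rule span_minimal) auto

lemma in_bounded_words:
  assumes "induced_from S" "x \<in> C"
  obtains A D where "finite A" "\<And>l. l \<in> A \<Longrightarrow> mode l < 0" "x \<in> bounded_words S A D"
proof -
  have "x \<in> span {word w s | w s. w \<in> creation_words \<and> s \<in> S}"
    using induced_spanned assms by auto
  then have "\<exists>A D. finite A \<and> (\<forall>l\<in>A. mode l < 0) \<and> x \<in> bounded_words S A D"
  proof (induction rule: span_induct_alt)
    case base
    then show ?case using subspace_0[OF subspace_bounded_words] by (intro exI[of _ "{}"]) auto
  next
    case (step c u v)
    then obtain A D w s where *: "finite A" "\<forall>l\<in>A. mode l < 0" "v \<in> bounded_words S A D"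
      "u = word w s" "w \<in> creation_words" "s \<in> S" by blast
    let ?A = "A \<union> set w" and ?D = "max D (length w)"
    have "u \<in> bounded_words S ?A ?D" unfolding * by (intro bounded_words_base *) auto
    moreover have "v \<in> bounded_words S ?A ?D"
      using *(3) bounded_words_mono[of A ?A D ?D S] by auto
    ultimately have "c *s u + v \<in> bounded_words S ?A ?D"
      by (intro subspace_add subspace_scale subspace_bounded_words)
    moreover have "finite ?A" "\<forall>l\<in>?A. mode l < 0" using * by (auto simp: creation_words_def)
    ultimately show ?case by blast
  qed
  then show thesis using that by blast
qed

lemma act_bounded_words_neg:
  assumes "l \<in> A" "x \<in> bounded_words S A D"
  shows "act l x \<in> bounded_words S A (Suc D)"
  using assms(2) unfolding bounded_words_def
proof (rule act_span)
  fix b assume "b \<in> {word w s |w s. set w \<subseteq> A \<and> length w \<le> D \<and> s \<in> S}"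
  then obtain w s where "b = word w s" "set w \<subseteq> A" "length w \<le> D" "s \<in> S" by blast
  then have "act l b = word (l # w) s" "set (l # w) \<subseteq> A" "length (l # w) \<le> Suc D" using assms by auto
  then show "act l b \<in> span {word w s |w s. set w \<subseteq> A \<and> length w \<le> Suc D \<and> s \<in> S}"
    using \<open>s \<in> S\<close> by (intro span_base) blast
qed

text \<open>Each commutator removes one letter, and g kills the vector at the end of the word. For
  the empty word the result is zero, so the truncated subtraction is harmless.\<close>

lemma act_word_pos:
  assumes "S \<subseteq> C" "\<And>s. s \<in> S \<Longrightarrow> act g s = 0" "set w \<subseteq> A" "s \<in> S"
  shows "act g (word w s) \<in> bounded_words S A (length w - 1)"
  using assms(3)
proof (induction w)
  case Nil
  then show ?case using assms subspace_0[OF subspace_bounded_words] by simp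
next
  case (Cons l w)
  have "act g (act l (word w s)) = act l (act g (word w s)) + bg_comm g l *s word w s"
    using assms by (intro act_swap word_closed) auto
  moreover have "word w s \<in> bounded_words S A (length w)"
    using Cons.prems assms by (intro bounded_words_base) auto
  moreover have "act l (act g (word w s)) \<in> bounded_words S A (length w)"
  proof (cases w)
    case Nil
    then show ?thesis using assms subspace_0[OF subspace_bounded_words] by simp
  next
    case (Cons l' w')
    then show ?thesis using Cons.IH \<open>set (l # w) \<subseteq> A\<close> act_bounded_words_neg[of l A _ S "length w - 1"] by simp
  qed
  ultimately show ?case by (simp add: subspace_add subspace_scale subspace_bounded_words)
qed

lemma act_bounded_words_pos:
  assumes "induced_from S" "mode g > 0" "x \<in> bounded_words S A D"
  shows "act g x \<in> bounded_words S A (D - 1)" "D = 0 \<Longrightarrow> act g x = 0"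
proof -
  have S: "S \<subseteq> C" "\<And>s. s \<in> S \<Longrightarrow> act g s = 0" using assms by (auto simp: induced_from_def)
  show "act g x \<in> bounded_words S A (D - 1)"
    unfolding bounded_words_def
  proof (rule act_span[OF assms(3)[unfolded bounded_words_def]])
    fix b assume "b \<in> {word w s |w s. set w \<subseteq> A \<and> length w \<le> D \<and> s \<in> S}"
    then obtain w s where b: "b = word w s" "set w \<subseteq> A" "length w \<le> D" "s \<in> S" by blast
    then have "act g b \<in> bounded_words S A (length w - 1)" using act_word_pos[OF S] by auto
    then show "act g b \<in> span {word w s |w s. set w \<subseteq> A \<and> length w \<le> D - 1 \<and> s \<in> S}"
      using bounded_words_mono[of A A "length w - 1" "D - 1" S] b(3) diff_le_mono[OF b(3), of 1]
      unfolding bounded_words_def by blast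
  qed
  assume "D = 0"
  then have "x \<in> S" using assms bounded_words_0 by (auto simp: induced_from_def)
  then show "act g x = 0" using S by auto
qed

lemma induced_nilpotent:
  assumes "induced_from S" "mode g > 0" "x \<in> C"
  obtains n where "(act g ^^ n) x = 0"
proof -
  obtain A D where "x \<in> bounded_words S A D" using in_bounded_words[OF assms(1,3)] by blast
  then have "(act g ^^ Suc D) x = 0"
  proof (induction D arbitrary: x)
    case 0
    then show ?case using act_bounded_words_pos(2)[OF assms(1,2)] by simp
  next
    case (Suc D)
    then have "act g x \<in> bounded_words S A D" using act_bounded_words_pos(1)[OF assms(1,2)] by fastforce
    then have "(act g ^^ Suc D) (act g x) = 0" by (rule Suc.IH)
    then show ?case by (simp only: funpow_Suc_right o_apply)
  qed
  then show thesis by (rule that)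
qed

text \<open>For each creation letter the conjugate generator has positive mode, so every
  \<open>number l\<close> kills x. On words of length at most D + 1 the sum of these operators is D
  + 1 up to shorter words. Hence (D + 1) x lies in the span of shorter words, and the bound on the
  length descends to 0.\<close>

lemma induced_top:
  assumes ind: "induced_from S" and x: "x \<in> C" "\<And>g. mode g > 0 \<Longrightarrow> act g x = 0"
  shows "x \<in> S"
proof -
  obtain A D where A: "finite A" "\<And>l. l \<in> A \<Longrightarrow> mode l < 0" and "x \<in> bounded_words S A D"
    using in_bounded_words[OF ind x(1)] by blast
  have num: "(\<Sum>l\<in>A. number l x) = 0" using A x(2) by (simp add: number_def)
  from \<open>x \<in> bounded_words S A D\<close> show "x \<in> S"
  proof (induction D)
    case 0
    then show ?case using ind bounded_words_0 by (auto simp: induced_from_def)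
  next
    case (Suc D)
    have "(\<Sum>l\<in>A. number l y) - of_nat (Suc D) *s y \<in> bounded_words S A D"
      if "y \<in> bounded_words S A (Suc D)" for y
      using that unfolding bounded_words_def[of S A "Suc D"]
    proof (induction rule: span_induct_alt)
      case base
      then show ?case using subspace_0[OF subspace_bounded_words] by (simp add: number_def)
    next
      case (step c u v)
      then obtain w s where u: "u = word w s" "set w \<subseteq> A" "length w \<le> Suc D" "s \<in> S" by blast
      have s: "s \<in> C" "\<And>g. mode g > 0 \<Longrightarrow> act g s = 0" using u ind by (auto simp: induced_from_def)
      have "(\<Sum>l\<in>A. number l u) - of_nat (Suc D) *s u \<in> bounded_words S A D"
      proof (cases "length w = Suc D")
        case True
        then show ?thesis using sum_number_word[OF A u(2) s] u subspace_0[OF subspace_bounded_words] by simp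
      next
        case False
        then have "u \<in> bounded_words S A D" using u by (auto intro: bounded_words_base)
        then show ?thesis using sum_number_word[OF A u(2) s] u(1)
          by (auto intro: subspace_diff subspace_scale subspace_bounded_words)
      qed
      then have "c *s ((\<Sum>l\<in>A. number l u) - of_nat (Suc D) *s u)
        + ((\<Sum>l\<in>A. number l v) - of_nat (Suc D) *s v) \<in> bounded_words S A D"
        using step by (intro subspace_add subspace_scale subspace_bounded_words)
      moreover have "number l (c *s u + v) = c *s number l u + number l v" for l
        by (simp add: number_def act_add act_scale algebra_simps)
      ultimately show ?case
        by (simp add: sum.distrib scale_right_diff_distrib scale_right_distrib scale_sum_right
            scale_left_commute[of c] algebra_simps del: of_nat_Suc)
    qed
    from this[OF Suc.prems] have "- (of_nat (Suc D) *s x) \<in> bounded_words S A D" using num by simp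
    then have "(- 1 / of_nat (Suc D)) *s (- (of_nat (Suc D) *s x)) \<in> bounded_words S A D"
      by (intro subspace_scale subspace_bounded_words)
    then have "x \<in> bounded_words S A D" by (simp del: of_nat_Suc)
    then show ?case by (rule Suc.IH)
  qed
qed

text \<open>Positive modes lower the word length, so applying them to a nonzero vector of K as long
  as the result is nonzero ends in a nonzero vector killed by all of them;
  \<open>induced_top\<close> places it in S.\<close>

lemma induced_meets:
  assumes ind: "induced_from S" and K: "submod K" "K \<noteq> {0}"
  obtains s where "s \<in> S" "s \<in> K" "s \<noteq> 0"
proof -
  obtain x where x: "x \<in> K" "x \<noteq> 0" using K subspace_0[OF submod_subspace] by blast
  obtain A D where "x \<in> bounded_words S A D"
    using in_bounded_words[OF ind submod_subset[OF K(1) x(1)]] by blast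
  then have "\<exists>s\<in>S \<inter> K. s \<noteq> 0" using x
  proof (induction D arbitrary: x)
    case 0
    then show ?case using ind bounded_words_0 by (auto simp: induced_from_def)
  next
    case (Suc D)
    show ?case
    proof (cases "\<exists>g. mode g > 0 \<and> act g x \<noteq> 0")
      case True
      then obtain g where g: "mode g > 0" "act g x \<noteq> 0" by blast
      then have "act g x \<in> bounded_words S A D"
        using act_bounded_words_pos(1)[OF ind g(1) Suc.prems(1)] by simp
      then show ?thesis using Suc g K by (auto intro: submod_act)
    next
      case False
      then have "x \<in> S" using induced_top[OF ind submod_subset[OF K(1)]] Suc by auto
      then show ?thesis using Suc by auto
    qed
  qed
  then show thesis using that by blast
qed

text \<open>For m > 0 the factor beta_m kills s. For m < 0 the factor gamma_(-m) does so once the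
  two are exchanged, and the commutator leaves s itself.\<close>

lemma H_top:
  assumes "s \<in> C" "\<And>g. mode g > 0 \<Longrightarrow> act g s = 0" "m \<noteq> 0"
  shows "H m s = (if m > 0 then 0 else 1) *s s"
proof (cases "m > 0")
  case True
  then show ?thesis using assms by (simp add: H_def)
next
  case False
  then have "act (Gamma (- m)) s = 0" using assms by simp
  then show ?thesis using act_swap[OF assms(1), of "Gamma (- m)" "Beta m"] False by (simp add: H_def)
qed

section \<open>The simple modules\<close>

text \<open>
  A common description of \<open>V\<close> (where \<open>\<mu> = 0\<close> and \<open>v n\<close> is the \<open>n\<close>-th power of \<open>\<gamma>\<^sub>0\<close>) and of \<open>W\<close>
  (where \<open>\<mu>\<close> is not an integer and \<open>v n\<close> is the power of \<open>\<gamma>\<^sub>0\<close> with exponent \<open>n - \<mu>\<close>).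
\<close>

definition standard :: "complex \<Rightarrow> (int \<Rightarrow> 'a) \<Rightarrow> bool" where
  "standard \<mu> v \<longleftrightarrow> (\<forall>n. v n \<in> C) \<and>
     (\<forall>n. \<mu> \<notin> \<int> \<or> n \<ge> 0 \<longrightarrow> act (Gamma 0) (v n) = v (n + 1)) \<and>
     (\<forall>n. act (Beta 0) (v n) = (\<mu> - of_int n) *s v (n - 1)) \<and>
     (\<forall>n g. mode g > 0 \<longrightarrow> act g (v n) = 0) \<and>
     (\<mu> \<notin> \<int> \<or> \<mu> = 0 \<and> (\<forall>n<0. v n = 0)) \<and> C \<subseteq> gen (range v)"

text \<open>The class of \<mu> shows only at m = 0; for every other m the operator
  \<open>H m\<close> has integral eigenvalues on a standard module. For V the two cases
  agree.\<close>

definition standard_eigenvalues :: "complex \<Rightarrow> int \<Rightarrow> complex set" where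
  "standard_eigenvalues \<mu> m = (if m = 0 then {\<mu> + c | c. c \<in> \<int>} else \<int>)"

lemma standard_induced:
  assumes "standard \<mu> v"
  shows "induced_from (span (range v))"
  unfolding induced_from_def
proof (intro conjI allI ballI impI)
  have "range v \<subseteq> C" using assms by (auto simp: standard_def)
  then show "span (range v) \<subseteq> C" by (intro span_minimal subspace_C)
  fix g s assume s: "s \<in> span (range v)"
  {
    assume "mode g = 0"
    have v: "v n \<in> span (range v)" for n by (rule span_base) simp
    have "act (Gamma 0) (v n) \<in> span (range v)" for n
    proof (cases "\<mu> \<notin> \<int> \<or> n \<ge> 0")
      case True
      then show ?thesis using assms v by (auto simp: standard_def)
    next
      case False
      then have "v n = 0" using assms by (auto simp: standard_def)
      then show ?thesis by (simp add: span_zero)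
    qed
    moreover have "act (Beta 0) (v n) \<in> span (range v)" for n
      using assms v by (simp add: standard_def span_scale)
    ultimately show "act g s \<in> span (range v)" using \<open>mode g = 0\<close>
      by (intro act_span[OF s]) (auto simp: mode_zero_cases)
  next
    assume "mode g > 0"
    then have "act g s \<in> span {}" using assms by (intro act_span[OF s]) (auto simp: standard_def span_zero)
    then show "act g s = 0" by simp
  }
next
  show "C \<subseteq> gen (span (range v))"
    using assms gen_mono[OF span_superset, of "range v"] by (auto simp: standard_def)
qed auto

lemma standard_H0:
  assumes "standard \<mu> v"
  shows "H 0 (v n) = (\<mu> - of_int n) *s v n"
proof -
  have H: "H 0 (v n) = (\<mu> - of_int n) *s act (Gamma 0) (v (n - 1))"
    using assms by (simp add: standard_def H_def act_scale)
  show ?thesis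
  proof (cases "\<mu> \<notin> \<int> \<or> n > 0")
    case True
    then have "act (Gamma 0) (v (n - 1)) = v n" using assms by (auto simp: standard_def)
    then show ?thesis using H by simp
  next
    case False
    \<comment> \<open>Only V with n \<le> 0 remains: at n = 0 the coefficient vanishes, and for n <
      0 the vector v n does.\<close>
    then have "\<mu> = 0" "v (n - 1) = 0" "n < 0 \<longrightarrow> v n = 0" using assms by (auto simp: standard_def)
    then show ?thesis using H False by (cases "n = 0") auto
  qed
qed

text \<open>A creation word applied to v n is an eigenvector of \<open>H m\<close>; its eigenvalue
  is that of v n plus the integral weights of the letters.\<close>

lemma standard_diagonalizable:
  assumes "standard \<mu> v"
  shows "C \<subseteq> span {x \<in> C. \<exists>c\<in>standard_eigenvalues \<mu> m. H m x = c *s x}" (is "_ \<subseteq> span ?E")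
proof -
  have v: "v n \<in> C" "\<And>g. mode g > 0 \<Longrightarrow> act g (v n) = 0" for n
    using assms by (auto simp: standard_def)
  have "word w (v n) \<in> ?E" if w: "w \<in> creation_words" for w n
  proof -
    have "\<exists>c\<in>standard_eigenvalues \<mu> m. H m (v n) = c *s v n"
    proof (cases "m = 0")
      case True
      then show ?thesis using standard_H0[OF assms, of n]
        by (intro bexI[of _ "\<mu> - of_int n"]) (auto simp: standard_eigenvalues_def intro!: exI[of _ "- of_int n"])
    next
      case False
      then show ?thesis using H_top[OF v False, of n]
        by (intro bexI[of _ "if m > 0 then 0 else 1"]) (auto simp: standard_eigenvalues_def)
    qed
    then obtain c where c: "c \<in> standard_eigenvalues \<mu> m" "H m (v n) = c *s v n" by blast
    have "(\<Sum>g\<leftarrow>w. weight m g) \<in> \<int>" by (induction w) (auto simp: weight_int)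
    then have "c + (\<Sum>g\<leftarrow>w. weight m g) \<in> standard_eigenvalues \<mu> m"
      using c(1) by (auto simp: standard_eigenvalues_def add.assoc intro!: Ints_add)
    moreover have "H m (word w (v n)) = (c + (\<Sum>g\<leftarrow>w. weight m g)) *s word w (v n)"
      using H_word[OF v(1)] c by (simp add: word_scale algebra_simps)
    ultimately show ?thesis using v word_closed by blast
  qed
  note E = this
  have *: "word w s \<in> span ?E" if "w \<in> creation_words" "s \<in> span (range v)" for w s
    using that(2)
  proof (induction rule: span_induct_alt)
    case base
    then show ?case by (simp add: span_zero)
  next
    case (step c x y)
    then obtain n where "x = v n" by auto
    then have "word w x \<in> span ?E" using E[OF that(1)] span_base by blast
    then show ?case using step(2) by (simp add: word_add word_scale span_add span_scale)
  qed
  have "span {word w s | w s. w \<in> creation_words \<and> s \<in> span (range v)} \<subseteq> span ?E"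
    using * by (intro span_minimal) auto
  then show ?thesis using induced_spanned[OF standard_induced[OF assms]] by blast
qed

lemma standard_geig:
  assumes "standard \<mu> v"
  shows "C \<subseteq> H.geig m (standard_eigenvalues \<mu> m)"
  using standard_diagonalizable[OF assms, of m]
    span_minimal[OF _ H.subspace_geig, of "{x \<in> C. \<exists>c\<in>standard_eigenvalues \<mu> m. H m x = c *s x}" m "standard_eigenvalues \<mu> m"]
  by (auto intro: H.geig_eigenvector)

lemma standard_geig_eigen:
  assumes "standard \<mu> v" "x \<in> C" "x \<in> H.geig m {c}"
  shows "H m x = c *s x"
proof (rule H.diagonalizable_geig[OF _ assms(3)])
  have "{x \<in> C. \<exists>c\<in>standard_eigenvalues \<mu> m. H m x = c *s x} \<subseteq> {x. \<exists>c. H m x = c *s x}" by auto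
  from span_mono[OF this] show "x \<in> span {x. \<exists>c. H m x = c *s x}"
    using standard_diagonalizable[OF assms(1), of m] assms(2) by auto
qed

lemma span_range_sum:
  assumes "x \<in> span (range (v :: 'i \<Rightarrow> 'a))"
  obtains F a where "finite F" "x = (\<Sum>n\<in>F. a n *s v n)"
proof -
  have "\<exists>F a. finite F \<and> x = (\<Sum>n\<in>F. a n *s v n)"
    using assms
  proof (induction rule: span_induct_alt)
    case base
    then show ?case by (intro exI[of _ "{}"]) auto
  next
    case (step c x y)
    then obtain F a n where *: "finite F" "y = (\<Sum>n\<in>F. a n *s v n)" "x = v n" by auto
    define a' where "a' i = (if i \<in> F then a i else 0) + (if i = n then c else 0)" for i
    have "(\<Sum>i\<in>insert n F. a' i *s v i)
        = (\<Sum>i\<in>insert n F. (if i \<in> F then a i else 0) *s v i) + (\<Sum>i\<in>insert n F. (if i = n then c else 0) *s v i)"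
      by (simp add: a'_def scale_left_distrib sum.distrib)
    also have "(\<Sum>i\<in>insert n F. (if i \<in> F then a i else 0) *s v i) = y"
      unfolding *(2) using *(1) by (intro sum.mono_neutral_cong_right) auto
    also have "(\<Sum>i\<in>insert n F. (if i = n then c else 0) *s v i) = c *s x"
      using *(1,3) by (subst sum.remove[of _ n]) (auto intro!: sum.neutral)
    finally show ?case using *(1) by (intro exI[of _ "insert n F"] exI[of _ a']) (auto simp: add.commute)
  qed
  then show thesis using that by blast
qed

text \<open>A nonzero submodule contains a nonzero combination of the v n and, by separation of the
  distinct eigenvalues of \<open>H 0\<close>, a single nonzero v n. From there gamma_0 reaches the
  larger indices and beta_0 the smaller ones.\<close>

lemma standard_simple:
  assumes std: "standard \<mu> v" and K: "submod K"
  shows "K = {0} \<or> K = C"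
proof (cases "K = {0}")
  case False
  obtain s where s: "s \<in> span (range v)" "s \<in> K" "s \<noteq> 0"
    using induced_meets[OF standard_induced[OF std] K False] by blast
  then obtain F a where F: "finite F" "s = (\<Sum>n\<in>F. a n *s v n)" using span_range_sum by blast
  have "(\<Sum>n\<in>F. a n *s v n) \<noteq> 0" using F(2) s(3) by blast
  then obtain n where n: "n \<in> F" "a n *s v n \<noteq> 0" by (rule sum.not_neutral_contains_not_neutral)
  have "a n *s v n \<in> K"
  proof (rule H.eigen_component[of K 0 F "\<lambda>n. a n *s v n" "\<lambda>n. \<mu> - of_int n"])
    show "a i *s v i \<in> H.geig 0 {\<mu> - of_int i}" for i
      by (intro subspace_scale H.subspace_geig H.geig_eigenvector[OF standard_H0[OF std]]) simp
  qed (use K F s n in \<open>auto simp: submod_subspace submod_H inj_on_def\<close>)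
  then have "(1 / a n) *s (a n *s v n) \<in> K" by (rule subspace_scale[OF submod_subspace[OF K]])
  with n have vn: "v n \<in> K" by simp
  \<comment> \<open>For V a nonzero v n has n \<ge> 0, so gamma_0 raises every index from n
    on.\<close>
  have n0: "\<mu> \<notin> \<int> \<or> n \<ge> 0" using std n(2) by (force simp: standard_def)
  have up: "v (m + 1) \<in> K" if "v m \<in> K" "n \<le> m" for m
  proof -
    have "act (Gamma 0) (v m) = v (m + 1)" using std n0 that(2) by (auto simp: standard_def)
    then show ?thesis using submod_act[OF K that(1), of "Gamma 0"] by simp
  qed
  have down: "v (m - 1) \<in> K" if "v m \<in> K" for m
  proof (cases "\<mu> = of_int m")
    case True
    \<comment> \<open>An integral \<mu> occurs only for V, where \<mu> = 0; thus m = 0, and v (-1)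
      vanishes.\<close>
    then have "v (m - 1) = 0" using std by (auto simp: standard_def)
    then show ?thesis using K by (simp add: subspace_0 submod_subspace)
  next
    case False
    have "act (Beta 0) (v m) \<in> K" using submod_act[OF K that] .
    then have "(1 / (\<mu> - of_int m)) *s act (Beta 0) (v m) \<in> K"
      using K by (intro subspace_scale submod_subspace)
    then show ?thesis using std False by (simp add: standard_def)
  qed
  have "v m \<in> K" for m
    by (rule int_induct[of "\<lambda>m. v m \<in> K" n m]) (use vn up down in auto)
  then have "gen (range v) \<subseteq> K" using K by (intro gen_minimal) auto
  then show ?thesis using std submod_subset[OF K] by (auto simp: standard_def)
qed simp

lemma standard_nilpotent:
  assumes "standard \<mu> v" "mode g > 0" "x \<in> C"
  obtains n where "(act g ^^ n) x = 0"
  using induced_nilpotent[OF standard_induced[OF assms(1)] assms(2,3)] by blast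

end

section \<open>Composition series\<close>

lemma bg_comm_sigma: "bg_comm (bg_sigma m g) (bg_sigma m h) = bg_comm g h"
  by (cases g; cases h) auto

lemma bg_sigma_inverse: "bg_sigma m (bg_sigma (- m) g) = g" "bg_sigma (- m) (bg_sigma m g) = g"
  by (cases g; simp)+

lemma (in vector_space) subspace_additive_image:
  assumes "\<And>x y. q (x + y) = q x + q y" "\<And>c x. q (c *s x) = c *s q x" "subspace X"
  shows "subspace (q ` X)"
proof (rule subspaceI)
  show "0 \<in> q ` X" using assms(2)[of 0 0] subspace_0[OF assms(3)] by force
next
  fix x y assume "x \<in> q ` X" "y \<in> q ` X"
  then show "x + y \<in> q ` X" using subspace_add[OF assms(3)] by (auto simp flip: assms(1))
next
  fix c x assume "x \<in> q ` X"
  then show "c *s x \<in> q ` X" using subspace_scale[OF assms(3)] by (auto simp flip: assms(2))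
qed

text \<open>The relations are required only modulo Y. The same construction therefore serves for
  quotients of modules and for modules presented as formal linear combinations modulo
  relations.\<close>

lemma quotient_bg_space:
  fixes scale :: "complex \<Rightarrow> 'a::ab_group_add \<Rightarrow> 'a" and act :: "bg_gen \<Rightarrow> 'a \<Rightarrow> 'a"
  assumes vs: "vector_space scale"
    and act: "\<And>g x y. act g (x + y) = act g x + act g y" "\<And>g c x. act g (scale c x) = scale c (act g x)"
    and X: "module.subspace scale X" "\<And>g x. x \<in> X \<Longrightarrow> act g x \<in> X"
    and Y: "module.subspace scale Y" "\<And>g x. x \<in> Y \<Longrightarrow> act g x \<in> Y" "Y \<subseteq> X"
    and comm: "\<And>g h x. x \<in> X \<Longrightarrow> act g (act h x) - act h (act g x) - scale (bg_comm g h) x \<in> Y"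
  obtains q where "\<And>x y. q (x + y) = q x + q y" "\<And>c x. q (scale c x) = scale c (q x)"
    "\<And>x. x - q x \<in> Y" "\<And>x. q x = 0 \<longleftrightarrow> x \<in> Y" "bg_space scale (q ` X) (\<lambda>g x. q (act g x))"
    "\<And>g x. q (act g (q x)) = q (act g x)"
proof -
  interpret vector_space scale by (rule vs)
  obtain q where q: "\<And>x y. q (x + y) = q x + q y" "\<And>c x. q (scale c x) = scale c (q x)"
    "\<And>x. x - q x \<in> Y" "\<And>y. y \<in> Y \<Longrightarrow> q y = 0"
    by (rule projection_along[OF Y(1)]) (rule that)
  have q0: "q x = 0 \<longleftrightarrow> x \<in> Y" for x using q(3)[of x] q(4)[of x] by auto
  have qd: "q (x - y) = q x - q y" for x y
    using q(1)[of "x - y" y] by (simp add: algebra_simps)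
  have ad: "act g (x - y) = act g x - act g y" for g x y
    using act(1)[of g "x - y" y] by (simp add: algebra_simps)
  have qact: "q (act g (q x)) = q (act g x)" for g x
  proof -
    have "q (act g (x - q x)) = 0" using Y(2)[OF q(3)] by (simp add: q0)
    then show ?thesis by (simp add: ad qd)
  qed
  have "bg_space scale (q ` X) (\<lambda>g x. q (act g x))"
  proof unfold_locales
    show "subspace (q ` X)" by (rule subspace_additive_image[OF q(1,2) X(1)])
  next
    fix g x assume "x \<in> q ` X"
    then obtain y where "x = q y" "y \<in> X" by auto
    then show "q (act g x) \<in> q ` X" using X(2) by (simp add: qact)
  next
    fix g h x assume "x \<in> q ` X"
    then obtain y where y: "x = q y" "y \<in> X" by auto
    have "q (act g (q (act h x))) - q (act h (q (act g x)))
        = q (act g (act h y) - act h (act g y) - scale (bg_comm g h) y) + q (scale (bg_comm g h) y)"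
      by (simp only: y(1) qact qd) simp
    also have "\<dots> = scale (bg_comm g h) x" using q(4)[OF comm[OF y(2)]] by (simp add: q(2) y(1))
    finally show "q (act g (q (act h x))) - q (act h (q (act g x))) = scale (bg_comm g h) x" .
  qed (auto simp: q act)
  then show thesis by (rule that[OF q(1-3) q0 _ qact])
qed

context bg_space
begin

lemma bg_space_flow: "bg_space scale C (\<lambda>g. act (bg_sigma m g))"
  by unfold_locales (auto simp: subspace_C act_add act_scale act_closed act_comm bg_comm_sigma)

text \<open>The flow moves the indices of beta_j and gamma_(-j) in opposite directions, so their
  product keeps its form.\<close>

lemma H_flow: "bg_space.H (\<lambda>g. act (bg_sigma m g)) j = H (j - m)"
  using bg_space.H_def[OF bg_space_flow] by (auto simp: fun_eq_iff H_def)

lemma submod_flow: "bg_space.submod scale C (\<lambda>g. act (bg_sigma m g)) Y \<longleftrightarrow> submod Y"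
  unfolding bg_space.submod_def[OF bg_space_flow] submod_def
  by (metis bg_sigma_inverse(1))

section \<open>Quotients by submodules and the simple layers of a module\<close>

lemma quotient:
  assumes X: "submod X" and Y: "submod Y" "Y \<subseteq> X"
  obtains q where "\<And>x y. q (x + y) = q x + q y" "\<And>c x. q (c *s x) = c *s q x"
    "\<And>x. x - q x \<in> Y" "\<And>x. q x = 0 \<longleftrightarrow> x \<in> Y" "bg_space scale (q ` X) (\<lambda>g x. q (act g x))"
    "\<And>g x. q (act g (q x)) = q (act g x)"
proof (rule quotient_bg_space[where scale = scale and act = act and X = X and Y = Y])
  show "act g (act h x) - act h (act g x) - bg_comm g h *s x \<in> Y" if "x \<in> X" for g h x
    using act_comm[OF submod_subset[OF X that]] subspace_0[OF submod_subspace[OF Y(1)]] by simp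
qed (use that in \<open>auto simp: vector_space_axioms act_add act_scale submod_subspace[OF X] submod_subspace[OF Y(1)]
    submod_act[OF X] submod_act[OF Y(1)] Y(2)\<close>)

text \<open>
  \<open>X / Y\<close> is the spectral flow by \<open>m\<close> of a standard module, with generators the classes of
  \<open>v n\<close>; the case \<open>X = Y\<close> is not excluded.
\<close>

definition simple_step :: "int \<Rightarrow> complex \<Rightarrow> (int \<Rightarrow> 'a) \<Rightarrow> 'a set \<Rightarrow> 'a set \<Rightarrow> bool" where
  "simple_step m \<mu> v Y X \<longleftrightarrow> submod Y \<and> submod X \<and> Y \<subseteq> X \<and> (\<forall>n. v n \<in> X) \<and>
     (\<forall>n. \<mu> \<notin> \<int> \<or> n \<ge> 0 \<longrightarrow> act (bg_sigma m (Gamma 0)) (v n) - v (n + 1) \<in> Y) \<and>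
     (\<forall>n. act (bg_sigma m (Beta 0)) (v n) - (\<mu> - of_int n) *s v (n - 1) \<in> Y) \<and>
     (\<forall>n g. mode g > 0 \<longrightarrow> act (bg_sigma m g) (v n) \<in> Y) \<and>
     (\<mu> \<notin> \<int> \<or> \<mu> = 0 \<and> (\<forall>n<0. v n \<in> Y)) \<and>
     (\<forall>Z. submod Z \<longrightarrow> Y \<subseteq> Z \<longrightarrow> range v \<subseteq> Z \<longrightarrow> X \<subseteq> Z)"

text \<open>Realizes X / Y as a \<open>standard\<close> module on which statements about the step
  can be checked. The flow is undone by precomposing the action with
  \<open>bg_sigma m\<close>.\<close>

lemma simple_step_quotient:
  assumes "simple_step m \<mu> v Y X"
  obtains q T A where "\<And>x y. q (x + y) = q x + q y" "\<And>c x. q (c *s x) = c *s q x"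
    "\<And>x. q x = 0 \<longleftrightarrow> x \<in> Y" "T = q ` X" "bg_space scale T A" "\<And>g x. x \<in> X \<Longrightarrow> q (act g x) = A g (q x)"
    "bg_space.standard scale T (\<lambda>g. A (bg_sigma m g)) \<mu> (\<lambda>n. q (v n))"
proof -
  have X: "submod X" and Y: "submod Y" "Y \<subseteq> X" using assms by (auto simp: simple_step_def)
  obtain q where q: "\<And>x y. q (x + y) = q x + q y" "\<And>c x. q (c *s x) = c *s q x"
    "\<And>x. x - q x \<in> Y" "\<And>x. q x = 0 \<longleftrightarrow> x \<in> Y" "bg_space scale (q ` X) (\<lambda>g x. q (act g x))"
    "\<And>g x. q (act g (q x)) = q (act g x)"
    by (rule quotient[OF X Y]) (rule that)
  define A where "A = (\<lambda>g x. q (act g x))"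
  interpret T: bg_space scale "q ` X" A using q(5) by (simp add: A_def)
  have flow: "bg_space scale (q ` X) (\<lambda>g. A (bg_sigma m g))" by (rule T.bg_space_flow)
  interpret F: bg_space scale "q ` X" "\<lambda>g. A (bg_sigma m g)" by (rule flow)
  have eqI: "q x = q y" if "x - y \<in> Y" for x y
    using q(4)[of "x - y"] q(1)[of "x - y" y] that by simp
  have act: "A g (q x) = q (act g x)" if "x \<in> X" for g x using q(6)[of g x] by (simp add: A_def)
  have v: "v n \<in> X" for n using assms by (auto simp: simple_step_def)
  have std: "F.standard \<mu> (\<lambda>n. q (v n))"
    unfolding F.standard_def
  proof (intro conjI allI impI)
    fix n
    show "q (v n) \<in> q ` X" using v by auto
    show "A (bg_sigma m (Gamma 0)) (q (v n)) = q (v (n + 1))" if "\<mu> \<notin> \<int> \<or> n \<ge> 0"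
      using assms that by (simp only: act[OF v]) (auto intro!: eqI simp: simple_step_def)
    show "A (bg_sigma m (Beta 0)) (q (v n)) = (\<mu> - of_int n) *s q (v (n - 1))"
      using assms by (simp only: act[OF v] flip: q(2)) (auto intro!: eqI simp: simple_step_def)
    fix g assume "mode g > 0"
    then show "A (bg_sigma m g) (q (v n)) = 0" using assms by (simp add: act[OF v] q(4) simple_step_def)
  next
    show "\<mu> \<notin> \<int> \<or> \<mu> = 0 \<and> (\<forall>n<0. q (v n) = 0)" using assms by (simp add: q(4) simple_step_def)
    \<comment> \<open>The preimage in X of the submodule generated by the q (v n). It contains Y and
      all v n, so the generation clause of \<open>simple_step\<close> makes it all of X.\<close>
    define Z where "Z = {x \<in> X. q x \<in> F.gen (range (\<lambda>n. q (v n)))}"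
    have sub: "F.submod (F.gen (range (\<lambda>n. q (v n))))" using v by (intro F.submod_gen) auto
    then have sub': "T.submod (F.gen (range (\<lambda>n. q (v n))))" by (simp add: T.submod_flow)
    have "submod Z"
      unfolding submod_def
    proof (intro conjI allI ballI)
      show "subspace Z"
        using subspace_0[OF submod_subspace[OF X]] subspace_add[OF submod_subspace[OF X]]
          subspace_scale[OF submod_subspace[OF X]] F.submod_subspace[OF sub] q(4)[of 0] subspace_0[OF submod_subspace[OF Y(1)]]
        by (intro subspaceI) (auto simp: Z_def q(1,2) subspace_0 subspace_add subspace_scale)
      show "Z \<subseteq> C" using submod_subset[OF X] by (auto simp: Z_def)
      fix g x assume "x \<in> Z"
      then show "act g x \<in> Z" using submod_act[OF X] T.submod_act[OF sub'] by (auto simp: Z_def simp flip: act)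
    qed
    moreover have "Y \<subseteq> Z" using Y subspace_0[OF F.submod_subspace[OF sub]] by (auto simp: Z_def iffD2[OF q(4)])
    moreover have "range v \<subseteq> Z" using v F.gen_base by (auto simp: Z_def)
    ultimately have "X \<subseteq> Z" using assms by (auto simp: simple_step_def)
    then show "q ` X \<subseteq> F.gen (range (\<lambda>n. q (v n)))" by (auto simp: Z_def)
  qed
  show thesis by (rule that[OF q(1,2,4) refl T.bg_space_axioms act[symmetric] std])
qed

text \<open>The image of Z in X / Y is a submodule of a simple module. This controls the trace of a
  filtration on a submodule.\<close>

lemma simple_step_simple:
  assumes st: "simple_step m \<mu> v Y X" and Z: "submod Z" "Y \<subseteq> Z" "Z \<subseteq> X"
  shows "Z = Y \<or> Z = X"
proof -
  obtain q T A where q: "\<And>x y. q (x + y) = q x + q y" "\<And>c x. q (c *s x) = c *s q x"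
    "\<And>x. q x = 0 \<longleftrightarrow> x \<in> Y" "T = q ` X" "bg_space scale T A" "\<And>g x. x \<in> X \<Longrightarrow> q (act g x) = A g (q x)"
    "bg_space.standard scale T (\<lambda>g. A (bg_sigma m g)) \<mu> (\<lambda>n. q (v n))"
    by (rule simple_step_quotient[OF st]) (rule that)
  interpret T: bg_space scale T A by fact
  interpret F: bg_space scale T "\<lambda>g. A (bg_sigma m g)" by (rule T.bg_space_flow)
  have X: "submod X" using st by (auto simp: simple_step_def)
  have "T.submod (q ` Z)"
    unfolding T.submod_def
  proof (intro conjI allI ballI)
    show "subspace (q ` Z)" by (rule subspace_additive_image[OF q(1,2) submod_subspace[OF Z(1)]])
    show "q ` Z \<subseteq> T" using Z q by auto
    fix g x assume "x \<in> q ` Z"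
    then obtain z where z: "x = q z" "z \<in> Z" by auto
    then have "A g x = q (act g z)" using Z(3) q(6) by auto
    then show "A g x \<in> q ` Z" using submod_act[OF Z(1) z(2)] by simp
  qed
  then have "F.submod (q ` Z)" by (simp add: T.submod_flow)
  then have "q ` Z = {0} \<or> q ` Z = T" using F.standard_simple[OF q(7)] by blast
  then show ?thesis
  proof
    assume "q ` Z = {0}"
    then have "Z \<subseteq> Y" using q(3) by auto
    then show ?thesis using Z by auto
  next
    assume *: "q ` Z = T"
    have "x \<in> Z" if x: "x \<in> X" for x
    proof -
      obtain z where z: "z \<in> Z" "q x = q z" using * x q(4) by blast
      then have "q (x - z) = 0" using q(1)[of "x - z" z] by simp
      then have "x - z \<in> Z" using q(3) Z by auto
      then have "x - z + z \<in> Z" using z subspace_add[OF submod_subspace[OF Z(1)]] by blast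
      then show ?thesis by simp
    qed
    then show ?thesis using Z by auto
  qed
qed

text \<open>Undoing the flow by m turns \<open>H j\<close> into \<open>H (j + m)\<close> on the
  standard module, where it is diagonalizable. Hence vectors with other generalized eigenvalues
  already lie in Y, and a generalized eigenvector for c reaches Y after a single factor
  \<open>H j\<close> - c.\<close>

lemma simple_step_geig:
  assumes st: "simple_step m \<mu> v Y X" and x: "x \<in> X"
  shows "\<exists>cs. set cs \<subseteq> standard_eigenvalues \<mu> (j + m) \<and> H.shifts j cs x \<in> Y" (is ?thesis1)
    and "x \<in> H.geig j \<Delta> \<Longrightarrow> \<Delta> \<inter> standard_eigenvalues \<mu> (j + m) = {} \<Longrightarrow> x \<in> Y"
    and "x \<in> H.geig j {c} \<Longrightarrow> H.shift j c x \<in> Y"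
proof -
  obtain q T A where q: "\<And>x y. q (x + y) = q x + q y" "\<And>c x. q (c *s x) = c *s q x"
    "\<And>x. q x = 0 \<longleftrightarrow> x \<in> Y" "T = q ` X" "bg_space scale T A" "\<And>g x. x \<in> X \<Longrightarrow> q (act g x) = A g (q x)"
    "bg_space.standard scale T (\<lambda>g. A (bg_sigma m g)) \<mu> (\<lambda>n. q (v n))"
    by (rule simple_step_quotient[OF st]) (rule that)
  interpret T: bg_space scale T A by fact
  interpret F: bg_space scale T "\<lambda>g. A (bg_sigma m g)" by (rule T.bg_space_flow)
  have X: "submod X" using st by (auto simp: simple_step_def)
  have FH: "F.H (j + m) = T.H j" using T.H_flow[of m "j + m"] by simp
  have qH: "q (H j x) = T.H j (q x)" if "x \<in> X" for x
    using that submod_act[OF X] by (simp add: H_def T.H_def q(6))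
  have qd: "q (x - y) = q x - q y" for x y
    using q(1)[of "x - y" y] by (simp add: algebra_simps)
  have qshift: "q (H.shift j c x) = T.H.shift j c (q x)" "H.shift j c x \<in> X" if "x \<in> X" for x c
    using that subspace_diff[OF submod_subspace[OF X]] subspace_scale[OF submod_subspace[OF X]] submod_H[OF X]
    by (simp_all add: H.shift_def T.H.shift_def qd q(2) qH)
  have qshifts: "q (H.shifts j cs x) = T.H.shifts j cs (q x)" if "x \<in> X" for x cs
    using that by (induction cs arbitrary: x) (auto simp: qshift)
  have qx: "q x \<in> T" using x q(4) by auto
  have geig: "q x \<in> T.H.geig j (standard_eigenvalues \<mu> (j + m))"
    using F.standard_geig[OF q(7), of "j + m"] qx by (auto simp: FH F.H.geig_def T.H.geig_def)
  from geig obtain cs where "set cs \<subseteq> standard_eigenvalues \<mu> (j + m)" "T.H.shifts j cs (q x) = 0"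
    by (auto simp: T.H.geig_def)
  then show ?thesis1 using qshifts[OF x] q(3) by metis
  have qgeig: "q x \<in> T.H.geig j \<Delta>" if xg: "x \<in> H.geig j \<Delta>" for \<Delta>
  proof -
    obtain cs where cs: "set cs \<subseteq> \<Delta>" "H.shifts j cs x = 0" using xg by (auto simp: H.geig_def)
    have "q 0 = 0" using q(2)[of 0 0] by simp
    then have "T.H.shifts j cs (q x) = 0" using qshifts[OF x, of cs] cs(2) by simp
    then show ?thesis using cs(1) by (rule T.H.geigI[rotated])
  qed
  show "x \<in> Y" if "x \<in> H.geig j \<Delta>" "\<Delta> \<inter> standard_eigenvalues \<mu> (j + m) = {}"
    using T.H.geig_disjoint[OF that(2) qgeig[OF that(1)] geig] q(3) by simp
  show "H.shift j c x \<in> Y" if "x \<in> H.geig j {c}"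
  proof -
    have "T.H j (q x) = c *s q x"
      using F.standard_geig_eigen[OF q(7) qx, of "j + m" c] qgeig[OF that] by (simp add: FH)
    then have "q (H.shift j c x) = 0" by (simp add: qshift(1)[OF x] T.H.shift_def)
    then show ?thesis using q(3) by simp
  qed
qed

text \<open>Restricted to flow 0, because a flow by m \<noteq> 0 makes gamma_m (if m > 0) or
  beta_(-m) (if m < 0) act as a zero mode of the standard module.\<close>

lemma simple_step_nilpotent:
  assumes st: "simple_step 0 \<mu> v Y X" and x: "x \<in> X" and g: "mode g > 0"
  obtains n where "(act g ^^ n) x \<in> Y"
proof -
  obtain q T A where q: "\<And>x y. q (x + y) = q x + q y" "\<And>c x. q (c *s x) = c *s q x"
    "\<And>x. q x = 0 \<longleftrightarrow> x \<in> Y" "T = q ` X" "bg_space scale T A" "\<And>g x. x \<in> X \<Longrightarrow> q (act g x) = A g (q x)"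
    "bg_space.standard scale T (\<lambda>g. A (bg_sigma 0 g)) \<mu> (\<lambda>n. q (v n))"
    by (rule simple_step_quotient[OF st]) (rule that)
  interpret T: bg_space scale T A by fact
  have [simp]: "bg_sigma 0 g = g" for g by (cases g) auto
  have X: "submod X" using st by (auto simp: simple_step_def)
  have "T.standard \<mu> (\<lambda>n. q (v n))" using q(7) by simp
  then obtain n where n: "(A g ^^ n) (q x) = 0" using T.standard_nilpotent g x q(4) by blast
  have "(act g ^^ n) x \<in> X \<and> q ((act g ^^ n) x) = (A g ^^ n) (q x)" for n
    by (induction n) (auto simp: x q(6) submod_act[OF X])
  then have "(act g ^^ n) x \<in> Y" using n q(3) by metis
  then show thesis by (rule that)
qed

section \<open>Eigenvalues and nilpotency along a composition chain\<close>

definition composition_chain :: "(nat \<Rightarrow> 'a set) \<Rightarrow> nat \<Rightarrow> bool" where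
  "composition_chain F r \<longleftrightarrow> F 0 = {0} \<and> F r = C \<and> (\<forall>i<r. \<exists>m \<mu> v. simple_step m \<mu> v (F i) (F (Suc i)))"

lemma composition_chain_geig:
  assumes "composition_chain F r"
  shows "C \<subseteq> H.geig j UNIV"
proof -
  have "F i \<subseteq> H.geig j UNIV" if "i \<le> r" for i
    using that
  proof (induction i)
    case 0
    then show ?case using assms subspace_0[OF H.subspace_geig] by (auto simp: composition_chain_def)
  next
    case (Suc i)
    then obtain m \<mu> v where st: "simple_step m \<mu> v (F i) (F (Suc i))"
      using assms by (auto simp: composition_chain_def Suc_le_eq)
    show ?case
    proof
      fix x assume "x \<in> F (Suc i)"
      then obtain cs where "H.shifts j cs x \<in> F i" using simple_step_geig(1)[OF st] by blast
      then obtain ds where "H.shifts j ds (H.shifts j cs x) = 0" using Suc by (force simp: H.geig_def)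
      then show "x \<in> H.geig j UNIV" by (intro H.geigI[of "cs @ ds"]) (auto simp: H.shifts_append)
    qed
  qed
  then show ?thesis using assms by (auto simp: composition_chain_def)
qed

text \<open>Each application of \<open>H j\<close> - c descends one step of the chain, by
  diagonalizability on the factor. The bound is uniform in x, which is what allows a Jordan block of
  maximal size to be chosen later.\<close>

lemma composition_chain_bounded:
  assumes "composition_chain F r" "x \<in> C" "x \<in> H.geig j {c}"
  shows "(H.shift j c ^^ r) x = 0"
proof -
  have "(H.shift j c ^^ i) x = 0" if "i \<le> r" "x \<in> F i" "x \<in> H.geig j {c}" for i x
    using that
  proof (induction i arbitrary: x)
    case 0
    then show ?case using assms by (auto simp: composition_chain_def)
  next
    case (Suc i)
    then obtain m \<mu> v where st: "simple_step m \<mu> v (F i) (F (Suc i))"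
      using assms by (auto simp: composition_chain_def Suc_le_eq)
    have "H.shift j c x \<in> H.geig j {c}"
    proof -
      obtain cs where "set cs \<subseteq> {c}" "H.shifts j cs x = 0" using Suc.prems by (auto simp: H.geig_def)
      then show ?thesis by (intro H.geigI[of cs]) (auto simp: H.shifts_shift)
    qed
    then have "(H.shift j c ^^ i) (H.shift j c x) = 0"
      using Suc simple_step_geig(3)[OF st] by auto
    then show ?case by (simp only: funpow_Suc_right o_apply)
  qed
  then show ?thesis using assms by (auto simp: composition_chain_def)
qed

text \<open>In a step of flow m \<noteq> 0 the eigenvalues of gamma_0 beta_0 are integers, which
  \<Lambda> excludes, so the vectors already lie one step lower. In a step of flow 0 some power of g
  moves the vector one step down.\<close>

lemma composition_chain_nilpotent:
  assumes ch: "composition_chain F r" and geig: "C \<subseteq> H.geig 0 \<Lambda>" "\<Lambda> \<inter> \<int> = {}" and g: "mode g > 0" and "x \<in> C"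
  obtains n where "(act g ^^ n) x = 0"
proof -
  have "\<exists>n. (act g ^^ n) x = 0" if "i \<le> r" "x \<in> F i" for i x
    using that
  proof (induction i arbitrary: x)
    case 0
    then show ?case using ch by (intro exI[of _ 0]) (auto simp: composition_chain_def)
  next
    case (Suc i)
    then obtain m \<mu> v where st: "simple_step m \<mu> v (F i) (F (Suc i))"
      using ch by (auto simp: composition_chain_def Suc_le_eq)
    have "\<exists>n. (act g ^^ n) x \<in> F i"
    proof (cases "m = 0")
      case True
      then show ?thesis using simple_step_nilpotent[of \<mu> v "F i" "F (Suc i)" x g] st Suc.prems g by blast
    next
      case False
      have "x \<in> C" using st Suc.prems by (auto simp: simple_step_def dest: submod_subset)
      then have "x \<in> F i" using simple_step_geig(2)[OF st Suc.prems(2), of 0 \<Lambda>] geig False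
        by (auto simp: standard_eigenvalues_def)
      then show ?thesis by (intro exI[of _ 0]) auto
    qed
    then obtain n k where "(act g ^^ k) ((act g ^^ n) x) = 0" using Suc by (meson Suc_leD)
    then have "(act g ^^ (k + n)) x = 0" by (simp add: funpow_add)
    then show ?case by blast
  qed
  then show thesis using that assms by (auto simp: composition_chain_def)
qed

end

section \<open>Modules on which \<open>\<gamma>\<^sub>0\<beta>\<^sub>0\<close> has eigenvalues in a single non-integral class\<close>

text \<open>A product that kills x has finitely many factors, so \<open>geig_split\<close> separates
  the eigenvalues one by one even when \<Gamma> is infinite.\<close>

lemma (in linear_operator) geig_finite_decomposition:
  assumes K: "subspace K" "\<And>x. x \<in> K \<Longrightarrow> h x \<in> K" and x: "x \<in> K" "x \<in> geig \<Gamma>"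
  shows "x \<in> span (\<Union>c\<in>\<Gamma>. K \<inter> geig {c})"
proof -
  obtain cs where cs: "set cs \<subseteq> \<Gamma>" "shifts cs x = 0" using x by (auto simp: geig_def)
  have "x \<in> span (\<Union>c\<in>F. K \<inter> geig {c})" if "finite F" "x \<in> K" "x \<in> geig F" for F x
    using that
  proof (induction F arbitrary: x rule: finite_induct)
    case empty
    then show ?case by (auto simp: geig_def)
  next
    case (insert c F)
    obtain y z where yz: "x = y + z" "y \<in> K" "y \<in> geig {c}" "z \<in> K" "z \<in> geig F"
      using geig_split[OF K insert.prems(1), of "{c}" F] insert by auto
    have "span (\<Union>c\<in>F. K \<inter> geig {c}) \<subseteq> span (\<Union>c\<in>insert c F. K \<inter> geig {c})"
      by (intro span_mono) auto
    then have "z \<in> span (\<Union>c\<in>insert c F. K \<inter> geig {c})" using insert.IH yz by auto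
    moreover have "y \<in> span (\<Union>c\<in>insert c F. K \<inter> geig {c})" using yz by (intro span_base) auto
    ultimately show ?case using yz(1) span_add by auto
  qed
  from this[of "set cs" x] have "x \<in> span (\<Union>c\<in>set cs. K \<inter> geig {c})"
    using x cs by (auto intro: geigI[of cs])
  moreover have "span (\<Union>c\<in>set cs. K \<inter> geig {c}) \<subseteq> span (\<Union>c\<in>\<Gamma>. K \<inter> geig {c})"
    using cs by (intro span_mono) auto
  ultimately show ?thesis by auto
qed

context bg_space
begin

section \<open>Vectors killed by the positive modes\<close>

definition top :: "'a set" where
  "top = {x \<in> C. \<forall>g. mode g > 0 \<longrightarrow> act g x = 0}"

lemma topD: "x \<in> top \<Longrightarrow> x \<in> C" "x \<in> top \<Longrightarrow> mode g > 0 \<Longrightarrow> act g x = 0"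
  by (auto simp: top_def)

lemma subspace_top: "subspace top"
  by (rule subspaceI)
    (auto simp: top_def act_add act_scale subspace_0 subspace_add subspace_scale subspace_C)

lemma act_top: "x \<in> top \<Longrightarrow> mode g = 0 \<Longrightarrow> act g x \<in> top"
  by (auto simp: top_def act_closed act_swap[of x _ g] bg_comm_mode_zero)

lemma H_top_closed: "x \<in> top \<Longrightarrow> H 0 x \<in> top"
  by (simp add: H_def act_top)

text \<open>The conjugate generator differentiates powers of l. At n = 0 the coefficient vanishes,
  so the truncated exponent n - 1 is harmless.\<close>

lemma conj_power_act:
  assumes "u \<in> C" "act (conj_gen l) u = 0"
  shows "act (conj_gen l) ((act l ^^ n) u)
    = (of_nat n * bg_comm (conj_gen l) l) *s (act l ^^ (n - 1)) u"
proof (induction n)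
  case (Suc n)
  have C: "(act l ^^ n) u \<in> C" for n using assms by (induction n) (auto simp: act_closed)
  have "act (conj_gen l) ((act l ^^ Suc n) u)
      = act l (act (conj_gen l) ((act l ^^ n) u)) + bg_comm (conj_gen l) l *s (act l ^^ n) u"
    using act_swap[OF C, of "conj_gen l" l n] by simp
  also have "\<dots> = (of_nat n * bg_comm (conj_gen l) l) *s act l ((act l ^^ (n - 1)) u)
      + bg_comm (conj_gen l) l *s (act l ^^ n) u"
    unfolding Suc by (simp add: act_scale)
  also have "\<dots> = (of_nat (Suc n) * bg_comm (conj_gen l) l) *s (act l ^^ n) u"
  proof -
    have "(of_nat n * bg_comm (conj_gen l) l) *s act l ((act l ^^ (n - 1)) u)
        = (of_nat n * bg_comm (conj_gen l) l) *s (act l ^^ n) u"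
      by (cases n) simp_all
    then show ?thesis by (simp add: algebra_simps)
  qed
  finally show ?case by simp
qed (use assms in simp)

text \<open>The number k is n! times the n-th power of the commutator.\<close>

lemma conj_power_power:
  assumes "u \<in> C" "act (conj_gen l) u = 0"
  obtains k where "k \<noteq> 0" "(act (conj_gen l) ^^ n) ((act l ^^ n) u) = k *s u"
proof -
  have "\<exists>k. k \<noteq> 0 \<and> (act (conj_gen l) ^^ n) ((act l ^^ n) u) = k *s u"
  proof (induction n)
    case 0
    then show ?case by (intro exI[of _ 1]) simp
  next
    case (Suc n)
    then obtain k where k: "k \<noteq> 0" "(act (conj_gen l) ^^ n) ((act l ^^ n) u) = k *s u" by blast
    have power_scale: "(act g ^^ n) (c *s x) = c *s (act g ^^ n) x" for g c x
      by (induction n) (auto simp: act_scale)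
    have "(act (conj_gen l) ^^ Suc n) ((act l ^^ Suc n) u)
        = (act (conj_gen l) ^^ n) (act (conj_gen l) ((act l ^^ Suc n) u))"
      by (simp only: funpow_Suc_right o_apply)
    also have "\<dots> = (of_nat (Suc n) * bg_comm (conj_gen l) l * k) *s u"
      unfolding conj_power_act[OF assms] by (simp add: power_scale k(2))
    finally show ?case using k(1) bg_comm_conj_gen_square[of l]
      by (intro exI[of _ "of_nat (Suc n) * bg_comm (conj_gen l) l * k"]) (auto simp del: of_nat_Suc)
  qed
  then show thesis using that by blast
qed

text \<open>
  Kashiwara's argument: if \<open>a = conj_gen l\<close> acts locally nilpotently, subtracting a multiple of
  \<open>l\<^sup>n a\<^sup>n x\<close> lowers the nilpotency order of \<open>x\<close>.
\<close>

lemma generated_by_top: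
  assumes nil: "\<And>g x. mode g > 0 \<Longrightarrow> x \<in> C \<Longrightarrow> \<exists>n. (act g ^^ n) x = 0"
    and smooth: "\<And>x. x \<in> C \<Longrightarrow> finite {g. mode g > 0 \<and> act g x \<noteq> 0}"
    and G: "submod G" "top \<subseteq> G"
  shows "C \<subseteq> G"
proof -
  \<comment> \<open>Outer induction on a finite set A of positive modes outside of which every
    positive mode kills x; inner induction on the nilpotency order at the newly added mode
    a.\<close>
  have "x \<in> G" if "finite A" "x \<in> C" "{g. mode g > 0 \<and> act g x \<noteq> 0} \<subseteq> A" "\<And>g. g \<in> A \<Longrightarrow> mode g > 0" for x A
    using that
  proof (induction A arbitrary: x rule: finite_induct)
    case empty
    then show ?case using G by (auto simp: top_def)
  next
    case (insert a A)
    obtain n where "(act a ^^ n) x = 0" using nil insert.prems by blast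
    then show ?case using insert.prems(1,2)
    proof (induction n arbitrary: x)
      case 0
      then show ?case using G subspace_0[OF submod_subspace] by auto
    next
      case (Suc n)
      define l where "l = conj_gen a"
      have a: "a = conj_gen l" by (cases a) (auto simp: l_def)
      have l: "mode l < 0" using insert.prems(3)[of a] by (simp add: l_def)
      \<comment> \<open>Killed by a and by all positive modes outside A, since these commute with a;
        so the outer induction hypothesis applies to u.\<close>
      define u where "u = (act a ^^ n) x"
      have powC: "(act g ^^ k) y \<in> C" if "y \<in> C" for g k y
        using that by (induction k) (auto simp: act_closed)
      have commute: "act g ((act h ^^ k) y) = (act h ^^ k) (act g y)" if "bg_comm g h = 0" "y \<in> C" for g h k y
      proof (induction k)
        case (Suc k)
        show ?case using act_swap[OF powC[OF that(2), where k = k], of g h h] Suc that by simp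
      qed simp
      have pow_zero: "(act h ^^ k) 0 = 0" for h k by (induction k) auto
      have uC: "u \<in> C" using Suc by (simp add: u_def powC)
      have au: "act a u = 0" using Suc by (simp add: u_def)
      have killed: "act g x = 0" if "mode g > 0" "g \<notin> insert a A" for g
        using that Suc.prems(3) by blast
      have "act g u = 0" if g: "mode g > 0" "g \<notin> A" for g
      proof (cases "g = a")
        case False
        have "bg_comm g a = 0" using g insert.prems(3)[of a] by (intro bg_comm_mode_zero) auto
        then show ?thesis using commute[of g a x n] killed[of g] Suc False g by (simp add: u_def pow_zero)
      qed (use au in simp)
      then have uG: "u \<in> G" using insert.IH[of u] uC insert.prems(3) by blast
      obtain k where k: "k \<noteq> 0" "(act a ^^ n) ((act l ^^ n) u) = k *s u"
        using conj_power_power[OF uC, of l n] au a by metis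
      \<comment> \<open>As k is the scalar by which a^n l^n acts on u = a^n x, the power a^n kills
        y. The letter l commutes with every generator except a, so no mode outside
        \<open>insert a A\<close> becomes active.\<close>
      define y where "y = x - (1 / k) *s (act l ^^ n) u"
      have pow_lin: "(act a ^^ n) (v - c *s w) = (act a ^^ n) v - c *s (act a ^^ n) w" for v c w
        by (induction n) (auto simp: act_diff act_scale)
      have "(act a ^^ n) y = 0" using k by (simp add: y_def pow_lin flip: u_def)
      moreover have yC: "y \<in> C" unfolding y_def
        using Suc uC by (intro subspace_diff subspace_scale subspace_C powC)
      moreover have "act g y = 0" if g: "mode g > 0" "g \<notin> insert a A" for g
      proof -
        have "bg_comm g l = 0" using g a by (cases g; cases l) auto
        then have "act g ((act l ^^ n) u) = (act l ^^ n) (act g u)" using commute uC by blast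
        also have "act g u = (act a ^^ n) (act g x)" unfolding u_def
          using g insert.prems(3)[of a] Suc by (intro commute bg_comm_mode_zero) auto
        finally show ?thesis using killed[OF g] by (simp add: y_def act_diff act_scale pow_zero)
      qed
      ultimately have "y \<in> G" using Suc.IH[of y] by blast
      moreover have "(act l ^^ n) u \<in> G" using uG by (induction n) (auto simp: submod_act[OF G(1)])
      ultimately have "y + (1 / k) *s (act l ^^ n) u \<in> G"
        by (intro subspace_add subspace_scale submod_subspace[OF G(1)])
      then show ?case by (simp add: y_def)
    qed
  qed
  then show ?thesis using smooth by blast
qed

end

locale bg_weight_space = bg_space scale C act
  for scale :: "complex \<Rightarrow> 'a::ab_group_add \<Rightarrow> 'a" (infixr \<open>*s\<close> 75) and C act +
  fixes \<mu> :: complex and r :: nat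
  assumes \<mu>: "\<mu> \<notin> \<int>"
    and weights: "C \<subseteq> H.geig 0 {\<mu> + c | c. c \<in> \<int>}"
    and nilpotent: "mode g > 0 \<Longrightarrow> x \<in> C \<Longrightarrow> \<exists>n. (act g ^^ n) x = 0"
    and smooth_act: "x \<in> C \<Longrightarrow> finite {g. mode g > 0 \<and> act g x \<noteq> 0}"
    and bounded: "x \<in> C \<Longrightarrow> x \<in> H.geig 0 {c} \<Longrightarrow> (H.shift 0 c ^^ r) x = 0"
begin

section \<open>Invertibility and integral powers of gamma_0\<close>

abbreviation "\<gamma> \<equiv> act (Gamma 0)"
abbreviation "\<beta> \<equiv> act (Beta 0)"

text \<open>The factors that kill x avoid the integers, so \<open>H 0\<close> - n can be inverted on
  it. For n = 0 the operator is gamma_0 beta_0, for n = 1 it is beta_0 gamma_0.\<close>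

lemma shift_invertible_int:
  assumes "subspace K" "\<And>x. x \<in> K \<Longrightarrow> H 0 x \<in> K" "K \<subseteq> C" "n \<in> \<int>" "x \<in> K"
  obtains y where "y \<in> K" "H.shift 0 n y = x"
proof -
  obtain cs where cs: "set cs \<subseteq> {\<mu> + c | c. c \<in> \<int>}" "H.shifts 0 cs x = 0"
    using weights assms by (auto simp: H.geig_def)
  have "n \<notin> set cs"
  proof
    assume "n \<in> set cs"
    then obtain c where "n = \<mu> + c" "c \<in> \<int>" using cs by auto
    then have "\<mu> = n - c" by simp
    then show False using \<mu> assms(4) \<open>c \<in> \<int>\<close> by auto
  qed
  then show thesis using H.shift_invertible[OF assms(1,2,5) cs(2)] that by blast
qed

lemma shift_injective_int:
  assumes "x \<in> C" "n \<in> \<int>" "H.shift 0 n x = 0"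
  shows "x = 0"
proof -
  have "n \<noteq> \<mu> + c" if "c \<in> \<int>" for c
  proof
    assume "n = \<mu> + c"
    then have "\<mu> = n - c" by simp
    then show False using \<mu> assms(2) that by auto
  qed
  then have "{n} \<inter> {\<mu> + c | c. c \<in> \<int>} = {}" by auto
  moreover have "x \<in> H.geig 0 {n}" using assms(3) by (intro H.geigI[of "[n]"]) auto
  ultimately show ?thesis using H.geig_disjoint weights assms(1) by blast
qed

lemma beta_gamma: "x \<in> C \<Longrightarrow> \<beta> (\<gamma> x) = H 0 x - x"
  using act_swap[of x "Beta 0" "Gamma 0"] by (simp add: H_def)

text \<open>Both products of beta_0 and gamma_0 are \<open>H 0\<close> shifted by an integer:
  injectivity comes from beta_0 gamma_0 and surjectivity from gamma_0 beta_0.\<close>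

lemma gamma_bij: "bij_betw \<gamma> top top"
  unfolding bij_betw_def
proof
  show "inj_on \<gamma> top"
  proof (rule inj_onI)
    fix x y assume xy: "x \<in> top" "y \<in> top" "\<gamma> x = \<gamma> y"
    then have "\<beta> (\<gamma> (x - y)) = 0" by (simp add: act_diff)
    moreover have C: "x - y \<in> C" using xy by (intro subspace_diff subspace_C topD)
    ultimately have "H.shift 0 1 (x - y) = 0" using beta_gamma[of "x - y"] by (simp add: H.shift_def)
    then have "x - y = 0" using shift_injective_int[OF C, of 1] by simp
    then show "x = y" by simp
  qed
  show "\<gamma> ` top = top"
  proof
    show "\<gamma> ` top \<subseteq> top" by (auto intro: act_top)
    show "top \<subseteq> \<gamma> ` top"
    proof
      fix x assume "x \<in> top"
      then obtain y where y: "y \<in> top" "H.shift 0 0 y = x"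
        using shift_invertible_int[OF subspace_top H_top_closed, of 0 x] topD(1) by (metis Ints_0 subsetI)
      then have "\<gamma> (\<beta> y) = x" by (simp add: H.shift_def H_def)
      then show "x \<in> \<gamma> ` top" using y act_top[of y "Beta 0"] by auto
    qed
  qed
qed

text \<open>The inverse is taken on \<open>top\<close>, so negative powers have a meaning only
  there.\<close>

definition gamma_power :: "int \<Rightarrow> 'a \<Rightarrow> 'a" where
  "gamma_power n x = (if n \<ge> 0 then (\<gamma> ^^ nat n) x else (inv_into top \<gamma> ^^ nat (- n)) x)"

lemma gamma_power_0 [simp]: "gamma_power 0 x = x"
  by (simp add: gamma_power_def)

lemma gamma_power_top: "x \<in> top \<Longrightarrow> gamma_power n x \<in> top"
proof -
  assume x: "x \<in> top"
  have "(\<gamma> ^^ k) x \<in> top" for k by (induction k) (auto simp: x act_top)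
  moreover have "(inv_into top \<gamma> ^^ k) x \<in> top" for k
    using gamma_bij by (induction k) (auto simp: x bij_betw_def intro!: inv_into_into)
  ultimately show ?thesis by (simp add: gamma_power_def)
qed

lemma gamma_power_closed: "x \<in> top \<Longrightarrow> gamma_power n x \<in> C"
  using gamma_power_top topD by blast

lemma gamma_gamma_power: "x \<in> top \<Longrightarrow> \<gamma> (gamma_power n x) = gamma_power (n + 1) x"
proof (cases "n \<ge> 0")
  case True
  then have "nat (n + 1) = Suc (nat n)" by simp
  then show ?thesis using True by (simp add: gamma_power_def)
next
  case False
  assume x: "x \<in> top"
  define k where "k = nat (- n - 1)"
  have n: "nat (- n) = Suc k" "n + 1 = - int k" using False by (auto simp: k_def)
  have "gamma_power (n + 1) x = (inv_into top \<gamma> ^^ k) x"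
    unfolding n(2) by (cases "k = 0") (simp_all add: gamma_power_def)
  moreover have "gamma_power (n + 1) x \<in> top" using gamma_power_top x by blast
  ultimately have "\<gamma> (inv_into top \<gamma> ((inv_into top \<gamma> ^^ k) x)) = gamma_power (n + 1) x"
    using gamma_bij by (simp add: bij_betw_def f_inv_into_f)
  then show ?thesis using False by (simp add: gamma_power_def n(1))
qed

lemma gamma_inj: "x \<in> top \<Longrightarrow> y \<in> top \<Longrightarrow> \<gamma> x = \<gamma> y \<Longrightarrow> x = y"
  using gamma_bij by (auto simp: bij_betw_def dest: inj_onD)

text \<open>Serves the downward half of inductions over n: vectors of \<open>top\<close> at n - 1
  agree as soon as gamma_0 makes them agree at n.\<close>

lemma gamma_gamma_power_pred: "x \<in> top \<Longrightarrow> \<gamma> (gamma_power (n - 1) x) = gamma_power n x"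
  using gamma_gamma_power[of x "n - 1"] by simp

lemma gamma_power_add: "x \<in> top \<Longrightarrow> y \<in> top \<Longrightarrow> gamma_power n (x + y) = gamma_power n x + gamma_power n y"
proof (induction n rule: int_induct[where k = 0])
  case (step1 n)
  then show ?case by (simp add: act_add subspace_add[OF subspace_top] gamma_gamma_power[of _ n, symmetric])
next
  case (step2 n)
  show ?case
    by (rule gamma_inj) (use step2 in \<open>auto simp: act_add gamma_gamma_power_pred gamma_power_top subspace_add[OF subspace_top]
        intro!: gamma_power_top subspace_add[OF subspace_top]\<close>)
qed simp

lemma gamma_power_scale: "x \<in> top \<Longrightarrow> gamma_power n (c *s x) = c *s gamma_power n x"
proof (induction n rule: int_induct[where k = 0])
  case (step1 n)
  then show ?case by (simp add: act_scale subspace_scale[OF subspace_top] gamma_gamma_power[of _ n, symmetric])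
next
  case (step2 n)
  show ?case
    by (rule gamma_inj) (use step2 in \<open>auto simp: act_scale gamma_gamma_power_pred subspace_scale[OF subspace_top]
        intro!: gamma_power_top subspace_scale[OF subspace_top]\<close>)
qed simp

lemma gamma_power_diff: "x \<in> top \<Longrightarrow> y \<in> top \<Longrightarrow> gamma_power n (x - y) = gamma_power n x - gamma_power n y"
  using gamma_power_add[of "x - y" y n] subspace_diff[OF subspace_top, of x y] by simp

lemma gamma_power_zero [simp]: "gamma_power n 0 = 0"
  using gamma_power_scale[of 0 n 0] subspace_0[OF subspace_top] by simp

lemma gamma_power_eq_0: "x \<in> top \<Longrightarrow> gamma_power n x = 0 \<Longrightarrow> x = 0"
proof (induction n rule: int_induct[where k = 0])
  case (step1 n)
  then have "\<gamma> (gamma_power n x) = \<gamma> 0" by (simp add: gamma_gamma_power)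
  then have "gamma_power n x = 0"
    using gamma_inj gamma_power_top[OF step1.prems(1)] subspace_0[OF subspace_top] by blast
  then show ?case using step1 by blast
next
  case (step2 n)
  then have "gamma_power n x = 0" using gamma_gamma_power_pred[of x n] by simp
  then show ?case using step2 by blast
qed simp

lemma gamma_power_plus: "x \<in> top \<Longrightarrow> gamma_power m (gamma_power n x) = gamma_power (m + n) x"
proof (induction m rule: int_induct[where k = 0])
  case (step1 m)
  then have "gamma_power (m + 1) (gamma_power n x) = \<gamma> (gamma_power (m + n) x)"
    by (simp add: gamma_power_top gamma_gamma_power[of _ m, symmetric])
  then show ?case using step1 by (simp add: gamma_gamma_power algebra_simps)
next
  case (step2 m)
  show ?case
  proof (rule gamma_inj)
    show "\<gamma> (gamma_power (m - 1) (gamma_power n x)) = \<gamma> (gamma_power (m - 1 + n) x)"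
      using step2 by (simp add: gamma_gamma_power_pred gamma_gamma_power gamma_power_top algebra_simps)
  qed (use step2 in \<open>auto intro!: gamma_power_top\<close>)
qed simp

text \<open>The weight of gamma_0 under gamma_0 beta_0 is -1, so each further power shifts the
  operator by one.\<close>

lemma H_gamma_power: "x \<in> top \<Longrightarrow> H 0 (gamma_power n x) = gamma_power n (H 0 x - of_int n *s x)"
proof (induction n rule: int_induct[where k = 0])
  case (step1 n)
  have *: "H 0 x - c *s x \<in> top" for c
    using step1.prems by (intro subspace_diff subspace_scale subspace_top H_top_closed)
  have "H 0 (gamma_power (n + 1) x) = \<gamma> (gamma_power n (H 0 x - of_int n *s x)) - \<gamma> (gamma_power n x)"
    using step1 by (simp add: H_act gamma_power_closed gamma_gamma_power[of _ n, symmetric])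
  also have "\<dots> = gamma_power (n + 1) (H 0 x - of_int n *s x - x)"
    using step1.prems * by (simp add: gamma_power_diff gamma_gamma_power)
  also have "H 0 x - of_int n *s x - x = H 0 x - of_int (n + 1) *s x" by (simp add: algebra_simps)
  finally show ?case .
next
  case (step2 n)
  have *: "H 0 x - c *s x \<in> top" for c
    using step2.prems by (intro subspace_diff subspace_scale subspace_top H_top_closed)
  show ?case
  proof (rule gamma_inj)
    have "\<gamma> (H 0 (gamma_power (n - 1) x)) = H 0 (gamma_power n x) + gamma_power n x"
      using H_act[OF gamma_power_closed[OF step2.prems], of 0 "Gamma 0" "n - 1"] step2.prems
      by (simp add: gamma_gamma_power_pred)
    also have "\<dots> = gamma_power n (H 0 x - of_int n *s x + x)"
      using step2 * by (simp add: gamma_power_add)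
    also have "H 0 x - of_int n *s x + x = H 0 x - of_int (n - 1) *s x" by (simp add: algebra_simps)
    finally show "\<gamma> (H 0 (gamma_power (n - 1) x)) = \<gamma> (gamma_power (n - 1) (H 0 x - of_int (n - 1) *s x))"
      by (simp add: gamma_gamma_power_pred[OF *])
  qed (use step2 * in \<open>auto intro: gamma_power_top H_top_closed\<close>)
qed simp

text \<open>On an eigenvector for \<mu> this is the rule for minus the derivative of gamma_0^(n -
  \<mu>); the nilpotent part of \<open>H 0\<close> supplies the logarithmic terms. Both sides are
  compared after applying gamma_0.\<close>

lemma beta_gamma_power:
  assumes "x \<in> top"
  shows "\<beta> (gamma_power n x) = gamma_power (n - 1) (H.shift 0 (of_int n) x)"
proof (rule gamma_inj)
  have *: "H.shift 0 (of_int n) x \<in> top"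
    unfolding H.shift_def using assms by (intro subspace_diff subspace_scale subspace_top H_top_closed)
  show "\<beta> (gamma_power n x) \<in> top" using assms by (intro act_top gamma_power_top) auto
  show "gamma_power (n - 1) (H.shift 0 (of_int n) x) \<in> top" using * by (rule gamma_power_top)
  have "\<gamma> (\<beta> (gamma_power n x)) = H 0 (gamma_power n x)" by (simp add: H_def)
  then show "\<gamma> (\<beta> (gamma_power n x)) = \<gamma> (gamma_power (n - 1) (H.shift 0 (of_int n) x))"
    using * by (simp add: gamma_gamma_power_pred H_gamma_power[OF assms] H.shift_def)
qed

lemma gamma_power_geig:
  assumes "x \<in> top" "x \<in> H.geig 0 {c}"
  shows "gamma_power n x \<in> H.geig 0 {c - of_int n}"
proof -
  obtain k where k: "(H.shift 0 c ^^ k) x = 0" using assms by (auto simp: H.geig_single)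
  have "(H.shift 0 (c - of_int n) ^^ k) (gamma_power n x) = gamma_power n ((H.shift 0 c ^^ k) x)
    \<and> (H.shift 0 c ^^ k) x \<in> top" for k
  proof (induction k)
    case (Suc k)
    let ?y = "(H.shift 0 c ^^ k) x"
    have y: "?y \<in> top" using Suc by blast
    then have "H 0 ?y - d *s ?y \<in> top" for d
      by (intro subspace_diff subspace_scale subspace_top H_top_closed)
    moreover have "H.shift 0 (c - of_int n) (gamma_power n ?y)
      = gamma_power n (H 0 ?y - of_int n *s ?y) - gamma_power n ((c - of_int n) *s ?y)"
      using y by (simp add: H.shift_def H_gamma_power gamma_power_scale)
    moreover have "H 0 ?y - of_int n *s ?y - (c - of_int n) *s ?y = H.shift 0 c ?y"
      by (simp add: H.shift_def algebra_simps)
    ultimately show ?case using Suc y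
      by (simp add: H.shift_def[of 0 c ?y] subspace_scale[OF subspace_top] flip: gamma_power_diff)
  qed (use assms in simp)
  then have "(H.shift 0 (c - of_int n) ^^ k) (gamma_power n x) = 0" using k by (metis gamma_power_zero)
  then show ?thesis by (auto simp: H.geig_single)
qed

section \<open>The space \<open>E\<close> and the submodules generated by its subspaces\<close>

definition E :: "'a set" where
  "E = top \<inter> H.geig 0 {\<mu>}"

lemma E_top: "x \<in> E \<Longrightarrow> x \<in> top"
  by (simp add: E_def)

lemma subspace_E: "subspace E"
  by (simp add: E_def subspace_inter subspace_top H.subspace_geig)

lemma H_E: "x \<in> E \<Longrightarrow> H 0 x \<in> E"
proof -
  assume x: "x \<in> E"
  then obtain k where "(H.shift 0 \<mu> ^^ k) x = 0" by (auto simp: E_def H.geig_single)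
  then have "(H.shift 0 \<mu> ^^ k) (H 0 x) = 0"
  proof -
    have "(H.shift 0 \<mu> ^^ k) (H 0 y) = H 0 ((H.shift 0 \<mu> ^^ k) y)" for k y
      by (induction k) (auto simp: H.shift_def H.h_diff H.h_scale)
    then show ?thesis using \<open>(H.shift 0 \<mu> ^^ k) x = 0\<close> by simp
  qed
  then show ?thesis using x by (auto simp: E_def H.geig_single H_top_closed)
qed

text \<open>Negative powers of gamma_0 do not belong to the algebra. They are reached through
  beta_0: if (\<open>H 0\<close> - n) y = x with y in D, then beta_0 sends gamma_0^n y to gamma_0^(n
  - 1) x.\<close>

lemma gamma_power_submod:
  assumes D: "subspace D" "\<And>x. x \<in> D \<Longrightarrow> H 0 x \<in> D" "D \<subseteq> top" and G: "submod G" "D \<subseteq> G"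
  shows "x \<in> D \<Longrightarrow> gamma_power n x \<in> G"
proof (induction n arbitrary: x rule: int_induct[where k = 0])
  case base
  then show ?case using G by auto
next
  case (step1 n)
  then show ?case using D submod_act[OF G(1)] gamma_gamma_power[of x n] by (metis subsetD)
next
  case (step2 n)
  obtain y where y: "y \<in> D" "H.shift 0 (of_int n) y = x"
    using shift_invertible_int[OF D(1,2), of "of_int n" x] D(3) step2.prems topD(1) by (metis Ints_of_int subset_iff)
  have "gamma_power (n - 1) x = \<beta> (gamma_power n y)" using beta_gamma_power[of y n] y D(3) by auto
  then show ?case using step2.IH(1) step2 y submod_act[OF G(1)] by auto
qed

text \<open>A generalized eigenvector for \<mu> + n is gamma_0^(-n) applied to its image under
  gamma_0^n, and that image has generalized eigenvalue \<mu>.\<close>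

lemma top_spanned: "top \<subseteq> span {gamma_power n x | n x. x \<in> E}"
proof
  fix x assume x: "x \<in> top"
  have "x \<in> span (\<Union>c\<in>{\<mu> + c | c. c \<in> \<int>}. top \<inter> H.geig 0 {c})"
    using x weights topD by (intro H.geig_finite_decomposition subspace_top H_top_closed) auto
  moreover have "span (\<Union>c\<in>{\<mu> + c | c. c \<in> \<int>}. top \<inter> H.geig 0 {c}) \<subseteq> span {gamma_power n x | n x. x \<in> E}"
  proof (rule span_mono, safe)
    fix c y assume "c \<in> \<int>" and y: "y \<in> top" "y \<in> H.geig 0 {\<mu> + c}"
    then obtain n where n: "c = of_int n" by (auto elim: Ints_cases)
    have "gamma_power n y \<in> E"
      using gamma_power_geig[OF y, of n] gamma_power_top[OF y(1)] n by (simp add: E_def)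
    moreover have "y = gamma_power (- n) (gamma_power n y)" using y by (simp add: gamma_power_plus)
    ultimately show "\<exists>n x. y = gamma_power n x \<and> x \<in> E" by blast
  qed
  ultimately show "x \<in> span {gamma_power n x | n x. x \<in> E}" by blast
qed

lemma E_generates:
  assumes "submod G" "E \<subseteq> G"
  shows "C \<subseteq> G"
proof (rule generated_by_top[OF nilpotent smooth_act assms(1)])
  have "span {gamma_power n x | n x. x \<in> E} \<subseteq> G"
    using gamma_power_submod[OF subspace_E H_E _ assms] E_top by (intro span_minimal submod_subspace assms) auto
  then show "top \<subseteq> G" using top_spanned by blast
qed

lemma gamma_power_independent:
  assumes "finite F" "\<And>n. n \<in> F \<Longrightarrow> x n \<in> E" "(\<Sum>n\<in>F. gamma_power n (x n)) = 0" "n \<in> F"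
  shows "x n = 0"
proof -
  have "gamma_power n (x n) = 0"
  proof (rule H.geig_independent[OF assms(1) _ _ assms(3,4)])
    show "gamma_power n (x n) \<in> H.geig 0 {\<mu> - of_int n}" if "n \<in> F" for n
      using assms(2)[OF that] by (intro gamma_power_geig) (auto simp: E_def)
  qed (auto simp: inj_on_def)
  then show ?thesis using gamma_power_eq_0 assms E_top by blast
qed

text \<open>Laurent polynomials in gamma_0 with coefficients in D. For an \<open>H 0\<close>-stable
  subspace D of \<open>E\<close> this is the inducing space of the submodule generated by D.\<close>

definition tower :: "'a set \<Rightarrow> 'a set" where
  "tower D = span {gamma_power n x | n x. x \<in> D}"

text \<open>The expansion holds over every finite set that contains the support, so two expansions
  can be compared over a common index set.\<close>

lemma tower_sum:
  assumes D: "subspace D" "D \<subseteq> E" and "s \<in> tower D"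
  obtains x where "\<And>n. x n \<in> D" "finite {n. x n \<noteq> 0}" "\<And>F. finite F \<Longrightarrow> {n. x n \<noteq> 0} \<subseteq> F \<Longrightarrow> s = (\<Sum>n\<in>F. gamma_power n (x n))"
proof -
  have "\<exists>x. (\<forall>n. x n \<in> D) \<and> finite {n. x n \<noteq> 0} \<and>
      (\<forall>F. finite F \<longrightarrow> {n. x n \<noteq> 0} \<subseteq> F \<longrightarrow> s = (\<Sum>n\<in>F. gamma_power n (x n)))"
    using assms(3) unfolding tower_def
  proof (induction rule: span_induct_alt)
    case base
    then show ?case using subspace_0[OF D(1)] by (intro exI[of _ "\<lambda>_. 0"]) auto
  next
    case (step c u s)
    then obtain x m y where x: "\<And>n. x n \<in> D" "finite {n. x n \<noteq> 0}"
      "\<And>F. finite F \<Longrightarrow> {n. x n \<noteq> 0} \<subseteq> F \<Longrightarrow> s = (\<Sum>n\<in>F. gamma_power n (x n))"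
      and y: "u = gamma_power m y" "y \<in> D" by blast
    let ?x = "\<lambda>n. (if n = m then c *s y else 0) + x n"
    have "finite {n. ?x n \<noteq> 0}" by (rule finite_subset[of _ "insert m {n. x n \<noteq> 0}"]) (use x(2) in auto)
    moreover have "\<forall>n. ?x n \<in> D" using x y D by (auto intro!: subspace_add subspace_scale subspace_0)
    moreover have "c *s u + s = (\<Sum>n\<in>F. gamma_power n (?x n))" if F: "finite F" "{n. ?x n \<noteq> 0} \<subseteq> F" for F
    proof -
      let ?F = "insert m (F \<union> {n. x n \<noteq> 0})"
      have top: "x n \<in> top" "(if n = m then c *s y else 0) \<in> top" for n
        using x(1)[of n] y D E_top subspace_scale[OF subspace_top] subspace_0[OF subspace_top] by auto
      have "gamma_power n (?x n) = 0" if "n \<notin> F" for n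
      proof -
        have "?x n = 0" using F(2) that by blast
        then show ?thesis by (simp only: gamma_power_zero)
      qed
      then have "(\<Sum>n\<in>F. gamma_power n (?x n)) = (\<Sum>n\<in>?F. gamma_power n (?x n))"
        using F(1) x(2) by (intro sum.mono_neutral_left) (auto simp del: add_eq_0_iff)
      also have "\<dots> = (\<Sum>n\<in>?F. gamma_power n (if n = m then c *s y else 0)) + (\<Sum>n\<in>?F. gamma_power n (x n))"
        using top by (simp only: gamma_power_add sum.distrib)
      also have "(\<Sum>n\<in>?F. gamma_power n (x n)) = s" using F x(2) by (intro x(3)[symmetric]) auto
      also have "(\<Sum>n\<in>?F. gamma_power n (if n = m then c *s y else 0)) = gamma_power m (c *s y)"
        using F x(2) by (subst sum.remove[of _ m]) (auto intro!: sum.neutral)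
      also have "\<dots> = c *s u" using y D E_top by (auto simp: gamma_power_scale)
      finally show ?thesis by simp
    qed
    ultimately show ?case by (intro exI[of _ ?x] conjI allI impI) blast+
  qed
  then obtain x where "\<forall>n. x n \<in> D" "finite {n. x n \<noteq> 0}"
    "\<forall>F. finite F \<longrightarrow> {n. x n \<noteq> 0} \<subseteq> F \<longrightarrow> s = (\<Sum>n\<in>F. gamma_power n (x n))" by (elim exE conjE)
  then show thesis by (intro that[of x]) blast+
qed

lemma tower_disjoint:
  assumes D: "subspace D" "D \<subseteq> E" and D': "subspace D'" "D' \<subseteq> E" and "D \<inter> D' = {0}"
    and s: "s \<in> tower D" "s \<in> tower D'"
  shows "s = 0"
proof -
  obtain x where x: "\<And>n. x n \<in> D" "finite {n. x n \<noteq> 0}"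
    "\<And>F. finite F \<Longrightarrow> {n. x n \<noteq> 0} \<subseteq> F \<Longrightarrow> s = (\<Sum>n\<in>F. gamma_power n (x n))"
    by (rule tower_sum[OF D s(1)]) (rule that)
  obtain y where y: "\<And>n. y n \<in> D'" "finite {n. y n \<noteq> 0}"
    "\<And>F. finite F \<Longrightarrow> {n. y n \<noteq> 0} \<subseteq> F \<Longrightarrow> s = (\<Sum>n\<in>F. gamma_power n (y n))"
    by (rule tower_sum[OF D' s(2)]) (rule that)
  let ?F = "{n. x n \<noteq> 0} \<union> {n. y n \<noteq> 0}"
  have F: "finite ?F" using x y by auto
  have top: "x n \<in> top" "y n \<in> top" for n using x(1)[of n] y(1)[of n] D D' E_top by auto
  have "(\<Sum>n\<in>?F. gamma_power n (x n - y n)) = 0"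
    using x(3)[OF F] y(3)[OF F] by (simp add: gamma_power_diff top sum_subtractf)
  moreover have "x n - y n \<in> E" for n using x(1)[of n] y(1)[of n] D D' by (auto intro: subspace_diff[OF subspace_E])
  ultimately have xy: "x n - y n = 0" if "n \<in> ?F" for n
    using gamma_power_independent[OF F, of "\<lambda>n. x n - y n" n] that by auto
  have x0: "x n = 0" if "n \<in> ?F" for n
  proof -
    have "x n = y n" using xy[OF that] by simp
    then have "x n \<in> D \<inter> D'" using x(1)[of n] y(1)[of n] by simp
    then show ?thesis using assms(5) by simp
  qed
  have "(\<Sum>n\<in>?F. gamma_power n (x n)) = 0"
    by (intro sum.neutral ballI) (simp only: x0 gamma_power_zero)
  then show ?thesis using x(3)[OF F] by simp
qed

text \<open>By \<open>beta_gamma_power\<close> the coefficients are changed by \<open>H 0\<close> -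
  n under beta_0, so stability of D under \<open>H 0\<close> makes the tower stable under the zero
  modes.\<close>

lemma induced_from_tower:
  assumes D: "subspace D" "D \<subseteq> E" "\<And>x. x \<in> D \<Longrightarrow> H 0 x \<in> D"
  shows "bg_space.induced_from scale (gen D) act (tower D)"
proof -
  have "D \<subseteq> C" using D E_top topD by blast
  then have sub: "submod (gen D)" by (rule submod_gen)
  interpret G: bg_space scale "gen D" act using sub by (rule submod_bg_space)
  have DG: "D \<subseteq> gen D" using gen_base by auto
  have top: "gamma_power n x \<in> top" if "x \<in> D" for n x using that D E_top gamma_power_top by blast
  have base: "gamma_power n x \<in> tower D" if "x \<in> D" for n x
    unfolding tower_def using that by (intro span_base) auto
  show ?thesis
    unfolding G.induced_from_def
  proof (intro conjI allI ballI impI)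
    show "tower D \<subseteq> gen D"
      unfolding tower_def using gamma_power_submod[OF D(1,3) _ sub DG] D(2) E_top
      by (intro span_minimal submod_subspace[OF sub]) blast
    have "D \<subseteq> tower D" using base[of _ 0] by auto
    then show "gen D \<subseteq> G.gen (tower D)" using gen_mono by blast
    fix g s assume s: "s \<in> tower D"
    {
      assume g: "mode g = 0"
      show "act g s \<in> tower D"
        unfolding tower_def
      proof (rule act_span[OF s[unfolded tower_def]])
        fix b assume "b \<in> {gamma_power n x | n x. x \<in> D}"
        then obtain n x where b: "b = gamma_power n x" "x \<in> D" by blast
        have "H.shift 0 (of_int n) x \<in> D" unfolding H.shift_def
          using D b by (intro subspace_diff subspace_scale) auto
        then show "act g b \<in> span {gamma_power n x | n x. x \<in> D}"
          using g b base D E_top unfolding tower_def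
          by (auto simp: mode_zero_cases gamma_gamma_power beta_gamma_power subset_iff)
      qed
    next
      assume "mode g > 0"
      then have "act g b = 0" if "b \<in> {gamma_power n x | n x. x \<in> D}" for b
        using that topD(2)[OF top] by blast
      then have "act g s \<in> span {}"
        by (intro act_span[OF s[unfolded tower_def]]) (simp add: span_zero)
      then show "act g s = 0" by simp
    }
  qed (simp add: tower_def)
qed

text \<open>A nonzero intersection meets \<open>tower D\<close>, by \<open>induced_meets\<close>
  inside \<open>gen D\<close>. Such a vector is killed by the positive modes, so
  \<open>induced_top\<close> inside \<open>gen D'\<close> puts it into \<open>tower D'\<close> as
  well, and the two towers meet only in 0.\<close>

lemma gen_disjoint:
  assumes D: "subspace D" "D \<subseteq> E" "\<And>x. x \<in> D \<Longrightarrow> H 0 x \<in> D"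
    and D': "subspace D'" "D' \<subseteq> E" "\<And>x. x \<in> D' \<Longrightarrow> H 0 x \<in> D'" and disj: "D \<inter> D' = {0}"
  shows "gen D \<inter> gen D' = {0}"
proof (rule ccontr)
  assume ne: "gen D \<inter> gen D' \<noteq> {0}"
  have "D \<subseteq> C" "D' \<subseteq> C" using D D' E_top topD by blast+
  then have sub: "submod (gen D)" "submod (gen D')" by (auto intro: submod_gen)
  interpret G: bg_space scale "gen D" act using sub(1) by (rule submod_bg_space)
  interpret G': bg_space scale "gen D'" act using sub(2) by (rule submod_bg_space)
  have "G.submod (gen D \<inter> gen D')"
    using submod_Int[OF sub] by (auto simp: G.submod_def submod_def)
  then obtain s where s: "s \<in> tower D" "s \<in> gen D'" "s \<noteq> 0"
    using G.induced_meets[OF induced_from_tower[OF D] _ ne] by blast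
  have "act g s = 0" if "mode g > 0" for g
    using induced_from_tower[OF D] s(1) that by (simp add: G.induced_from_def)
  then have "s \<in> tower D'" using G'.induced_top[OF induced_from_tower[OF D'] s(2)] by blast
  then show False using tower_disjoint[OF D(1,2) D'(1,2) disj s(1)] s(3) by blast
qed

end

section \<open>Splitting off a Jordan block of maximal size\<close>

lemma (in vector_space) separating_functional:
  assumes "u \<noteq> 0"
  obtains f where "\<And>x y. f (x + y) = f x + f y" "\<And>c x. f (c *s x) = c * f x" "f u \<noteq> 0"
proof -
  interpret K: vector_space "(*) :: 'a \<Rightarrow> 'a \<Rightarrow> 'a" by unfold_locales (auto simp: algebra_simps)
  interpret P: vector_space_pair scale "(*) :: 'a \<Rightarrow> 'a \<Rightarrow> 'a" by unfold_locales
  have ind: "independent {u}" using assms by simp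
  define f where "f = P.construct {u} (\<lambda>_. 1)"
  interpret f: Vector_Spaces.linear scale "(*)" f
    unfolding f_def using ind by (rule P.linear_construct)
  have "f u = 1" unfolding f_def using P.construct_basis[OF ind, of u] by simp
  then show thesis using that[of f] f.add f.scale by simp
qed

text \<open>Take a functional f that is nonzero on h^(k-1) v. The matrix f (h^(i+j) v) is
  triangular: it vanishes for i + j \<ge> k and is nonzero for i + j = k - 1. So the common kernel
  D' of the functionals f h^i with i < k is a complement of D, in any dimension; it is h-stable
  because h^k = 0 on K.\<close>

lemma (in linear_operator) cyclic_complement:
  assumes K: "subspace K" "\<And>x. x \<in> K \<Longrightarrow> h x \<in> K" and nil: "\<And>x. x \<in> K \<Longrightarrow> (h ^^ k) x = 0"
    and v: "v \<in> K" "(h ^^ (k - 1)) v \<noteq> 0" "k > 0"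
  defines "D \<equiv> span {(h ^^ i) v | i. i < k}"
  obtains D' where "subspace D'" "D' \<subseteq> K" "\<And>x. x \<in> D' \<Longrightarrow> h x \<in> D'" "D \<inter> D' = {0}"
    "\<And>x. x \<in> K \<Longrightarrow> \<exists>y\<in>D. x - y \<in> D'"
    "\<And>a. (\<Sum>i<k. a i *s (h ^^ i) v) = 0 \<Longrightarrow> \<forall>i<k. a i = 0"
proof -
  have pow: "(h ^^ n) (x + y) = (h ^^ n) x + (h ^^ n) y" "(h ^^ n) (c *s x) = c *s (h ^^ n) x"
    "(h ^^ n) (x - y) = (h ^^ n) x - (h ^^ n) y" "(h ^^ n) 0 = 0" for n x y c
    by (induction n) (auto simp: h_add h_scale h_diff)
  have pow_sum: "(h ^^ n) (sum g A) = (\<Sum>a\<in>A. (h ^^ n) (g a))" for n g and A :: "nat set"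
    by (induction n) (auto simp: h_sum)
  have powK: "(h ^^ n) x \<in> K" if "x \<in> K" for n x using that by (induction n) (auto simp: K)
  have nil': "(h ^^ n) x = 0" if "x \<in> K" "n \<ge> k" for n x
  proof -
    have "(h ^^ n) x = (h ^^ (n - k)) ((h ^^ k) x)"
      using that(2) by (simp flip: funpow_add o_apply[of "h ^^ (n - k)" "h ^^ k"])
    then show ?thesis using nil that by (simp add: pow)
  qed
  have pow_pow: "(h ^^ m) ((h ^^ n) x) = (h ^^ (m + n)) x" for m n x by (simp add: funpow_add)
  obtain f where f: "\<And>x y. f (x + y) = f x + f y" "\<And>c x. f (c *s x) = c * f x"
    "f ((h ^^ (k - 1)) v) \<noteq> 0"
    by (rule separating_functional[OF v(2)]) (rule that)
  have f0: "f 0 = 0" using f(2)[of 0 0] by simp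
  have fd: "f (x - y) = f x - f y" for x y using f(1)[of "x - y" y] by simp
  define D' where "D' = {x \<in> K. \<forall>i<k. f ((h ^^ i) x) = 0}"
  have key: "\<forall>i<k. a i = 0" if "\<And>i. i < k \<Longrightarrow> f ((h ^^ i) (\<Sum>i<k. a i *s (h ^^ i) v)) = 0" for a
  proof (rule ccontr)
    assume "\<not> (\<forall>i<k. a i = 0)"
    \<comment> \<open>The least index with a nonzero coefficient. After applying h^(k - 1 - i) the
      earlier terms are zero by minimality and the later ones because h^k = 0.\<close>
    then obtain i where i: "i < k" "a i \<noteq> 0" "\<And>j. j < i \<Longrightarrow> a j = 0"
      using exists_least_iff[of "\<lambda>i. i < k \<and> a i \<noteq> 0"] by (metis order.strict_trans)
    have "(h ^^ (k - 1 - i)) (\<Sum>j<k. a j *s (h ^^ j) v) = (\<Sum>j<k. a j *s (h ^^ (k - 1 - i + j)) v)"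
      by (simp add: pow_sum pow pow_pow)
    also have "\<dots> = (\<Sum>j\<in>{i}. a j *s (h ^^ (k - 1 - i + j)) v)"
    proof (rule sum.mono_neutral_right)
      show "\<forall>j\<in>{..<k} - {i}. a j *s (h ^^ (k - 1 - i + j)) v = 0"
      proof
        fix j assume "j \<in> {..<k} - {i}"
        then consider "j < i" | "j > i" by fastforce
        then show "a j *s (h ^^ (k - 1 - i + j)) v = 0"
          using i v(1) nil'[of v "k - 1 - i + j"] by cases auto
      qed
    qed (use i in auto)
    also have "\<dots> = a i *s (h ^^ (k - 1)) v" using i by simp
    finally show False using that[of "k - 1 - i"] f i v(3) by simp
  qed
  have D_sum: "\<exists>a. x = (\<Sum>i<k. a i *s (h ^^ i) v)" if "x \<in> D" for x
    using that unfolding D_def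
  proof (induction rule: span_induct_alt)
    case base
    then show ?case by (intro exI[of _ "\<lambda>_. 0"]) simp
  next
    case (step c u x)
    then obtain a i where *: "x = (\<Sum>i<k. a i *s (h ^^ i) v)" "u = (h ^^ i) v" "i < k" by blast
    have "(\<Sum>j<k. (if j = i then c else 0) *s (h ^^ j) v) = c *s u"
      using *(2,3) by (subst sum.remove[of _ i]) (auto intro!: sum.neutral)
    then show ?case using *
      by (intro exI[of _ "\<lambda>j. (if j = i then c else 0) + a j"]) (simp add: scale_left_distrib sum.distrib)
  qed
  have DK: "D \<subseteq> K" unfolding D_def using K(1) powK v by (intro span_minimal) auto
  show thesis
  proof (rule that[of D'])
    show "subspace D'"
      by (rule subspaceI) (auto simp: D'_def pow f f0 subspace_0 subspace_add subspace_scale K(1))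
    show "D' \<subseteq> K" by (auto simp: D'_def)
    show "h x \<in> D'" if x: "x \<in> D'" for x
    proof -
      have "f ((h ^^ i) (h x)) = 0" if "i < k" for i
      proof (cases "Suc i = k")
        case True
        have "(h ^^ i) (h x) = (h ^^ Suc i) x" by (simp only: funpow_Suc_right o_apply)
        then show ?thesis using x nil True by (simp add: D'_def f0 del: funpow.simps)
      next
        case False
        have "(h ^^ i) (h x) = (h ^^ Suc i) x" by (simp only: funpow_Suc_right o_apply)
        then show ?thesis using x that False by (simp add: D'_def del: funpow.simps)
      qed
      then show ?thesis using x K by (simp add: D'_def)
    qed
    have "x = 0" if x: "x \<in> D" "x \<in> D'" for x
    proof -
      obtain a where a: "x = (\<Sum>i<k. a i *s (h ^^ i) v)" using D_sum[OF x(1)] by blast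
      then have "\<forall>i<k. a i = 0" using x(2) by (intro key) (simp add: D'_def)
      then show ?thesis using a by simp
    qed
    moreover have "0 \<in> D" by (simp add: D_def span_zero)
    moreover have "0 \<in> D'" using K(1) by (simp add: D'_def pow f0 subspace_0)
    ultimately show "D \<inter> D' = {0}" by auto
    show "\<forall>i<k. a i = 0" if "(\<Sum>i<k. a i *s (h ^^ i) v) = 0" for a
      using that by (intro key) (simp add: pow f0)
    show "\<exists>y\<in>D. x - y \<in> D'" if x: "x \<in> K" for x
    proof -
      \<comment> \<open>Elimination from the highest power down: stage j arranges the vanishing for
        all i \<ge> k - j.\<close>
      have "\<exists>y\<in>D. \<forall>i<k. k \<le> i + j \<longrightarrow> f ((h ^^ i) (x - y)) = 0" if "j \<le> k" for j
        using that
      proof (induction j)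
        case 0
        then show ?case by (intro bexI[of _ 0]) (auto simp: D_def span_zero)
      next
        case (Suc j)
        then obtain y where y: "y \<in> D" "\<And>i. i < k \<Longrightarrow> k \<le> i + j \<Longrightarrow> f ((h ^^ i) (x - y)) = 0" by auto
        define i0 where "i0 = k - Suc j"
        have i0: "i0 + j = k - 1" "i0 < k" using Suc.prems by (auto simp: i0_def)
        \<comment> \<open>Adding b h^j v corrects the value at i0 = k - 1 - j and leaves larger i
          alone, since h^(i + j) v = 0 there.\<close>
        define b where "b = f ((h ^^ i0) (x - y)) / f ((h ^^ (k - 1)) v)"
        let ?y = "y + b *s (h ^^ j) v"
        have "f ((h ^^ i) (x - ?y)) = 0" if i: "i < k" "k \<le> i + Suc j" for i
        proof -
          have "(h ^^ i) (x - ?y) = (h ^^ i) (x - y) - b *s (h ^^ (i + j)) v"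
            by (simp add: pow pow_pow algebra_simps)
          then have eq: "f ((h ^^ i) (x - ?y)) = f ((h ^^ i) (x - y)) - b * f ((h ^^ (i + j)) v)"
            by (simp only: fd f(2))
          show ?thesis
          proof (cases "i = i0")
            case True
            then show ?thesis using eq i0 f(3) by (simp add: b_def)
          next
            case False
            then have ij: "k \<le> i + j" using i by (auto simp: i0_def)
            then show ?thesis using eq y(2)[OF i(1) ij] nil'[OF v(1) ij] by (simp add: f0)
          qed
        qed
        moreover have "(h ^^ j) v \<in> D" unfolding D_def using Suc.prems by (intro span_base) auto
        then have "?y \<in> D" using y(1) unfolding D_def by (intro span_add span_scale)
        ultimately show ?case by blast
      qed
      from this[of k] obtain y where "y \<in> D" "\<forall>i<k. f ((h ^^ i) (x - y)) = 0" by auto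
      then show ?thesis using x DK K(1) by (intro bexI[of _ y]) (auto simp: D'_def subspace_diff)
    qed
  qed
qed

text \<open>
  The vector \<open>u n j\<close> plays the role of \<open>\<gamma>\<^sub>0\<close> to the power \<open>n - \<mu>\<close> times the \<open>j\<close>-th power of
  \<open>log \<gamma>\<^sub>0\<close>.
\<close>

definition (in bg_space) jordan_basis :: "complex \<Rightarrow> nat \<Rightarrow> (int \<Rightarrow> nat \<Rightarrow> 'a) \<Rightarrow> bool" where
  "jordan_basis \<mu> k u \<longleftrightarrow> (\<forall>n j. u n j \<in> C) \<and> (\<forall>n j g. mode g > 0 \<longrightarrow> act g (u n j) = 0) \<and>
     (\<forall>n j. act (Gamma 0) (u n j) = u (n + 1) j) \<and>
     (\<forall>n. \<forall>j<k. act (Beta 0) (u n j) = - ((of_int n - \<mu>) *s u (n - 1) j + of_nat j *s u (n - 1) (j - 1))) \<and>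
     (\<forall>F a. finite F \<and> F \<subseteq> UNIV \<times> {..<k} \<and> (\<Sum>(n, j)\<in>F. a (n, j) *s u n j) = 0 \<longrightarrow> (\<forall>i\<in>F. a i = 0)) \<and>
     (\<forall>G. submod G \<and> (\<forall>n. \<forall>j<k. u n j \<in> G) \<longrightarrow> C \<subseteq> G)"

lemma (in bg_space) jordan_basisD:
  assumes "jordan_basis \<mu> k u"
  shows "\<lbrakk>finite F; F \<subseteq> UNIV \<times> {..<k}; (\<Sum>(n, j)\<in>F. a (n, j) *s u n j) = 0\<rbrakk> \<Longrightarrow> \<forall>i\<in>F. a i = 0"
    and "submod G \<Longrightarrow> \<forall>n. \<forall>j<k. u n j \<in> G \<Longrightarrow> C \<subseteq> G"
proof -
  have "\<forall>F a. finite F \<and> F \<subseteq> UNIV \<times> {..<k} \<and> (\<Sum>(n, j)\<in>F. a (n, j) *s u n j) = 0 \<longrightarrow> (\<forall>i\<in>F. a i = 0)"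
    using assms unfolding jordan_basis_def by (elim conjE)
  from this[THEN spec[of _ F], THEN spec[of _ a]]
  show "\<lbrakk>finite F; F \<subseteq> UNIV \<times> {..<k}; (\<Sum>(n, j)\<in>F. a (n, j) *s u n j) = 0\<rbrakk> \<Longrightarrow> \<forall>i\<in>F. a i = 0" by simp
  have "\<forall>G. submod G \<and> (\<forall>n. \<forall>j<k. u n j \<in> G) \<longrightarrow> C \<subseteq> G"
    using assms unfolding jordan_basis_def by (elim conjE)
  then show "submod G \<Longrightarrow> \<forall>n. \<forall>j<k. u n j \<in> G \<Longrightarrow> C \<subseteq> G" by blast
qed

section \<open>The Jordan block of an indecomposable module\<close>

context bg_weight_space
begin

abbreviation "N \<equiv> H.shift 0 \<mu>"

interpretation N: linear_operator scale N
  by unfold_locales (auto simp: H.shift_add H.shift_scale)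

lemma N_E: "x \<in> E \<Longrightarrow> N x \<in> E"
  unfolding H.shift_def by (intro subspace_diff subspace_scale subspace_E H_E)

lemma H_N: "H 0 x = N x + \<mu> *s x"
  by (simp add: H.shift_def)

text \<open>A Jordan block of maximal size in \<open>E\<close> has an \<open>N\<close>-stable
  complement. Both generate submodules, which meet in 0 and together contain \<open>E\<close>, so
  they decompose C; indecomposability then removes the complement.\<close>

lemma single_jordan_block:
  assumes indec: "\<And>A B. submod A \<Longrightarrow> submod B \<Longrightarrow> A \<inter> B = {0} \<Longrightarrow> (\<And>x. x \<in> C \<Longrightarrow> \<exists>y\<in>A. x - y \<in> B)
      \<Longrightarrow> A = {0} \<or> B = {0}"
  obtains k v where "v \<in> E" "(N ^^ k) v = 0" "E \<subseteq> span {(N ^^ i) v | i. i < k}"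
    "\<And>a. (\<Sum>i<k. a i *s (N ^^ i) v) = 0 \<Longrightarrow> \<forall>i<k. a i = 0"
proof (cases "E = {0}")
  case True
  show thesis by (rule that[of 0 0]) (auto simp: True span_zero)
next
  case False
  have ex: "\<forall>x\<in>E. (N ^^ r) x = 0" using bounded topD by (auto simp: E_def)
  \<comment> \<open>A common exponent for all of \<open>E\<close> exists because r bounds the
    nilpotency order of each vector.\<close>
  define k where "k = (LEAST n. \<forall>x\<in>E. (N ^^ n) x = 0)"
  have nil: "(N ^^ k) x = 0" if "x \<in> E" for x unfolding k_def using LeastI[of "\<lambda>n. \<forall>x\<in>E. (N ^^ n) x = 0", OF ex] that by blast
  have "k > 0"
  proof (rule ccontr)
    assume "\<not> k > 0"
    then have "x = 0" if "x \<in> E" for x using nil[OF that] by simp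
    then show False using False subspace_0[OF subspace_E] by auto
  qed
  then have "\<not> (\<forall>x\<in>E. (N ^^ (k - 1)) x = 0)" unfolding k_def by (intro not_less_Least) auto
  then obtain v where v: "v \<in> E" "(N ^^ (k - 1)) v \<noteq> 0" by blast
  let ?D = "span {(N ^^ i) v | i. i < k}"
  obtain D' where D': "subspace D'" "D' \<subseteq> E" "\<And>x. x \<in> D' \<Longrightarrow> N x \<in> D'" "?D \<inter> D' = {0}"
    "\<And>x. x \<in> E \<Longrightarrow> \<exists>y\<in>?D. x - y \<in> D'"
    and ind: "\<And>a. (\<Sum>i<k. a i *s (N ^^ i) v) = 0 \<Longrightarrow> \<forall>i<k. a i = 0"
    by (rule N.cyclic_complement[OF subspace_E N_E nil v \<open>k > 0\<close>]) (assumption | rule that)+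
  have NiE: "(N ^^ i) v \<in> E" for i by (induction i) (auto simp: v N_E)
  then have DE: "?D \<subseteq> E" by (intro span_minimal subspace_E) auto
  have DN: "N x \<in> ?D" if "x \<in> ?D" for x
    using that
  proof (induction rule: span_induct_alt)
    case base
    then show ?case by (simp add: span_zero)
  next
    case (step c u x)
    then obtain i where i: "u = (N ^^ i) v" "i < k" by blast
    have "N u \<in> ?D"
    proof (cases "Suc i < k")
      case True
      have "N u = (N ^^ Suc i) v" by (simp add: i)
      then show ?thesis using True by (intro span_base) blast
    next
      case False
      then have "Suc i = k" using i by simp
      then have "N u = (N ^^ k) v" using i by auto
      then show ?thesis using nil[OF v(1)] by (simp add: span_zero)
    qed
    then show ?case using step by (simp add: H.shift_add H.shift_scale span_add span_scale)
  qed
  have DH: "H 0 x \<in> ?D" if "x \<in> ?D" for x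
    using span_add[OF DN[OF that] span_scale[OF that]] by (subst H_N)
  have DH': "H 0 x \<in> D'" if "x \<in> D'" for x
    using subspace_add[OF D'(1) D'(3)[OF that] subspace_scale[OF D'(1) that]] by (subst H_N)
  have "E \<subseteq> C" using E_top topD(1) by blast
  then have C: "?D \<subseteq> C" "D' \<subseteq> C" using DE D'(2) by (simp_all only: subset_trans)
  have sub: "submod (gen ?D)" "submod (gen D')" using C by (auto intro: submod_gen)
  let ?G = "{x + y | x y. x \<in> gen ?D \<and> y \<in> gen D'}"
  have "E \<subseteq> ?G"
  proof
    fix x assume "x \<in> E"
    then obtain y where "y \<in> ?D" "x - y \<in> D'" using D'(5) by blast
    then have "x = y + (x - y)" "y \<in> gen ?D" "x - y \<in> gen D'" using gen_base by auto
    then show "x \<in> ?G" by blast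
  qed
  then have CG: "C \<subseteq> ?G" by (rule E_generates[OF submod_sum[OF sub]])
  have "\<exists>y\<in>gen ?D. x - y \<in> gen D'" if x: "x \<in> C" for x
  proof -
    obtain y z where "x = y + z" "y \<in> gen ?D" "z \<in> gen D'" using subsetD[OF CG x] by blast
    then show ?thesis by (intro bexI[of _ y]) simp_all
  qed
  then have "gen ?D = {0} \<or> gen D' = {0}"
    by (intro indec sub gen_disjoint[OF subspace_span DE DH D'(1,2) DH' D'(4)])
  moreover have "gen ?D \<noteq> {0}"
  proof
    assume "gen ?D = {0}"
    moreover have "v \<in> gen ?D" using \<open>k > 0\<close> by (intro gen_base span_base) (auto intro!: exI[of _ 0])
    ultimately have "v = 0" by simp
    moreover have "(N ^^ n) 0 = 0" for n by (induction n) auto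
    ultimately show False using v(2) by simp
  qed
  ultimately have "gen D' = {0}" by blast
  then have "D' \<subseteq> {0}" using gen_base by blast
  then have "E \<subseteq> ?D" using D'(5) by fastforce
  then show thesis using that[OF v(1) nil[OF v(1)] _ ind] by blast
qed

theorem jordan_basis_exists:
  assumes indec: "\<And>A B. submod A \<Longrightarrow> submod B \<Longrightarrow> A \<inter> B = {0} \<Longrightarrow> (\<And>x. x \<in> C \<Longrightarrow> \<exists>y\<in>A. x - y \<in> B)
      \<Longrightarrow> A = {0} \<or> B = {0}"
  shows "\<exists>k u. jordan_basis \<mu> k u"
proof -
  obtain k v where v: "v \<in> E" "(N ^^ k) v = 0" "E \<subseteq> span {(N ^^ i) v | i. i < k}"
    "\<And>a. (\<Sum>i<k. a i *s (N ^^ i) v) = 0 \<Longrightarrow> \<forall>i<k. a i = 0"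
    by (rule single_jordan_block[OF indec]) (assumption | rule that)+
  \<comment> \<open>The chain is read backwards, with v at the top power of the logarithm, so that
    \<open>N\<close> lowers the exponent. The factor (-1)^j j! turns N (w j) into - j w (j - 1), the
    derivative rule for powers of the logarithm with the sign of beta_0.\<close>
  define \<kappa> :: "nat \<Rightarrow> complex" where "\<kappa> j = (- 1) ^ j * fact j" for j
  have \<kappa>: "\<kappa> j \<noteq> 0" for j by (simp add: \<kappa>_def)
  define w where "w j = \<kappa> j *s (N ^^ (k - 1 - j)) v" for j
  define u where "u n j = gamma_power n (w j)" for n j
  have NiE: "(N ^^ i) v \<in> E" for i by (induction i) (auto simp: v N_E)
  have wE: "w j \<in> E" for j unfolding w_def by (intro subspace_scale subspace_E NiE)
  have wtop: "w j \<in> top" for j using wE E_top by blast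
  have utop: "u n j \<in> top" for n j unfolding u_def by (rule gamma_power_top[OF wtop])
  have Nw: "N (w j) = - (of_nat j *s w (j - 1))" if "j < k" for j
  proof -
    have "N (w j) = \<kappa> j *s (N ^^ Suc (k - 1 - j)) v" by (simp add: w_def H.shift_scale)
    also have "\<dots> = - (of_nat j *s w (j - 1))"
    proof (cases j)
      case 0
      then have "Suc (k - 1 - j) = k" using that by simp
      then show ?thesis using v(2) 0 by (simp del: funpow.simps)
    next
      case (Suc i)
      then have "Suc (k - 1 - j) = k - 1 - i" using that by simp
      then show ?thesis using Suc by (simp add: w_def \<kappa>_def algebra_simps del: funpow.simps)
    qed
    finally show ?thesis .
  qed
  have "jordan_basis \<mu> k u"
    unfolding jordan_basis_def
  proof (intro conjI allI impI)
    show "u n j \<in> C" for n j using utop topD by blast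
    show "act g (u n j) = 0" if "mode g > 0" for n j g using topD(2)[OF utop that] .
    show "\<gamma> (u n j) = u (n + 1) j" for n j unfolding u_def by (rule gamma_gamma_power[OF wtop])
    show "\<beta> (u n j) = - ((of_int n - \<mu>) *s u (n - 1) j + of_nat j *s u (n - 1) (j - 1))" if "j < k" for n j
    proof -
      have "H.shift 0 (of_int n) (w j) = (\<mu> - of_int n) *s w j + N (w j)"
        by (simp add: H.shift_def algebra_simps)
      also have "\<dots> = (- 1) *s ((of_int n - \<mu>) *s w j + of_nat j *s w (j - 1))"
        unfolding Nw[OF that] by (simp add: algebra_simps)
      finally have *: "H.shift 0 (of_int n) (w j) = \<dots>" .
      have t: "(of_int n - \<mu>) *s w j \<in> top" "of_nat j *s w (j - 1) \<in> top"
        using wtop by (auto intro: subspace_scale[OF subspace_top])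
      have "\<beta> (u n j) = (- 1) *s gamma_power (n - 1) ((of_int n - \<mu>) *s w j + of_nat j *s w (j - 1))"
        unfolding u_def beta_gamma_power[OF wtop] *
        by (rule gamma_power_scale[OF subspace_add[OF subspace_top t]])
      also have "\<dots> = (- 1) *s ((of_int n - \<mu>) *s u (n - 1) j + of_nat j *s u (n - 1) (j - 1))"
        unfolding gamma_power_add[OF t] by (simp only: gamma_power_scale[OF wtop] u_def)
      finally show ?thesis by simp
    qed
    show "\<forall>i\<in>F. a i = 0"
      if "finite F \<and> F \<subseteq> UNIV \<times> {..<k} \<and> (\<Sum>(n, j)\<in>F. a (n, j) *s u n j) = 0" for F a
    proof -
      have F: "finite F" "F \<subseteq> UNIV \<times> {..<k}" and sum0: "(\<Sum>(n, j)\<in>F. a (n, j) *s u n j) = 0"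
        using that by auto
      \<comment> \<open>Extends a by zero to the rectangle of all n in the projection of F and all j
        < k, so that the sum can be grouped by n.\<close>
      define a' where "a' i = (if i \<in> F then a i else 0)" for i
      have top: "(\<Sum>j\<in>J. a' (n, j) *s w j) \<in> top" for n J
        using wtop by (intro subspace_sum subspace_top subspace_scale)
      have gp: "gamma_power n (\<Sum>j\<in>J. a' (n, j) *s w j) = (\<Sum>j\<in>J. a' (n, j) *s u n j)" if "finite J" for n J
        using that
      proof (induction J rule: finite_induct)
        case (insert j J)
        then show ?case using top wtop
          by (simp add: gamma_power_add gamma_power_scale subspace_scale subspace_top u_def)
      qed simp
      have "0 = (\<Sum>i\<in>F. a' i *s u (fst i) (snd i))"
        using sum0 by (simp add: a'_def case_prod_unfold)
      also have "\<dots> = (\<Sum>i\<in>fst ` F \<times> {..<k}. a' i *s u (fst i) (snd i))"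
        using F by (intro sum.mono_neutral_left) (force simp: a'_def)+
      also have "\<dots> = (\<Sum>n\<in>fst ` F. \<Sum>j<k. a' (n, j) *s u n j)"
        by (simp add: sum.cartesian_product case_prod_unfold)
      also have "\<dots> = (\<Sum>n\<in>fst ` F. gamma_power n (\<Sum>j<k. a' (n, j) *s w j))"
        by (simp add: gp)
      finally have s: "(\<Sum>n\<in>fst ` F. gamma_power n (\<Sum>j<k. a' (n, j) *s w j)) = 0" by simp
      have "(\<Sum>j<k. a' (n, j) *s w j) = 0" if "n \<in> fst ` F" for n
      proof (rule gamma_power_independent[OF _ _ s that])
        show "(\<Sum>j<k. a' (n, j) *s w j) \<in> E" for n
          using wE by (intro subspace_sum subspace_E subspace_scale)
      qed (use F in simp)
      \<comment> \<open>Reverses the index, because w j involves the power k - 1 - j of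
        \<open>N\<close>.\<close>
      then have "(\<Sum>i<k. (a' (n, k - 1 - i) * \<kappa> (k - 1 - i)) *s (N ^^ i) v) = 0" if "n \<in> fst ` F" for n
        using sum.nat_diff_reindex[of "\<lambda>j. a' (n, j) *s w j" k] that
        by (simp add: w_def cong: sum.cong_simp)
      then have rev: "a' (n, k - 1 - i) = 0" if "n \<in> fst ` F" "i < k" for n i
        using v(4)[of "\<lambda>i. a' (n, k - 1 - i) * \<kappa> (k - 1 - i)"] that \<kappa> by auto
      have zero: "a' (n, j) = 0" if "n \<in> fst ` F" "j < k" for n j
        using rev[of n "k - 1 - j"] that by simp
      show ?thesis
      proof
        fix i assume i: "i \<in> F"
        then have "fst i \<in> fst ` F" "snd i < k" using F by auto
        then have "a' (fst i, snd i) = 0" by (rule zero)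
        then show "a i = 0" using i by (simp add: a'_def)
      qed
    qed
    show "C \<subseteq> G" if "submod G \<and> (\<forall>n. \<forall>j<k. u n j \<in> G)" for G
    proof -
      have G: "submod G" "\<forall>n. \<forall>j<k. u n j \<in> G" using that by auto
      have "(N ^^ i) v \<in> G" if "i < k" for i
      proof -
        have "u 0 (k - 1 - i) \<in> G" using that G(2) by auto
        then have "(1 / \<kappa> (k - 1 - i)) *s u 0 (k - 1 - i) \<in> G"
          by (rule subspace_scale[OF submod_subspace[OF G(1)]])
        then show ?thesis using \<kappa> that by (simp add: u_def w_def)
      qed
      then have "E \<subseteq> G" using v(3) span_minimal[OF _ submod_subspace[OF G(1)], of "{(N ^^ i) v | i. i < k}"] by blast
      then show ?thesis by (rule E_generates[OF G(1)])
    qed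
  qed
  then show ?thesis by blast
qed

end

section \<open>Homomorphisms, submodules and quotients of module records\<close>

lemma complex_ring_simps [simp]:
  "carrier complex_ring = UNIV" "add complex_ring = (+)" "mult complex_ring = (*)"
  "one complex_ring = 1" "zero complex_ring = 0"
  by (simp_all add: complex_ring_def)

lemma cring_complex_ring: "cring complex_ring"
proof (rule cringI)
  show "abelian_group complex_ring"
    by (rule abelian_groupI) (auto intro: exI[of _ "- x" for x])
  show "comm_monoid complex_ring"
    by (rule comm_monoidI) auto
qed (auto simp: algebra_simps)

text \<open>Leaves out the commutation relations, which the free module on words does not
  satisfy.\<close>

locale bg_premodule = module complex_ring M for M :: "'v bg_rep" (structure) +
  assumes act_closed: "x \<in> carrier M \<Longrightarrow> act M g x \<in> carrier M"
    and act_add: "x \<in> carrier M \<Longrightarrow> y \<in> carrier M \<Longrightarrow> act M g (x \<oplus> y) = act M g x \<oplus> act M g y"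
    and act_smult: "x \<in> carrier M \<Longrightarrow> act M g (c \<odot> x) = c \<odot> act M g x"

lemma bg_module_premodule: "bg_module M \<Longrightarrow> bg_premodule M"
  unfolding bg_premodule_def bg_premodule_axioms_def bg_module_def bg_module_axioms_def by blast

lemma bg_homD:
  assumes "f \<in> bg_hom M N"
  shows "x \<in> carrier M \<Longrightarrow> f x \<in> carrier N"
    and "x \<in> carrier M \<Longrightarrow> y \<in> carrier M \<Longrightarrow> f (x \<oplus>\<^bsub>M\<^esub> y) = f x \<oplus>\<^bsub>N\<^esub> f y"
    and "x \<in> carrier M \<Longrightarrow> f (c \<odot>\<^bsub>M\<^esub> x) = c \<odot>\<^bsub>N\<^esub> f x"
    and "x \<in> carrier M \<Longrightarrow> f (act M g x) = act N g (f x)"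
  using assms by (auto simp: bg_hom_def)

lemma bg_homI:
  assumes "\<And>x. x \<in> carrier M \<Longrightarrow> f x \<in> carrier N"
    and "\<And>x y. x \<in> carrier M \<Longrightarrow> y \<in> carrier M \<Longrightarrow> f (x \<oplus>\<^bsub>M\<^esub> y) = f x \<oplus>\<^bsub>N\<^esub> f y"
    and "\<And>c x. x \<in> carrier M \<Longrightarrow> f (c \<odot>\<^bsub>M\<^esub> x) = c \<odot>\<^bsub>N\<^esub> f x"
    and "\<And>g x. x \<in> carrier M \<Longrightarrow> f (act M g x) = act N g (f x)"
  shows "f \<in> bg_hom M N"
  using assms by (auto simp: bg_hom_def)

lemma bg_hom_comp: "f \<in> bg_hom M N \<Longrightarrow> g \<in> bg_hom N P \<Longrightarrow> g \<circ> f \<in> bg_hom M P"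
  by (intro bg_homI) (simp_all add: bg_homD[of f M N] bg_homD[of g N P])

lemma bg_iso_trans: "bg_iso M N \<Longrightarrow> bg_iso N P \<Longrightarrow> bg_iso M P"
  unfolding bg_iso_def by (meson bg_hom_comp bij_betw_trans)

text \<open>Closure is what the passage to representatives in \<open>bg_iso_common_source\<close>
  relies on, and it is available for quotient records without showing them to be modules.\<close>

definition bg_closed :: "'v bg_rep \<Rightarrow> bool" where
  "bg_closed M \<longleftrightarrow> (\<forall>x\<in>carrier M. (\<forall>y\<in>carrier M. x \<oplus>\<^bsub>M\<^esub> y \<in> carrier M) \<and>
     (\<forall>c. c \<odot>\<^bsub>M\<^esub> x \<in> carrier M) \<and> (\<forall>g. act M g x \<in> carrier M))"

lemma (in bg_premodule) bg_closed: "bg_closed M"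
  by (simp add: bg_closed_def act_closed)

text \<open>The first isomorphism theorem in symmetric form. With a coset map it identifies
  quotients; with the identity as second map it inverts an isomorphism.\<close>

lemma bg_iso_common_source:
  assumes M: "bg_closed M" and \<kappa>: "\<kappa> \<in> bg_hom M A" "\<kappa> ` carrier M = carrier A"
    and \<phi>: "\<phi> \<in> bg_hom M B" "\<phi> ` carrier M = carrier B"
    and eq: "\<And>x y. x \<in> carrier M \<Longrightarrow> y \<in> carrier M \<Longrightarrow> \<kappa> x = \<kappa> y \<longleftrightarrow> \<phi> x = \<phi> y"
  shows "bg_iso A B"
proof -
  define \<psi> where "\<psi> a = \<phi> (SOME x. x \<in> carrier M \<and> \<kappa> x = a)" for a
  have \<psi>: "\<psi> (\<kappa> x) = \<phi> x" if x: "x \<in> carrier M" for x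
  proof -
    let ?y = "SOME y. y \<in> carrier M \<and> \<kappa> y = \<kappa> x"
    have "?y \<in> carrier M \<and> \<kappa> ?y = \<kappa> x" by (rule someI[of _ x]) (simp add: x)
    then show ?thesis using eq[of ?y x] x by (simp add: \<psi>_def)
  qed
  have A: "\<exists>x\<in>carrier M. a = \<kappa> x" if "a \<in> carrier A" for a using that \<kappa>(2) by auto
  have "\<psi> \<in> bg_hom A B"
  proof (rule bg_homI)
    fix a assume "a \<in> carrier A"
    then obtain x where x: "x \<in> carrier M" "a = \<kappa> x" using A by blast
    then show "\<psi> a \<in> carrier B" by (simp add: \<psi> bg_homD[OF \<phi>(1)])
    show "\<psi> (c \<odot>\<^bsub>A\<^esub> a) = c \<odot>\<^bsub>B\<^esub> \<psi> a" for c
      using x M by (simp add: \<psi> bg_closed_def bg_homD(3)[OF \<phi>(1)] flip: bg_homD(3)[OF \<kappa>(1)])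
    show "\<psi> (act A g a) = act B g (\<psi> a)" for g
      using x M by (simp add: \<psi> bg_closed_def bg_homD(4)[OF \<phi>(1)] flip: bg_homD(4)[OF \<kappa>(1)])
    fix b assume "b \<in> carrier A"
    then obtain y where y: "y \<in> carrier M" "b = \<kappa> y" using A by blast
    show "\<psi> (a \<oplus>\<^bsub>A\<^esub> b) = \<psi> a \<oplus>\<^bsub>B\<^esub> \<psi> b"
      using x y M by (simp add: \<psi> bg_closed_def bg_homD(2)[OF \<phi>(1)] flip: bg_homD(2)[OF \<kappa>(1)])
  qed
  moreover have "bij_betw \<psi> (carrier A) (carrier B)"
    unfolding bij_betw_def
  proof
    show "inj_on \<psi> (carrier A)"
    proof (rule inj_onI)
      fix a b assume "a \<in> carrier A" "b \<in> carrier A" "\<psi> a = \<psi> b"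
      then show "a = b" using A[of a] A[of b] \<psi> eq by auto
    qed
    show "\<psi> ` carrier A = carrier B"
      unfolding \<kappa>(2)[symmetric] \<phi>(2)[symmetric] image_image using \<psi> by (simp cong: image_cong)
  qed
  ultimately show ?thesis by (auto simp: bg_iso_def)
qed

lemma bg_iso_sym:
  assumes "bg_closed M" "bg_iso M N"
  shows "bg_iso N M"
proof -
  obtain f where f: "f \<in> bg_hom M N" "bij_betw f (carrier M) (carrier N)" using assms by (auto simp: bg_iso_def)
  show ?thesis
    by (rule bg_iso_common_source[OF assms(1) f(1) _ _ , of id])
      (use f(2) in \<open>auto simp: bij_betw_def inj_on_eq_iff intro: bg_homI\<close>)
qed

lemma bg_flow_simps [simp]:
  "carrier (bg_flow n M) = carrier M" "add (bg_flow n M) = add M" "smult (bg_flow n M) = smult M"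
  "zero (bg_flow n M) = zero M" "act (bg_flow n M) g = act M (bg_sigma (- n) g)"
  by (simp_all add: bg_flow_def)

lemma bg_iso_flow: "bg_iso M N \<Longrightarrow> bg_iso (bg_flow n M) (bg_flow n N)"
proof -
  assume "bg_iso M N"
  then obtain f where f: "f \<in> bg_hom M N" "bij_betw f (carrier M) (carrier N)" by (auto simp: bg_iso_def)
  have "f \<in> bg_hom (bg_flow n M) (bg_flow n N)"
    by (rule bg_homI) (simp_all add: bg_homD[OF f(1)])
  with f(2) show ?thesis by (auto simp: bg_iso_def)
qed

section \<open>Submodules and quotients of records\<close>

context bg_premodule
begin

lemma bg_submoduleD:
  assumes "bg_submodule H M"
  shows "H \<subseteq> carrier M" "\<zero> \<in> H" "x \<in> H \<Longrightarrow> y \<in> H \<Longrightarrow> x \<oplus> y \<in> H" "x \<in> H \<Longrightarrow> c \<odot> x \<in> H"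
    "x \<in> H \<Longrightarrow> act M g x \<in> H" "x \<in> H \<Longrightarrow> \<ominus> x \<in> H" "x \<in> H \<Longrightarrow> y \<in> H \<Longrightarrow> x \<ominus> y \<in> H"
proof -
  have H: "submodule H complex_ring M" using assms by (simp add: bg_submodule_def)
  show "H \<subseteq> carrier M" by (rule submoduleE(1)[OF H])
  show "\<zero> \<in> H" using subgroup.one_closed[OF submodule.axioms(1)[OF H]] by simp
  show *: "x \<in> H \<Longrightarrow> y \<in> H \<Longrightarrow> x \<oplus> y \<in> H" for x y by (rule submoduleE(5)[OF H])
  show "x \<in> H \<Longrightarrow> c \<odot> x \<in> H" by (rule submoduleE(4)[OF H]) simp_all
  show **: "x \<in> H \<Longrightarrow> \<ominus> x \<in> H" for x by (rule submoduleE(3)[OF H])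
  show "x \<in> H \<Longrightarrow> y \<in> H \<Longrightarrow> x \<ominus> y \<in> H" by (simp add: a_minus_def * **)
  show "x \<in> H \<Longrightarrow> act M g x \<in> H" using assms by (simp add: bg_submodule_def)
qed

lemma neg_eq_smult: "x \<in> carrier M \<Longrightarrow> \<ominus> x = (- 1) \<odot> x"
proof -
  assume x: "x \<in> carrier M"
  have "x \<oplus> (- 1) \<odot> x = (1 + - 1 :: complex) \<odot> x"
    using smult_l_distr[of 1 "- 1" x] smult_one[OF x] x by simp
  also have "\<dots> = \<zero>" using smult_l_null[OF x] by simp
  finally have "(- 1) \<odot> x \<oplus> x = \<zero>" using x by (simp add: M.a_comm)
  then show ?thesis using M.minus_equality[of "(- 1) \<odot> x" x] x by simp
qed

lemma bg_submoduleI: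
  assumes "H \<subseteq> carrier M" "\<zero> \<in> H" "\<And>x y. x \<in> H \<Longrightarrow> y \<in> H \<Longrightarrow> x \<oplus> y \<in> H"
    "\<And>c x. x \<in> H \<Longrightarrow> c \<odot> x \<in> H" "\<And>g x. x \<in> H \<Longrightarrow> act M g x \<in> H"
  shows "bg_submodule H M"
  unfolding bg_submodule_def
proof (intro conjI allI ballI)
  show "submodule H complex_ring M"
    using assms by (intro submoduleI) (auto simp: neg_eq_smult subset_iff)
qed (use assms in auto)

lemma restrict_premodule:
  assumes "bg_submodule H M"
  shows "bg_premodule (M\<lparr>carrier := H\<rparr>)"
proof -
  have "module complex_ring (M\<lparr>carrier := H\<rparr>)"
    using assms by (intro submodule.submodule_is_module module_axioms) (simp add: bg_submodule_def)
  then interpret H: module complex_ring "M\<lparr>carrier := H\<rparr>" .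
  show ?thesis
    by unfold_locales (use bg_submoduleD[OF assms] in \<open>auto simp: act_add act_smult subset_iff\<close>)
qed

lemma restrict_submodule:
  assumes "bg_submodule H M" "bg_submodule K M" "K \<subseteq> H"
  shows "bg_submodule K (M\<lparr>carrier := H\<rparr>)"
  using bg_premodule.bg_submoduleI[OF restrict_premodule[OF assms(1)], of K] bg_submoduleD[OF assms(2)] assms(3)
  by simp

lemma bg_submodule_Int: "bg_submodule H M \<Longrightarrow> bg_submodule K M \<Longrightarrow> bg_submodule (H \<inter> K) M"
  using bg_submoduleD[of H] bg_submoduleD[of K] by (intro bg_submoduleI) auto

lemma minus_eq: "x \<in> carrier M \<Longrightarrow> y \<in> carrier M \<Longrightarrow> x \<ominus> y = x \<oplus> (- 1) \<odot> y"
  by (simp add: a_minus_def neg_eq_smult)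

lemma bg_quot_hom:
  assumes H: "bg_submodule H M"
  shows "(\<lambda>x. H +> x) \<in> bg_hom M (bg_quot M H)"
    and "(\<lambda>x. H +> x) ` carrier M = carrier (bg_quot M H)"
    and "x \<in> carrier M \<Longrightarrow> y \<in> carrier M \<Longrightarrow> H +> x = H +> y \<longleftrightarrow> x \<ominus> y \<in> H"
proof -
  have sub: "subgroup H (add_monoid M)"
    using H by (simp add: bg_submodule_def submodule_def)
  interpret S: abelian_subgroup H M
    by (intro abelian_subgroupI3 additive_subgroupI sub) (unfold_locales)
  note HD = bg_submoduleD[OF H]
  show eq: "H +> x = H +> y \<longleftrightarrow> x \<ominus> y \<in> H" if xy: "x \<in> carrier M" "y \<in> carrier M" for x y
  proof
    assume "H +> x = H +> y"
    then have "x \<in> H +> y" using S.a_rcos_self[OF xy(1)] by simp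
    then obtain h where h: "h \<in> H" "x = h \<oplus> y" by (auto simp: a_r_coset_def')
    then have "x \<ominus> y = h" using xy HD(1) by (auto simp: a_minus_def M.a_assoc M.r_neg)
    then show "x \<ominus> y \<in> H" using h by simp
  next
    assume *: "x \<ominus> y \<in> H"
    have "x = (x \<ominus> y) \<oplus> y" using xy by (simp add: a_minus_def M.a_assoc M.l_neg)
    then have "x \<in> H +> y" using * by (auto simp: a_r_coset_def')
    then show "H +> x = H +> y" using M.a_repr_independence[OF _ xy(2) sub] by simp
  qed
  show surj: "(\<lambda>x. H +> x) ` carrier M = carrier (bg_quot M H)"
    by (auto simp: bg_quot_def A_RCOSETS_def')
  \<comment> \<open>The operations of \<open>bg_quot\<close> are unions over the members of a coset.
    All members give the same coset, so the union collapses to the value at one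
    representative.\<close>
  have const: "(\<Union>a\<in>H +> x. H +> f a) = H +> f x"
    if x: "x \<in> carrier M" and f: "\<And>a. a \<in> carrier M \<Longrightarrow> f a \<in> carrier M"
      "\<And>a b. a \<in> carrier M \<Longrightarrow> b \<in> carrier M \<Longrightarrow> f (a \<oplus> b) = f a \<oplus> f b" "\<And>a. a \<in> H \<Longrightarrow> f a \<in> H" for f x
  proof -
    have "H +> f a = H +> f x" if a: "a \<in> H +> x" for a
    proof -
      obtain h where h: "h \<in> H" "a = h \<oplus> x" using a by (auto simp: a_r_coset_def')
      then have "f a = f h \<oplus> f x" using f x HD(1) by auto
      then have "f a \<in> H +> f x" using f(3)[OF h(1)] by (auto simp: a_r_coset_def')
      then show ?thesis using M.a_repr_independence[OF _ f(1)[OF x] sub] by simp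
    qed
    moreover have "x \<in> H +> x" by (rule S.a_rcos_self[OF x])
    ultimately show ?thesis by blast
  qed
  show "(\<lambda>x. H +> x) \<in> bg_hom M (bg_quot M H)"
  proof (rule bg_homI)
    fix x assume x: "x \<in> carrier M"
    then show "H +> x \<in> carrier (bg_quot M H)" using surj by blast
    show "H +> (c \<odot> x) = c \<odot>\<^bsub>bg_quot M H\<^esub> (H +> x)" for c
      using const[of x "\<lambda>a. c \<odot> a"] x HD by (simp add: bg_quot_def smult_r_distr)
    show "H +> act M g x = act (bg_quot M H) g (H +> x)" for g
      using const[of x "act M g"] x HD by (simp add: bg_quot_def act_closed act_add)
    fix y assume "y \<in> carrier M"
    then show "H +> (x \<oplus> y) = (H +> x) \<oplus>\<^bsub>bg_quot M H\<^esub> (H +> y)"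
      using x by (simp add: bg_quot_def S.a_rcos_sum)
  qed
qed

lemma bg_quot_iso:
  assumes H: "bg_submodule H M" and \<phi>: "\<phi> \<in> bg_hom M T" "\<phi> ` carrier M = carrier T"
    and eq: "\<And>x y. x \<in> carrier M \<Longrightarrow> y \<in> carrier M \<Longrightarrow> \<phi> x = \<phi> y \<longleftrightarrow> x \<ominus> y \<in> H"
  shows "bg_iso (bg_quot M H) T"
  by (rule bg_iso_common_source[OF bg_closed bg_quot_hom(1,2)[OF H] \<phi>])
    (simp add: eq bg_quot_hom(3)[OF H])

lemma bg_closed_quot:
  assumes H: "bg_submodule H M"
  shows "bg_closed (bg_quot M H)"
  unfolding bg_closed_def bg_quot_hom(2)[OF H, symmetric]
proof (intro ballI conjI allI)
  note hom = bg_quot_hom(1)[OF H]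
  fix a assume "a \<in> (\<lambda>x. H +> x) ` carrier M"
  then obtain x where x: "x \<in> carrier M" "a = H +> x" by auto
  show "c \<odot>\<^bsub>bg_quot M H\<^esub> a \<in> (\<lambda>x. H +> x) ` carrier M" for c
    using x by (auto simp flip: bg_homD(3)[OF hom])
  show "act (bg_quot M H) g a \<in> (\<lambda>x. H +> x) ` carrier M" for g
    using x act_closed by (auto simp flip: bg_homD(4)[OF hom])
  fix b assume "b \<in> (\<lambda>x. H +> x) ` carrier M"
  then obtain y where y: "y \<in> carrier M" "b = H +> y" by auto
  show "a \<oplus>\<^bsub>bg_quot M H\<^esub> b \<in> (\<lambda>x. H +> x) ` carrier M"
    using x y by (auto simp flip: bg_homD(2)[OF hom])
qed

text \<open>The second isomorphism theorem: the inclusion of X \<inter> A into X induces the map,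
  and it is onto because every x in X agrees modulo Y with an element of A.\<close>

lemma bg_quot_Int_iso:
  assumes X: "bg_submodule X M" and Y: "bg_submodule Y M" "Y \<subseteq> X" and A: "bg_submodule A M"
    and sum: "\<And>x. x \<in> X \<Longrightarrow> \<exists>a\<in>X \<inter> A. x \<ominus> a \<in> Y"
  shows "bg_iso (bg_quot (M\<lparr>carrier := X \<inter> A\<rparr>) (Y \<inter> A)) (bg_quot (M\<lparr>carrier := X\<rparr>) Y)"
proof -
  have XA: "bg_submodule (X \<inter> A) M" and YA: "bg_submodule (Y \<inter> A) M"
    using X Y A by (auto intro: bg_submodule_Int)
  interpret XA: bg_premodule "M\<lparr>carrier := X \<inter> A\<rparr>" by (rule restrict_premodule[OF XA])
  interpret X: bg_premodule "M\<lparr>carrier := X\<rparr>" by (rule restrict_premodule[OF X])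
  note q = X.bg_quot_hom[OF restrict_submodule[OF X Y]]
  have minus: "x \<ominus>\<^bsub>M\<lparr>carrier := X\<rparr>\<^esub> y = x \<ominus> y" if "x \<in> X" "y \<in> X" for x y
    using that subsetD[OF bg_submoduleD(1)[OF X]] X.minus_eq[of x y] minus_eq[of x y] by simp
  have minus': "x \<ominus>\<^bsub>M\<lparr>carrier := X \<inter> A\<rparr>\<^esub> y = x \<ominus> y" if "x \<in> X \<inter> A" "y \<in> X \<inter> A" for x y
    using that subsetD[OF bg_submoduleD(1)[OF X]] XA.minus_eq[of x y] minus_eq[of x y] by simp
  show ?thesis
  proof (rule XA.bg_quot_iso)
    show "bg_submodule (Y \<inter> A) (M\<lparr>carrier := X \<inter> A\<rparr>)"
      by (rule restrict_submodule[OF XA YA]) (use Y(2) in auto)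
    show "(\<lambda>x. Y +>\<^bsub>M\<lparr>carrier := X\<rparr>\<^esub> x) \<in> bg_hom (M\<lparr>carrier := X \<inter> A\<rparr>) (bg_quot (M\<lparr>carrier := X\<rparr>) Y)"
      using q(1) by (auto simp: bg_hom_def)
    show "(\<lambda>x. Y +>\<^bsub>M\<lparr>carrier := X\<rparr>\<^esub> x) ` carrier (M\<lparr>carrier := X \<inter> A\<rparr>) = carrier (bg_quot (M\<lparr>carrier := X\<rparr>) Y)"
    proof
      show "carrier (bg_quot (M\<lparr>carrier := X\<rparr>) Y) \<subseteq> (\<lambda>x. Y +>\<^bsub>M\<lparr>carrier := X\<rparr>\<^esub> x) ` carrier (M\<lparr>carrier := X \<inter> A\<rparr>)"
      proof
        fix z assume "z \<in> carrier (bg_quot (M\<lparr>carrier := X\<rparr>) Y)"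
        then obtain x where x: "x \<in> X" "z = Y +>\<^bsub>M\<lparr>carrier := X\<rparr>\<^esub> x" using q(2) by auto
        then obtain a where a: "a \<in> X \<inter> A" "x \<ominus> a \<in> Y" using sum by blast
        then have "z = Y +>\<^bsub>M\<lparr>carrier := X\<rparr>\<^esub> a" using q(3)[of x a] x minus by simp
        then show "z \<in> (\<lambda>x. Y +>\<^bsub>M\<lparr>carrier := X\<rparr>\<^esub> x) ` carrier (M\<lparr>carrier := X \<inter> A\<rparr>)" using a by simp
      qed
    qed (use q(2) in auto)
    fix x y assume "x \<in> carrier (M\<lparr>carrier := X \<inter> A\<rparr>)" "y \<in> carrier (M\<lparr>carrier := X \<inter> A\<rparr>)"
    then show "Y +>\<^bsub>M\<lparr>carrier := X\<rparr>\<^esub> x = Y +>\<^bsub>M\<lparr>carrier := X\<rparr>\<^esub> y \<longleftrightarrow> x \<ominus>\<^bsub>M\<lparr>carrier := X \<inter> A\<rparr>\<^esub> y \<in> Y \<inter> A"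
      using q(3)[of x y] minus[of x y] minus'[of x y] bg_submoduleD(7)[OF A, of x y] by auto
  qed
qed

end

definition space_rep :: "(complex \<Rightarrow> 'a::ab_group_add \<Rightarrow> 'a) \<Rightarrow> 'a set \<Rightarrow> (bg_gen \<Rightarrow> 'a \<Rightarrow> 'a) \<Rightarrow> 'a bg_rep" where
  "space_rep s C a = \<lparr>carrier = C, mult = undefined, one = undefined, zero = 0, add = (+), smult = s, act = a\<rparr>"

lemma space_rep_simps [simp]:
  "carrier (space_rep s C a) = C" "zero (space_rep s C a) = 0" "add (space_rep s C a) = (+)"
  "smult (space_rep s C a) = s" "act (space_rep s C a) = a"
  by (simp_all add: space_rep_def)

lemma bg_flow_space_rep: "bg_flow n (space_rep s C a) = space_rep s C (\<lambda>g. a (bg_sigma (- n) g))"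
  by (simp add: bg_flow_def space_rep_def)

lemma bg_premoduleI:
  assumes "vector_space (smult M :: complex \<Rightarrow> 'a::ab_group_add \<Rightarrow> 'a)" "module.subspace (smult M) (carrier M)"
    "add M = (+)" "zero M = 0"
    and act: "\<And>g x. x \<in> carrier M \<Longrightarrow> act M g x \<in> carrier M"
      "\<And>g x y. x \<in> carrier M \<Longrightarrow> y \<in> carrier M \<Longrightarrow> act M g (x + y) = act M g x + act M g y"
      "\<And>g c x. x \<in> carrier M \<Longrightarrow> act M g (smult M c x) = smult M c (act M g x)"
  shows "bg_premodule M"
proof -
  interpret vector_space "smult M" by fact
  note sub = subspace_add[OF assms(2)] subspace_scale[OF assms(2)] subspace_0[OF assms(2)]
  have "abelian_group M"
  proof (rule abelian_groupI)
    fix x assume "x \<in> carrier M"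
    then show "\<exists>y\<in>carrier M. y \<oplus>\<^bsub>M\<^esub> x = \<zero>\<^bsub>M\<^esub>"
      using subspace_neg[OF assms(2)] by (intro bexI[of _ "- x"]) (auto simp: assms)
  qed (auto simp: assms sub add_ac)
  then interpret module complex_ring M
    by (intro moduleI cring_complex_ring) (auto simp: assms sub algebra_simps)
  show ?thesis by unfold_locales (auto simp: assms act)
qed

lemma (in bg_space) bg_premodule_space_rep: "bg_premodule (space_rep scale C act)"
  by (rule bg_premoduleI) (auto simp: vector_space_axioms subspace_C act_closed act_add act_scale)

section \<open>Formal linear combinations\<close>

lemma lookup_pm_scale [simp]: "Poly_Mapping.lookup (pm_scale c p) k = c * Poly_Mapping.lookup p k"
  by (simp add: pm_scale_def Poly_Mapping.map.rep_eq when_def)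

interpretation pm: vector_space "pm_scale :: complex \<Rightarrow> ('k \<Rightarrow>\<^sub>0 complex) \<Rightarrow> _"
  by unfold_locales (auto intro!: poly_mapping_eqI simp: lookup_add algebra_simps)

lemma pm_scale_single [simp]: "pm_scale c (Poly_Mapping.single k d) = Poly_Mapping.single k (c * d)"
  by (rule poly_mapping_eqI) (simp add: lookup_single when_def)

definition lin_ext :: "(complex \<Rightarrow> 'a::ab_group_add \<Rightarrow> 'a) \<Rightarrow> ('k \<Rightarrow> 'a) \<Rightarrow> ('k \<Rightarrow>\<^sub>0 complex) \<Rightarrow> 'a" where
  "lin_ext s f p = (\<Sum>k\<in>Poly_Mapping.keys p. s (Poly_Mapping.lookup p k) (f k))"

lemma pm_extend_lin_ext: "pm_extend f = lin_ext pm_scale f"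
  by (simp add: fun_eq_iff pm_extend_def lin_ext_def)


lemma lin_ext_superset:
  assumes "vector_space s" "finite S" "Poly_Mapping.keys p \<subseteq> S"
  shows "lin_ext s f p = (\<Sum>k\<in>S. s (Poly_Mapping.lookup p k) (f k))"
proof -
  interpret s: vector_space s by fact
  show ?thesis unfolding lin_ext_def
    using assms(2,3) by (intro sum.mono_neutral_left) (auto simp: in_keys_iff)
qed

lemma lin_ext_add: "vector_space s \<Longrightarrow> lin_ext s f (p + q) = lin_ext s f p + lin_ext s f q"
proof -
  assume s: "vector_space s"
  interpret s: vector_space s by fact
  let ?S = "Poly_Mapping.keys p \<union> Poly_Mapping.keys q"
  show ?thesis
    using Poly_Mapping.keys_add[of p q]
    by (simp add: lin_ext_superset[OF s, of ?S] lookup_add s.scale_left_distrib sum.distrib)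
qed

lemma lin_ext_scale: "vector_space s \<Longrightarrow> lin_ext s f (pm_scale c p) = s c (lin_ext s f p)"
proof -
  assume s: "vector_space s"
  interpret s: vector_space s by fact
  have "Poly_Mapping.keys (pm_scale c p) \<subseteq> Poly_Mapping.keys p" by (auto simp: in_keys_iff)
  then show ?thesis
    by (simp add: lin_ext_superset[OF s, of "Poly_Mapping.keys p"] s.scale_sum_right)
qed

lemma lin_ext_single: "vector_space s \<Longrightarrow> lin_ext s f (Poly_Mapping.single k c) = s c (f k)"
proof -
  assume s: "vector_space s"
  interpret s: vector_space s by fact
  show ?thesis by (simp add: lin_ext_superset[OF s, of "{k}"])
qed

lemma lin_ext_zero [simp]: "lin_ext s f 0 = 0"
  by (simp add: lin_ext_def)

lemma lin_ext_diff: "vector_space s \<Longrightarrow> lin_ext s f (p - q) = lin_ext s f p - lin_ext s f q"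
  using lin_ext_add[of s f "p - q" q] by simp

lemma lin_ext_in_subspace:
  assumes "vector_space s" "module.subspace s V" "\<And>k. k \<in> Poly_Mapping.keys p \<Longrightarrow> f k \<in> V"
  shows "lin_ext s f p \<in> V"
proof -
  interpret s: vector_space s by fact
  show ?thesis unfolding lin_ext_def using assms by (intro s.subspace_sum s.subspace_scale) auto
qed

lemma keys_subset_span:
  "{p :: 'k \<Rightarrow>\<^sub>0 complex. Poly_Mapping.keys p \<subseteq> K} = pm.span ((\<lambda>k. Poly_Mapping.single k 1) ` K)" (is "?L = ?R")
proof
  show "?L \<subseteq> ?R"
  proof
    fix p :: "'k \<Rightarrow>\<^sub>0 complex" assume p: "p \<in> ?L"
    have "p = lin_ext pm_scale (\<lambda>k. Poly_Mapping.single k 1) p"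
    proof (rule poly_mapping_eqI)
      fix k
      show "Poly_Mapping.lookup p k = Poly_Mapping.lookup (lin_ext pm_scale (\<lambda>k. Poly_Mapping.single k 1) p) k"
        by (cases "k \<in> Poly_Mapping.keys p")
          (auto simp: lin_ext_def lookup_sum lookup_single when_def sum.delta' in_keys_iff)
    qed
    also have "\<dots> \<in> ?R"
      using p by (intro lin_ext_in_subspace pm.vector_space_axioms pm.subspace_span) (auto intro!: pm.span_base)
    finally show "p \<in> ?R" .
  qed
  have "pm.subspace ?L"
  proof (rule pm.subspaceI)
    fix p q :: "'k \<Rightarrow>\<^sub>0 complex" assume "p \<in> ?L" "q \<in> ?L"
    then show "p + q \<in> ?L" using Poly_Mapping.keys_add[of p q] by auto
  next
    fix c and p :: "'k \<Rightarrow>\<^sub>0 complex" assume "p \<in> ?L"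
    then show "pm_scale c p \<in> ?L" by (auto simp: in_keys_iff)
  qed simp
  then show "?R \<subseteq> ?L" by (intro pm.span_minimal) auto
qed

lemma keys_induct [consumes 1, case_names zero add]:
  fixes p :: "'k \<Rightarrow>\<^sub>0 complex"
  assumes "Poly_Mapping.keys p \<subseteq> K" "P 0"
    and "\<And>c k q. k \<in> K \<Longrightarrow> Poly_Mapping.keys q \<subseteq> K \<Longrightarrow> P q \<Longrightarrow> P (pm_scale c (Poly_Mapping.single k 1) + q)"
  shows "P p"
proof -
  have "p \<in> pm.span ((\<lambda>k. Poly_Mapping.single k 1) ` K)" using assms(1) keys_subset_span by blast
  then have "Poly_Mapping.keys p \<subseteq> K \<and> P p"
  proof (induction rule: pm.span_induct_alt)
    case (step c x y)
    then obtain k where k: "k \<in> K" "x = Poly_Mapping.single k 1" by blast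
    have "Poly_Mapping.keys (pm_scale c x + y) \<subseteq> K"
      using step k Poly_Mapping.keys_add[of "pm_scale c x" y] by (auto split: if_splits)
    then show ?case using assms(3)[of k y c] step k by simp
  qed (use assms in auto)
  then show ?thesis ..
qed

lemma subspace_keys: "pm.subspace {p :: 'k \<Rightarrow>\<^sub>0 complex. Poly_Mapping.keys p \<subseteq> K}"
  unfolding keys_subset_span by simp

section \<open>Induced modules\<close>

lemma (in bg_space) word_append: "word (u @ w) x = word u (word w x)"
  by (induction u) auto

lemma (in bg_space) word_diff: "word w (x - y) = word w x - word w y"
  using word_add[of w "x - y" y] by simp

locale bg_base = vector_space sn
  for sn :: "complex \<Rightarrow> 'n::ab_group_add \<Rightarrow> 'n" +
  fixes N :: "'n bg_rep"
  assumes add_N: "add N = (+)" and smult_N: "smult N = sn" and subspace_N: "subspace (carrier N)"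
    and act_N_zero: "x \<in> carrier N \<Longrightarrow> mode g = 0 \<Longrightarrow> act N g x \<in> carrier N"
    and act_N_pos: "x \<in> carrier N \<Longrightarrow> mode g > 0 \<Longrightarrow> act N g x = 0"
begin

lemma act_N: "x \<in> carrier N \<Longrightarrow> mode g \<ge> 0 \<Longrightarrow> act N g x \<in> carrier N"
  using act_N_zero[of x g] act_N_pos[of x g] subspace_0[OF subspace_N] by (cases "mode g = 0") auto

abbreviation "free_carrier \<equiv> carrier (bg_free N)"
abbreviation "free_act \<equiv> act (bg_free N)"
abbreviation "rel_span \<equiv> pm.span (bg_ind_rels N)"

lemma free_carrier: "free_carrier = {p. Poly_Mapping.keys p \<subseteq> UNIV \<times> carrier N}"
  by (auto simp: bg_free_def)

lemma free_act_add: "free_act g (p + q) = free_act g p + free_act g q"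
  by (simp add: bg_free_def pm_extend_lin_ext lin_ext_add[OF pm.vector_space_axioms])

lemma free_act_scale: "free_act g (pm_scale c p) = pm_scale c (free_act g p)"
  by (simp add: bg_free_def pm_extend_lin_ext lin_ext_scale[OF pm.vector_space_axioms])

lemma free_act_single [simp]: "free_act g (Poly_Mapping.single (w, x) c) = Poly_Mapping.single (g # w, x) c"
  by (simp add: bg_free_def pm_extend_lin_ext lin_ext_single[OF pm.vector_space_axioms])

lemma free_act_diff: "free_act g (p - q) = free_act g p - free_act g q"
  using free_act_add[of g "p - q" q] by simp

lemma subspace_free: "pm.subspace free_carrier"
  unfolding free_carrier by (rule subspace_keys)

lemma free_act_closed:
  assumes "p \<in> free_carrier"
  shows "free_act g p \<in> free_carrier"
proof -
  have "Poly_Mapping.keys p \<subseteq> UNIV \<times> carrier N" using assms by (simp add: free_carrier)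
  then show ?thesis
  proof (induction rule: keys_induct)
    case zero
    then show ?case using free_act_scale[of g 0 0] pm.subspace_0[OF subspace_free] by simp
  next
    case (add c k q)
    obtain w x where k: "k = (w, x)" "x \<in> carrier N" using add(1) by (cases k) auto
    have "Poly_Mapping.single (g # w, x) c \<in> free_carrier" using k by (simp add: free_carrier)
    then show ?case using add(3) k by (simp add: free_act_add pm.subspace_add[OF subspace_free])
  qed
qed

lemma bg_premodule_free: "bg_premodule (bg_free N)"
proof (rule bg_premoduleI)
  show "vector_space (smult (bg_free N))" by (simp add: bg_free_def pm.vector_space_axioms)
  show "module.subspace (smult (bg_free N)) free_carrier"
    using subspace_free by (simp add: bg_free_def)
  show "free_act g (smult (bg_free N) c x) = smult (bg_free N) c (free_act g x)" for g c x
    using free_act_scale[of g c x] by (simp add: bg_free_def)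
qed (simp_all add: free_act_closed free_act_add, simp_all add: bg_free_def)

lemma rels_free: "bg_ind_rels N \<subseteq> free_carrier"
proof
  fix p assume "p \<in> bg_ind_rels N"
  moreover have s: "Poly_Mapping.single (w, x) c \<in> free_carrier" if "x \<in> carrier N" for w x c
    using that by (simp add: free_carrier)
  ultimately show "p \<in> free_carrier"
    using subspace_add[OF subspace_N] subspace_scale[OF subspace_N] act_N
    by (auto simp: bg_ind_rels_def add_N smult_N intro!: pm.subspace_diff[OF subspace_free])
qed

lemma rel_span_free: "rel_span \<subseteq> free_carrier"
  by (intro pm.span_minimal rels_free subspace_free)

text \<open>Each family of relations begins with an arbitrary word, so prefixing a letter stays
  within the family.\<close>

lemma rel_span_act:
  assumes "p \<in> rel_span"
  shows "free_act g p \<in> rel_span"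
proof -
  have rel: "free_act g p \<in> bg_ind_rels N" if "p \<in> bg_ind_rels N" for p
    using that[unfolded bg_ind_rels_def]
  proof (elim UnE)
    assume "p \<in> {Poly_Mapping.single (w, x \<oplus>\<^bsub>N\<^esub> y) 1 - Poly_Mapping.single (w, x) 1 - Poly_Mapping.single (w, y) 1
        | w x y. x \<in> carrier N \<and> y \<in> carrier N}"
    then obtain w x y where "p = Poly_Mapping.single (w, x \<oplus>\<^bsub>N\<^esub> y) 1 - Poly_Mapping.single (w, x) 1 - Poly_Mapping.single (w, y) 1"
      "x \<in> carrier N" "y \<in> carrier N" by blast
    then show ?thesis by (simp add: free_act_diff bg_ind_rels_def) blast
  next
    assume "p \<in> {Poly_Mapping.single (w, c \<odot>\<^bsub>N\<^esub> x) 1 - Poly_Mapping.single (w, x) c | w c x. x \<in> carrier N}"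
    then obtain w c x where "p = Poly_Mapping.single (w, c \<odot>\<^bsub>N\<^esub> x) 1 - Poly_Mapping.single (w, x) c" "x \<in> carrier N" by blast
    then show ?thesis by (simp add: free_act_diff bg_ind_rels_def) blast
  next
    assume "p \<in> {Poly_Mapping.single (u @ [g, h] @ v, x) 1 - Poly_Mapping.single (u @ [h, g] @ v, x) 1
          - Poly_Mapping.single (u @ v, x) (bg_comm g h) | u g h v x. x \<in> carrier N}"
    then obtain u g' h v x where "p = Poly_Mapping.single (u @ [g', h] @ v, x) 1 - Poly_Mapping.single (u @ [h, g'] @ v, x) 1
          - Poly_Mapping.single (u @ v, x) (bg_comm g' h)" "x \<in> carrier N" by blast
    then have "free_act g p = Poly_Mapping.single ((g # u) @ [g', h] @ v, x) 1 - Poly_Mapping.single ((g # u) @ [h, g'] @ v, x) 1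
          - Poly_Mapping.single ((g # u) @ v, x) (bg_comm g' h)" by (simp add: free_act_diff)
    then show ?thesis using \<open>x \<in> carrier N\<close> unfolding bg_ind_rels_def by blast
  next
    assume "p \<in> {Poly_Mapping.single (w @ [g], x) 1 - Poly_Mapping.single (w, act N g x) 1
        | w g x. mode g \<ge> 0 \<and> x \<in> carrier N}"
    then obtain w g' x where "p = Poly_Mapping.single (w @ [g'], x) 1 - Poly_Mapping.single (w, act N g' x) 1"
      "mode g' \<ge> 0" "x \<in> carrier N" by blast
    then have "free_act g p = Poly_Mapping.single ((g # w) @ [g'], x) 1 - Poly_Mapping.single (g # w, act N g' x) 1"
      by (simp add: free_act_diff)
    then show ?thesis using \<open>x \<in> carrier N\<close> \<open>mode g' \<ge> 0\<close> unfolding bg_ind_rels_def by blast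
  qed
  from assms show ?thesis
  proof (induction rule: pm.span_induct_alt)
    case base
    then show ?case using free_act_scale[of g 0 0] by (simp add: pm.span_zero)
  next
    case (step c p q)
    then show ?case using rel[of p]
      by (simp add: free_act_add free_act_scale pm.span_add pm.span_scale pm.span_base)
  qed
qed

text \<open>On a word this is the commutation relation with empty prefix, in the form that
  \<open>quotient_bg_space\<close> asks for.\<close>

lemma free_comm:
  assumes "p \<in> free_carrier"
  shows "free_act g (free_act h p) - free_act h (free_act g p) - pm_scale (bg_comm g h) p \<in> rel_span"
proof -
  have "Poly_Mapping.keys p \<subseteq> UNIV \<times> carrier N" using assms by (simp add: free_carrier)
  then show ?thesis
  proof (induction rule: keys_induct)
    case zero
    then show ?case using free_act_scale[of _ 0 0] by (simp add: pm.span_zero)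
  next
    case (add c k q)
    obtain w x where k: "k = (w, x)" "x \<in> carrier N" using add(1) by (cases k) auto
    have "Poly_Mapping.single ([] @ [g, h] @ w, x) 1 - Poly_Mapping.single ([] @ [h, g] @ w, x) 1
          - Poly_Mapping.single ([] @ w, x) (bg_comm g h) \<in> bg_ind_rels N"
      using k unfolding bg_ind_rels_def by blast
    then have "Poly_Mapping.single (g # h # w, x) 1 - Poly_Mapping.single (h # g # w, x) 1
          - Poly_Mapping.single (w, x) (bg_comm g h) \<in> rel_span" (is "?r \<in> _")
      by (simp add: pm.span_base)
    then have "pm_scale c ?r + (free_act g (free_act h q) - free_act h (free_act g q) - pm_scale (bg_comm g h) q) \<in> rel_span"
      using add(3) by (intro pm.span_add pm.span_scale)
    also have "pm_scale c ?r + (free_act g (free_act h q) - free_act h (free_act g q) - pm_scale (bg_comm g h) q)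
      = free_act g (free_act h (pm_scale c (Poly_Mapping.single k 1) + q)) -
         free_act h (free_act g (pm_scale c (Poly_Mapping.single k 1) + q)) -
         pm_scale (bg_comm g h) (pm_scale c (Poly_Mapping.single k 1) + q)"
      by (simp add: free_act_add pm.scale_right_distrib pm.scale_right_diff_distrib k(1) algebra_simps)
    finally show ?case .
  qed
qed

lemma bg_submodule_rel_span: "bg_submodule rel_span (bg_free N)"
proof (rule bg_premodule.bg_submoduleI[OF bg_premodule_free])
  show "free_act g p \<in> rel_span" if "p \<in> rel_span" for g p using that by (rule rel_span_act)
qed (use rel_span_free in \<open>auto simp: bg_free_def pm.span_zero pm.span_add pm.span_scale\<close>)

text \<open>A projection along the relations, fixed by choice so that carrier and action of the
  induced module become constants of the locale. Its existence comes from
  \<open>quotient_bg_space\<close>.\<close>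

definition ind_proj :: "(bg_gen list \<times> 'n \<Rightarrow>\<^sub>0 complex) \<Rightarrow> (bg_gen list \<times> 'n \<Rightarrow>\<^sub>0 complex)" where
  "ind_proj = (SOME q. (\<forall>p p'. q (p + p') = q p + q p') \<and> (\<forall>c p. q (pm_scale c p) = pm_scale c (q p)) \<and>
     (\<forall>p. p - q p \<in> rel_span) \<and> (\<forall>p. q p = 0 \<longleftrightarrow> p \<in> rel_span) \<and>
     bg_space pm_scale (q ` free_carrier) (\<lambda>g p. q (free_act g p)) \<and>
     (\<forall>g p. q (free_act g (q p)) = q (free_act g p)))"

definition "ind_carrier = ind_proj ` free_carrier"
definition "ind_act g p = ind_proj (free_act g p)"
definition "ind_top x = ind_proj (Poly_Mapping.single ([], x) 1)"

lemma ind_proj: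
  shows ind_proj_add: "ind_proj (p + p') = ind_proj p + ind_proj p'"
    and ind_proj_scale: "ind_proj (pm_scale c p) = pm_scale c (ind_proj p)"
    and ind_proj_diff_rel: "p - ind_proj p \<in> rel_span"
    and ind_proj_eq_0: "ind_proj p = 0 \<longleftrightarrow> p \<in> rel_span"
    and bg_space_ind: "bg_space pm_scale ind_carrier ind_act"
    and ind_proj_act: "ind_proj (free_act g (ind_proj p)) = ind_proj (free_act g p)"
proof -
  have "\<exists>q. (\<forall>p p'. q (p + p') = q p + q p') \<and> (\<forall>c p. q (pm_scale c p) = pm_scale c (q p)) \<and>
     (\<forall>p. p - q p \<in> rel_span) \<and> (\<forall>p. q p = 0 \<longleftrightarrow> p \<in> rel_span) \<and>
     bg_space pm_scale (q ` free_carrier) (\<lambda>g p. q (free_act g p)) \<and>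
     (\<forall>g p. q (free_act g (q p)) = q (free_act g p))"
  proof (rule quotient_bg_space[OF pm.vector_space_axioms free_act_add free_act_scale subspace_free free_act_closed
        pm.subspace_span rel_span_act rel_span_free free_comm])
    fix q assume q: "\<And>x y. q (x + y) = q x + q y" "\<And>c x. q (pm_scale c x) = pm_scale c (q x)"
      "\<And>x. x - q x \<in> rel_span" "\<And>x. q x = 0 \<longleftrightarrow> x \<in> rel_span"
      "bg_space pm_scale (q ` free_carrier) (\<lambda>g x. q (free_act g x))"
      "\<And>g x. q (free_act g (q x)) = q (free_act g x)"
    show ?thesis by (intro exI[of _ q] conjI allI) (rule q)+
  qed
  from someI_ex[OF this, folded ind_proj_def]
  show "ind_proj (p + p') = ind_proj p + ind_proj p'" "ind_proj (pm_scale c p) = pm_scale c (ind_proj p)"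
    "p - ind_proj p \<in> rel_span" "ind_proj p = 0 \<longleftrightarrow> p \<in> rel_span"
    "bg_space pm_scale ind_carrier ind_act" "ind_proj (free_act g (ind_proj p)) = ind_proj (free_act g p)"
    unfolding ind_carrier_def ind_act_def by blast+
qed

sublocale ind: bg_space pm_scale ind_carrier ind_act
  by (rule bg_space_ind)

lemma ind_proj_diff: "ind_proj (p - p') = ind_proj p - ind_proj p'"
  using ind_proj_add[of "p - p'" p'] by simp

lemma ind_proj_eqI: "p - p' \<in> rel_span \<Longrightarrow> ind_proj p = ind_proj p'"
  using ind_proj_eq_0[of "p - p'"] by (simp add: ind_proj_diff)

lemma ind_carrier_free: "ind_carrier \<subseteq> free_carrier"
proof
  fix p assume "p \<in> ind_carrier"
  then obtain p' where p': "p' \<in> free_carrier" "p = ind_proj p'" by (auto simp: ind_carrier_def)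
  have "p' - (p' - ind_proj p') \<in> free_carrier"
    by (rule pm.subspace_diff[OF subspace_free p'(1) subsetD[OF rel_span_free ind_proj_diff_rel]])
  then show "p \<in> free_carrier" using p' by simp
qed

lemma single_free: "x \<in> carrier N \<Longrightarrow> Poly_Mapping.single (w, x) c \<in> free_carrier"
  by (simp add: free_carrier)

lemma ind_top_closed: "x \<in> carrier N \<Longrightarrow> ind_top x \<in> ind_carrier"
  by (auto simp: ind_top_def ind_carrier_def single_free)

lemma ind_top_add:
  assumes "x \<in> carrier N" "y \<in> carrier N"
  shows "ind_top (x + y) = ind_top x + ind_top y"
proof -
  have "Poly_Mapping.single ([], x + y) 1 - Poly_Mapping.single ([], x) 1 - Poly_Mapping.single ([], y) 1 \<in> bg_ind_rels N"
    using assms unfolding bg_ind_rels_def add_N by blast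
  then have "ind_proj (Poly_Mapping.single ([], x + y) 1 - (Poly_Mapping.single ([], x) 1 + Poly_Mapping.single ([], y) 1)) = 0"
    unfolding ind_proj_eq_0 by (simp add: pm.span_base algebra_simps)
  then show ?thesis by (simp add: ind_top_def ind_proj_diff ind_proj_add)
qed

lemma ind_top_scale:
  assumes "x \<in> carrier N"
  shows "ind_top (sn c x) = pm_scale c (ind_top x)"
proof -
  have "Poly_Mapping.single ([], sn c x) 1 - Poly_Mapping.single ([], x) c \<in> bg_ind_rels N"
    using assms unfolding bg_ind_rels_def smult_N by blast
  then have "ind_proj (Poly_Mapping.single ([], sn c x) 1) = ind_proj (Poly_Mapping.single ([], x) c)"
    by (intro ind_proj_eqI pm.span_base)
  then show ?thesis by (simp add: ind_top_def flip: ind_proj_scale)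
qed

lemma ind_top_zero [simp]: "ind_top 0 = 0"
  using ind_top_scale[of 0 0] subspace_0[OF subspace_N] by simp

lemma ind_act_top:
  assumes "x \<in> carrier N" "mode g \<ge> 0"
  shows "ind_act g (ind_top x) = ind_top (act N g x)"
proof -
  have "Poly_Mapping.single ([] @ [g], x) 1 - Poly_Mapping.single ([], act N g x) 1 \<in> bg_ind_rels N"
    using assms unfolding bg_ind_rels_def by blast
  then have "ind_proj (Poly_Mapping.single ([g], x) 1) = ind_proj (Poly_Mapping.single ([], act N g x) 1)"
    by (intro ind_proj_eqI pm.span_base) simp
  then show ?thesis by (simp add: ind_act_def ind_top_def ind_proj_act)
qed

lemma ind_word_top: "ind_proj (Poly_Mapping.single (w, x) 1) = ind.word w (ind_top x)"
proof (induction w)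
  case (Cons g w)
  have "ind_proj (Poly_Mapping.single (g # w, x) 1) = ind_proj (free_act g (Poly_Mapping.single (w, x) 1))" by simp
  also have "\<dots> = ind_act g (ind_proj (Poly_Mapping.single (w, x) 1))" by (simp add: ind_act_def ind_proj_act)
  finally show ?case using Cons by simp
qed (simp add: ind_top_def)

lemma ind_generated:
  assumes "ind.submod Z" "ind_top ` carrier N \<subseteq> Z"
  shows "ind_carrier \<subseteq> Z"
proof
  fix p assume "p \<in> ind_carrier"
  then obtain p' where p': "p' \<in> free_carrier" "p = ind_proj p'" by (auto simp: ind_carrier_def)
  have "Poly_Mapping.keys p' \<subseteq> UNIV \<times> carrier N" using p' by (simp add: free_carrier)
  then have "ind_proj p' \<in> Z"
  proof (induction rule: keys_induct)
    case zero
    then show ?case using ind_proj_scale[of 0 0] pm.subspace_0[OF ind.submod_subspace[OF assms(1)]] by simp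
  next
    case (add c k q)
    obtain w x where k: "k = (w, x)" "x \<in> carrier N" using add(1) by (cases k) auto
    have "ind_proj (Poly_Mapping.single k 1) \<in> Z"
      unfolding k ind_word_top using assms k by (intro ind.submod_word) auto
    then show ?case unfolding ind_proj_add ind_proj_scale
      using add(3) by (intro pm.subspace_add pm.subspace_scale ind.submod_subspace[OF assms(1)])
  qed
  then show "p \<in> Z" using p' by simp
qed

lemma bg_free_minus: "p \<in> free_carrier \<Longrightarrow> p' \<in> free_carrier \<Longrightarrow> p \<ominus>\<^bsub>bg_free N\<^esub> p' = p - p'"
  using bg_premodule.minus_eq[OF bg_premodule_free, of p p'] by (simp add: bg_free_def)

lemma bg_ind_iso_space: "bg_iso (bg_ind N) (space_rep pm_scale ind_carrier ind_act)"
  unfolding bg_ind_def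
proof (rule bg_premodule.bg_quot_iso[OF bg_premodule_free bg_submodule_rel_span])
  show "ind_proj \<in> bg_hom (bg_free N) (space_rep pm_scale ind_carrier ind_act)"
    by (rule bg_homI) (auto simp: ind_carrier_def ind_act_def ind_proj_act, auto simp: bg_free_def ind_proj_add ind_proj_scale)
  show "ind_proj ` free_carrier = carrier (space_rep pm_scale ind_carrier ind_act)"
    by (simp add: ind_carrier_def)
  show "ind_proj p = ind_proj p' \<longleftrightarrow> p \<ominus>\<^bsub>bg_free N\<^esub> p' \<in> rel_span"
    if "p \<in> free_carrier" "p' \<in> free_carrier" for p p'
    using ind_proj_eq_0[of "p - p'"] by (simp add: bg_free_minus[OF that] ind_proj_diff)
qed

text \<open>Makes the word-length arguments available for the induced module itself.\<close>

lemma ind_induced_from: "ind.induced_from (ind_top ` carrier N)"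
proof -
  have sub: "pm.subspace (ind_top ` carrier N)"
  proof (rule pm.subspaceI)
    show "0 \<in> ind_top ` carrier N" using ind_top_zero subspace_0[OF subspace_N] by (metis imageI)
  next
    fix a b assume "a \<in> ind_top ` carrier N" "b \<in> ind_top ` carrier N"
    then show "a + b \<in> ind_top ` carrier N"
      using subspace_add[OF subspace_N] by (auto simp flip: ind_top_add)
  next
    fix c a assume "a \<in> ind_top ` carrier N"
    then show "pm_scale c a \<in> ind_top ` carrier N"
      using subspace_scale[OF subspace_N] by (auto simp flip: ind_top_scale)
  qed
  have "ind_carrier \<subseteq> ind.gen (ind_top ` carrier N)"
    using ind_top_closed by (intro ind_generated ind.submod_gen) (auto intro: ind.gen_base)
  then show ?thesis
    unfolding ind.induced_from_def
    using sub ind_top_closed act_N_zero act_N_pos by (auto simp: ind_act_top)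
qed

text \<open>The map sends a word and a vector x of N to the word applied to j x. Its kernel yields a
  submodule of the induced module; if nonzero, that submodule would contain a nonzero vector of the
  inducing space, where j is injective.\<close>

theorem bg_ind_iso:
  fixes s :: "complex \<Rightarrow> 'c::ab_group_add \<Rightarrow> 'c"
  assumes "bg_space s C a"
    and j: "\<And>x. x \<in> carrier N \<Longrightarrow> j x \<in> C"
      "\<And>x y. x \<in> carrier N \<Longrightarrow> y \<in> carrier N \<Longrightarrow> j (x + y) = j x + j y"
      "\<And>c x. x \<in> carrier N \<Longrightarrow> j (sn c x) = s c (j x)"
      "\<And>g x. x \<in> carrier N \<Longrightarrow> mode g \<ge> 0 \<Longrightarrow> a g (j x) = j (act N g x)"
      "\<And>x. x \<in> carrier N \<Longrightarrow> j x = 0 \<Longrightarrow> x = 0"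
    and gen: "\<And>G. bg_space.submod s C a G \<Longrightarrow> j ` carrier N \<subseteq> G \<Longrightarrow> C \<subseteq> G"
  shows "bg_iso (bg_ind N) (space_rep s C a)"
proof -
  interpret C: bg_space s C a by fact
  note vs = C.vector_space_axioms
  define \<Psi> where "\<Psi> = lin_ext s (\<lambda>(w, x). C.word w (j x))"
  have \<Psi>_add: "\<Psi> (p + q) = \<Psi> p + \<Psi> q" and \<Psi>_scale: "\<Psi> (pm_scale c p) = s c (\<Psi> p)"
    and \<Psi>_diff: "\<Psi> (p - q) = \<Psi> p - \<Psi> q" for p q c
    by (simp_all add: \<Psi>_def lin_ext_add[OF vs] lin_ext_scale[OF vs] lin_ext_diff[OF vs])
  have \<Psi>_single: "\<Psi> (Poly_Mapping.single (w, x) c) = s c (C.word w (j x))" for w x c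
    by (simp add: \<Psi>_def lin_ext_single[OF vs])
  have \<Psi>_C: "\<Psi> p \<in> C" if "p \<in> free_carrier" for p
    unfolding \<Psi>_def using that
    by (intro lin_ext_in_subspace[OF vs C.subspace_C]) (auto simp: free_carrier intro!: C.word_closed j)
  have \<Psi>_0: "\<Psi> 0 = 0" using \<Psi>_scale[of 0 0] by simp
  have \<Psi>_act: "\<Psi> (free_act g p) = a g (\<Psi> p)" if "p \<in> free_carrier" for g p
  proof -
    have "Poly_Mapping.keys p \<subseteq> UNIV \<times> carrier N" using that by (simp add: free_carrier)
    then show ?thesis
    proof (induction rule: keys_induct)
      case zero
      then show ?case using free_act_scale[of g 0 0] by (simp add: \<Psi>_0)
    next
      case (add c k q)
      obtain w x where k: "k = (w, x)" by (cases k) auto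
      then show ?case using add(3)
        by (simp add: free_act_add \<Psi>_add \<Psi>_single C.act_add C.act_scale)
    qed
  qed
  have \<Psi>_rel: "\<Psi> p = 0" if "p \<in> bg_ind_rels N" for p
    using that unfolding bg_ind_rels_def
  proof (elim UnE)
    assume "p \<in> {Poly_Mapping.single (w, x \<oplus>\<^bsub>N\<^esub> y) 1 - Poly_Mapping.single (w, x) 1 - Poly_Mapping.single (w, y) 1
        | w x y. x \<in> carrier N \<and> y \<in> carrier N}"
    then show ?thesis by (auto simp: \<Psi>_diff \<Psi>_single add_N j C.word_add)
  next
    assume "p \<in> {Poly_Mapping.single (w, c \<odot>\<^bsub>N\<^esub> x) 1 - Poly_Mapping.single (w, x) c | w c x. x \<in> carrier N}"
    then show ?thesis by (auto simp: \<Psi>_diff \<Psi>_single smult_N j C.word_scale)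
  next
    assume "p \<in> {Poly_Mapping.single (u @ [g, h] @ v, x) 1 - Poly_Mapping.single (u @ [h, g] @ v, x) 1
          - Poly_Mapping.single (u @ v, x) (bg_comm g h) | u g h v x. x \<in> carrier N}"
    then obtain u g h v x where p: "p = Poly_Mapping.single (u @ [g, h] @ v, x) 1 - Poly_Mapping.single (u @ [h, g] @ v, x) 1
          - Poly_Mapping.single (u @ v, x) (bg_comm g h)" "x \<in> carrier N" by blast
    have "C.word v (j x) \<in> C" using p by (intro C.word_closed j)
    then have "C.word u (a g (a h (C.word v (j x))) - a h (a g (C.word v (j x))) - s (bg_comm g h) (C.word v (j x))) = 0"
      by (simp add: C.act_comm)
    then show ?thesis
      by (simp add: p(1) \<Psi>_diff \<Psi>_single C.word_append C.word_diff C.word_scale)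
  next
    assume "p \<in> {Poly_Mapping.single (w @ [g], x) 1 - Poly_Mapping.single (w, act N g x) 1
        | w g x. mode g \<ge> 0 \<and> x \<in> carrier N}"
    then show ?thesis by (auto simp: \<Psi>_diff \<Psi>_single C.word_append j)
  qed
  have \<Psi>_span: "\<Psi> p = 0" if "p \<in> rel_span" for p
    using that by (induction rule: pm.span_induct_alt) (auto simp: \<Psi>_0 \<Psi>_add \<Psi>_scale \<Psi>_rel)
  have \<Psi>_proj: "\<Psi> (ind_proj p) = \<Psi> p" for p
    using \<Psi>_span[OF ind_proj_diff_rel, of p] by (simp add: \<Psi>_diff)
  have kernel: "p \<in> rel_span" if p: "p \<in> free_carrier" "\<Psi> p = 0" for p
  proof -
    define K where "K = {t \<in> ind_carrier. \<Psi> t = 0}"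
    have "ind.submod K"
      unfolding ind.submod_def
    proof (intro conjI allI ballI)
      show "pm.subspace K"
        using ind.subspace_C unfolding pm.subspace_def by (auto simp: K_def \<Psi>_0 \<Psi>_add \<Psi>_scale)
      fix g t assume "t \<in> K"
      then have "\<Psi> (ind_act g t) = a g (\<Psi> t)" "\<Psi> t = 0" "t \<in> ind_carrier"
        using ind_carrier_free by (auto simp: K_def ind_act_def \<Psi>_proj \<Psi>_act)
      then show "ind_act g t \<in> K" by (simp add: K_def ind.act_closed)
    qed (auto simp: K_def)
    have "K = {0}"
    proof (rule ccontr)
      assume "K \<noteq> {0}"
      then obtain t where t: "t \<in> ind_top ` carrier N" "t \<in> K" "t \<noteq> 0"
        using ind.induced_meets[OF ind_induced_from \<open>ind.submod K\<close>] by blast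
      then obtain x where x: "x \<in> carrier N" "t = ind_top x" by auto
      then have "\<Psi> (Poly_Mapping.single ([], x) 1) = 0" using t(2) by (simp add: K_def ind_top_def \<Psi>_proj)
      then have "x = 0" using j(5)[OF x(1)] by (simp add: \<Psi>_single)
      then show False using t(3) x(2) by simp
    qed
    moreover have "ind_proj p \<in> K" using p by (auto simp: K_def ind_carrier_def \<Psi>_proj)
    ultimately show ?thesis using ind_proj_eq_0 by auto
  qed
  show ?thesis
    unfolding bg_ind_def
  proof (rule bg_premodule.bg_quot_iso[OF bg_premodule_free bg_submodule_rel_span])
    show "\<Psi> \<in> bg_hom (bg_free N) (space_rep s C a)"
      by (rule bg_homI) (simp_all add: \<Psi>_C \<Psi>_act, simp_all add: bg_free_def \<Psi>_add \<Psi>_scale)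
    show "\<Psi> ` free_carrier = carrier (space_rep s C a)"
    proof
      show "\<Psi> ` free_carrier \<subseteq> carrier (space_rep s C a)" using \<Psi>_C by auto
      have "C.submod (\<Psi> ` free_carrier)"
        unfolding C.submod_def
      proof (intro conjI allI ballI)
        show "C.subspace (\<Psi> ` free_carrier)"
        proof (rule C.subspaceI)
          show "0 \<in> \<Psi> ` free_carrier" using \<Psi>_0 pm.subspace_0[OF subspace_free] by (metis imageI)
        next
          fix x y assume "x \<in> \<Psi> ` free_carrier" "y \<in> \<Psi> ` free_carrier"
          then show "x + y \<in> \<Psi> ` free_carrier"
            using pm.subspace_add[OF subspace_free] by (auto simp flip: \<Psi>_add)
        next
          fix c x assume "x \<in> \<Psi> ` free_carrier"
          then show "s c x \<in> \<Psi> ` free_carrier"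
            using pm.subspace_scale[OF subspace_free] by (auto simp flip: \<Psi>_scale)
        qed
        fix g x assume "x \<in> \<Psi> ` free_carrier"
        then show "a g x \<in> \<Psi> ` free_carrier" using free_act_closed by (auto simp flip: \<Psi>_act)
      qed (use \<Psi>_C in auto)
      moreover have "j ` carrier N \<subseteq> \<Psi> ` free_carrier"
      proof
        fix y assume "y \<in> j ` carrier N"
        then obtain x where x: "x \<in> carrier N" "y = j x" by auto
        have "y = \<Psi> (Poly_Mapping.single ([], x) 1)" by (simp add: \<Psi>_single x)
        then show "y \<in> \<Psi> ` free_carrier" using single_free[OF x(1)] by blast
      qed
      ultimately show "carrier (space_rep s C a) \<subseteq> \<Psi> ` free_carrier" using gen by simp
    qed
    show "\<Psi> p = \<Psi> p' \<longleftrightarrow> p \<ominus>\<^bsub>bg_free N\<^esub> p' \<in> rel_span"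
      if "p \<in> free_carrier" "p' \<in> free_carrier" for p p'
    proof -
      have "\<Psi> p = \<Psi> p' \<longleftrightarrow> \<Psi> (p - p') = 0" by (simp add: \<Psi>_diff)
      also have "\<dots> \<longleftrightarrow> p - p' \<in> rel_span"
        using kernel[of "p - p'"] \<Psi>_span[of "p - p'"] pm.subspace_diff[OF subspace_free that] by blast
      finally show ?thesis by (simp add: bg_free_minus[OF that])
    qed
  qed
qed

end

section \<open>The modules V and W in standard form\<close>

lemma (in bg_base) ind_top_sum:
  "(\<And>a. a \<in> S \<Longrightarrow> f a \<in> carrier N) \<Longrightarrow> ind_top (sum f S) = (\<Sum>a\<in>S. ind_top (f a))"
proof (induction S rule: infinite_finite_induct)
  case (insert a S)
  then have "sum f S \<in> carrier N" by (intro subspace_sum[OF subspace_N]) auto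
  then show ?case using insert by (simp add: ind_top_add)
qed auto

lemma bg_base_V: "bg_base Polynomial.smult V_top"
proof -
  interpret vector_space "Polynomial.smult :: complex \<Rightarrow> complex poly \<Rightarrow> complex poly"
    by unfold_locales (auto simp: smult_add_right smult_add_left)
  show ?thesis
    by unfold_locales (auto simp: V_top_def split: bg_gen.splits)
qed

lemma V_top_simps: "carrier V_top = UNIV" "act V_top (Gamma 0) p = pCons 0 p" "act V_top (Beta 0) p = - pderiv p"
  by (simp_all add: V_top_def)

interpretation V: bg_base Polynomial.smult V_top
  by (rule bg_base_V)

text \<open>Padding by zero for n < 0 adapts the powers of gamma_0 to the indexing by all integers
  in \<open>standard\<close>.\<close>

lemma V_standard: "V.ind.standard 0 (\<lambda>n. if n \<ge> 0 then V.ind_top (monom 1 (nat n)) else 0)"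
  (is "V.ind.standard 0 ?v")
proof -
  have N: "p \<in> carrier V_top" for p by (simp add: V_top_def)
  have zero: "0 \<in> V.ind_carrier" by (rule pm.subspace_0[OF V.ind.subspace_C])
  have scale: "V.ind_top (monom c i) = pm_scale c (V.ind_top (monom 1 i))" for c i
    using V.ind_top_scale[OF N, of c "monom 1 i"] by (simp add: smult_monom)
  show ?thesis
    unfolding V.ind.standard_def
  proof (intro conjI allI impI)
    fix n :: int
    show "?v n \<in> V.ind_carrier" using V.ind_top_closed[OF N] zero by simp
    show "V.ind_act (Gamma 0) (?v n) = ?v (n + 1)" if "0 \<notin> \<int> \<or> n \<ge> 0"
    proof -
      have "pCons 0 (monom 1 (nat n)) = (monom 1 (nat (n + 1)) :: complex poly)"
        using that by (simp add: nat_add_distrib monom_Suc)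
      then show ?thesis using that by (simp add: V.ind_act_top[OF N] V_top_simps)
    qed
    show "V.ind_act (Beta 0) (?v n) = pm_scale (0 - of_int n) (?v (n - 1))"
    proof (cases "n \<ge> 1")
      case True
      then have "V.ind_act (Beta 0) (?v n) = V.ind_top (- monom (of_nat (nat n)) (nat n - 1))"
        by (simp add: V.ind_act_top[OF N] V_top_simps pderiv_monom)
      also have "\<dots> = V.ind_top (monom (- of_nat (nat n)) (nat (n - 1)))"
        using True by (simp add: minus_monom nat_diff_distrib)
      also have "\<dots> = pm_scale (- of_nat (nat n)) (?v (n - 1))" using True by (subst scale) simp
      finally show ?thesis using True by (simp add: of_nat_nat)
    next
      case False
      then show ?thesis
        by (cases "n = 0") (auto simp: V.ind_act_top[OF N] V_top_simps pderiv_monom)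
    qed
    show "V.ind_act g (?v n) = 0" if "mode g > 0" for g
      using that V.act_N_pos[OF N that] by (simp add: V.ind_act_top[OF N])
  next
    have "range ?v \<subseteq> V.ind_carrier" using V.ind_top_closed[OF N] zero by auto
    then have sub: "V.ind.submod (V.ind.gen (range ?v))" by (rule V.ind.submod_gen)
    show "V.ind_carrier \<subseteq> V.ind.gen (range ?v)"
    proof (rule V.ind_generated[OF sub], safe)
      fix p :: "complex poly"
      have *: "V.ind_top (monom 1 i) \<in> V.ind.gen (range ?v)" for i
        by (rule V.ind.gen_base) (auto intro!: image_eqI[of _ _ "int i"])
      have "V.ind_top (\<Sum>i\<le>degree p. monom (coeff p i) i) = (\<Sum>i\<le>degree p. V.ind_top (monom (coeff p i) i))"
        by (rule V.ind_top_sum) (rule N)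
      also have "\<dots> \<in> V.ind.gen (range ?v)"
        unfolding scale[of "coeff p _"]
        by (intro pm.subspace_sum pm.subspace_scale V.ind.submod_subspace[OF sub] *)
      finally show "V.ind_top p \<in> V.ind.gen (range ?v)" by (simp add: poly_as_sum_of_monoms)
    qed
  qed auto
qed

lemma W_top_simps:
  "carrier (W_top \<mu> k) = {p. Poly_Mapping.keys p \<subseteq> UNIV \<times> {..<k}}"
  "act (W_top \<mu> k) (Gamma 0) p = lin_ext pm_scale (\<lambda>(n, j). Poly_Mapping.single (n + 1, j) 1) p"
  "act (W_top \<mu> k) (Beta 0) p = - lin_ext pm_scale
     (\<lambda>(n, j). Poly_Mapping.single (n - 1, j) (of_int n - \<mu>) + Poly_Mapping.single (n - 1, j - 1) (of_nat j)) p"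
  by (auto simp: W_top_def pm_extend_lin_ext)

lemma bg_base_W: "bg_base pm_scale (W_top \<mu> k)"
proof unfold_locales
  show "pm.subspace (carrier (W_top \<mu> k))" unfolding W_top_simps by (rule subspace_keys)
  then have neg: "- p \<in> carrier (W_top \<mu> k)" if "p \<in> carrier (W_top \<mu> k)" for p
    using that by (rule pm.subspace_neg)
  fix p g assume p: "p \<in> carrier (W_top \<mu> k)"
  have s: "Poly_Mapping.single (n, j) c \<in> carrier (W_top \<mu> k)" if "j < k" for n j c
    using that by (auto simp: W_top_simps)
  {
    assume "mode g = 0"
    then have "g = Beta 0 \<or> g = Gamma 0" by (simp add: mode_zero_cases)
    moreover have "act (W_top \<mu> k) (Gamma 0) p \<in> carrier (W_top \<mu> k)"
      unfolding W_top_simps(2) using p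
      by (intro lin_ext_in_subspace pm.vector_space_axioms \<open>pm.subspace (carrier (W_top \<mu> k))\<close>)
        (auto simp: W_top_simps(1))
    moreover have "act (W_top \<mu> k) (Beta 0) p \<in> carrier (W_top \<mu> k)"
      unfolding W_top_simps(3)
    proof (intro neg lin_ext_in_subspace pm.vector_space_axioms \<open>pm.subspace (carrier (W_top \<mu> k))\<close>)
      fix i assume "i \<in> Poly_Mapping.keys p"
      then obtain n j where "i = (n, j)" "j < k" using p by (cases i) (auto simp: W_top_simps(1))
      then show "(case i of (n, j) \<Rightarrow> Poly_Mapping.single (n - 1, j) (of_int n - \<mu>)
          + Poly_Mapping.single (n - 1, j - 1) (of_nat j)) \<in> carrier (W_top \<mu> k)"
        by (auto intro!: pm.subspace_add[OF \<open>pm.subspace (carrier (W_top \<mu> k))\<close>] s)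
    qed
    ultimately show "act (W_top \<mu> k) g p \<in> carrier (W_top \<mu> k)" by auto
  next
    assume "mode g > 0"
    then show "act (W_top \<mu> k) g p = 0" by (auto simp: W_top_def split: bg_gen.splits)
  }
qed (auto simp: W_top_def)

interpretation W: bg_base pm_scale "W_top \<mu> k" for \<mu> k
  by (rule bg_base_W)

lemma W_standard:
  assumes "\<mu> \<notin> \<int>"
  shows "W.ind.standard \<mu> 1 \<mu> (\<lambda>n. W.ind_top \<mu> 1 (Poly_Mapping.single (n, 0) 1))" (is "W.ind.standard \<mu> 1 \<mu> ?v")
proof -
  have N: "Poly_Mapping.single (n, 0) c \<in> carrier (W_top \<mu> 1)" for n c by (simp add: W_top_simps)
  show ?thesis
    unfolding W.ind.standard_def
  proof (intro conjI allI impI)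
    fix n :: int
    show "?v n \<in> W.ind_carrier \<mu> 1" by (rule W.ind_top_closed[OF N])
    show "W.ind_act \<mu> 1 (Gamma 0) (?v n) = ?v (n + 1)"
      by (simp add: W.ind_act_top[OF N] W_top_simps lin_ext_single[OF pm.vector_space_axioms] del: One_nat_def)
    have "act (W_top \<mu> 1) (Beta 0) (Poly_Mapping.single (n, 0) 1) = pm_scale (\<mu> - of_int n) (Poly_Mapping.single (n - 1, 0) 1)"
      by (simp add: W_top_simps lin_ext_single[OF pm.vector_space_axioms] flip: single_uminus)
    then show "W.ind_act \<mu> 1 (Beta 0) (?v n) = pm_scale (\<mu> - of_int n) (?v (n - 1))"
      by (simp add: W.ind_act_top[OF N] del: One_nat_def pm_scale_single flip: W.ind_top_scale[OF N])
    show "W.ind_act \<mu> 1 g (?v n) = 0" if "mode g > 0" for g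
      using that W.act_N_pos[OF N that] by (simp add: W.ind_act_top[OF N] del: One_nat_def)
  next
    show "\<mu> \<notin> \<int> \<or> \<mu> = 0 \<and> (\<forall>n<0. ?v n = 0)" using assms by blast
    have "range ?v \<subseteq> W.ind_carrier \<mu> 1" using W.ind_top_closed[OF N] by auto
    then have sub: "W.ind.submod \<mu> 1 (W.ind.gen \<mu> 1 (range ?v))" by (rule W.ind.submod_gen)
    show "W.ind_carrier \<mu> 1 \<subseteq> W.ind.gen \<mu> 1 (range ?v)"
    proof (rule W.ind_generated[OF sub], safe)
      fix p assume "p \<in> carrier (W_top \<mu> 1)"
      then have "Poly_Mapping.keys p \<subseteq> UNIV \<times> {..<1}" by (simp add: W_top_simps)
      then show "W.ind_top \<mu> 1 p \<in> W.ind.gen \<mu> 1 (range ?v)"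
      proof (induction rule: keys_induct)
        case zero
        then show ?case using pm.subspace_0[OF W.ind.submod_subspace[OF sub]] by simp
      next
        case (add c i q)
        obtain n where i: "i = (n, 0)" using add(1) by (cases i) auto
        have q: "q \<in> carrier (W_top \<mu> 1)" using add(2) by (simp add: W_top_simps)
        have eq: "W.ind_top \<mu> 1 (pm_scale c (Poly_Mapping.single i 1) + q) = pm_scale c (?v n) + W.ind_top \<mu> 1 q"
          using N[of n 1] pm.subspace_scale[OF W.subspace_N N[of n 1], of c] q
          by (simp add: i W.ind_top_add W.ind_top_scale del: pm_scale_single One_nat_def)
        have "?v n \<in> W.ind.gen \<mu> 1 (range ?v)" by (rule W.ind.gen_base) simp
        then show ?case unfolding eq using add(3)
          by (intro pm.subspace_add pm.subspace_scale W.ind.submod_subspace[OF sub])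
      qed
    qed
  qed
qed

text \<open>The basis vector with index (n, j) goes to u n j. Independence of the u n j gives the
  injectivity on the inducing space that \<open>bg_ind_iso\<close> asks for.\<close>

lemma bg_W_iso:
  fixes s :: "complex \<Rightarrow> 'c::ab_group_add \<Rightarrow> 'c"
  assumes "bg_space s C a" and jordan: "bg_space.jordan_basis s C a \<mu> k u"
  shows "bg_iso (bg_W \<mu> k) (space_rep s C a)"
  unfolding bg_W_def
proof (rule W.bg_ind_iso[OF assms(1)])
  interpret C: bg_space s C a by fact
  note vs = C.vector_space_axioms
  have u: "u n j \<in> C" "mode g > 0 \<Longrightarrow> a g (u n j) = 0" "a (Gamma 0) (u n j) = u (n + 1) j"
    "j < k \<Longrightarrow> a (Beta 0) (u n j) = - (s (of_int n - \<mu>) (u (n - 1) j) + s (of_nat j) (u (n - 1) (j - 1)))"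
    for n j g using jordan by (simp_all add: C.jordan_basis_def)
  let ?j = "lin_ext s (\<lambda>(n, j). u n j)"
  show "?j x \<in> C" for x using u(1) by (intro lin_ext_in_subspace vs C.subspace_C) (auto simp: case_prod_unfold)
  show "?j (x + y) = ?j x + ?j y" for x y by (rule lin_ext_add[OF vs])
  show "?j (pm_scale c x) = s c (?j x)" for c x by (rule lin_ext_scale[OF vs])
  have neg: "?j (- x) = - ?j x" for x using lin_ext_diff[OF vs, of _ 0 x] by simp
  have lin: "lin_ext pm_scale f (pm_scale c (Poly_Mapping.single i 1) + q) = pm_scale c (f i) + lin_ext pm_scale f q"
    for f :: "int \<times> nat \<Rightarrow> (int \<times> nat \<Rightarrow>\<^sub>0 complex)" and c i q
    by (simp add: lin_ext_add[OF pm.vector_space_axioms] lin_ext_scale[OF pm.vector_space_axioms]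
        lin_ext_single[OF pm.vector_space_axioms] del: pm_scale_single)
  have linj: "?j (pm_scale c (Poly_Mapping.single (n, j) 1) + q) = s c (u n j) + ?j q" for c n j q
    by (simp add: lin_ext_add[OF vs] lin_ext_single[OF vs])
  show "a g (?j x) = ?j (act (W_top \<mu> k) g x)" if x: "x \<in> carrier (W_top \<mu> k)" and g: "mode g \<ge> 0" for g x
  proof -
    have keys: "Poly_Mapping.keys x \<subseteq> UNIV \<times> {..<k}" using x by (simp add: W_top_simps)
    consider "mode g > 0" | "g = Gamma 0" | "g = Beta 0" using g mode_zero_cases[of g] by force
    then show ?thesis
    proof cases
      case 1
      have "a g (?j x) = 0" unfolding lin_ext_def using u(2)[OF 1]
        by (simp add: C.act_sum C.act_scale case_prod_unfold)
      then show ?thesis using W.act_N_pos[OF x 1] by simp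
    next
      case 2
      show ?thesis unfolding 2 W_top_simps using keys
      proof (induction rule: keys_induct)
        case (add c i q)
        obtain n j where i: "i = (n, j)" by (cases i) auto
        show ?case using add(3) unfolding i lin linj C.act_add C.act_scale
          by (simp add: lin_ext_add[OF vs] lin_ext_single[OF vs] u(3))
      qed simp
    next
      case 3
      show ?thesis unfolding 3 W_top_simps neg using keys
      proof (induction rule: keys_induct)
        case (add c i q)
        obtain n j where i: "i = (n, j)" "j < k" using add(1) by (cases i) auto
        show ?case using add(3) unfolding i(1) lin linj C.act_add C.act_scale
          by (simp add: lin_ext_add[OF vs] lin_ext_scale[OF vs] lin_ext_single[OF vs] u(4)[OF i(2)]
              C.scale_right_distrib algebra_simps)
      qed simp
    qed
  qed
  show "x = 0" if x: "x \<in> carrier (W_top \<mu> k)" "?j x = 0" for x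
  proof -
    have "\<forall>i\<in>Poly_Mapping.keys x. Poly_Mapping.lookup x i = 0"
      by (rule C.jordan_basisD(1)[OF jordan finite_keys])
        (use x in \<open>simp_all add: W_top_simps lin_ext_def case_prod_unfold\<close>)
    then have "Poly_Mapping.lookup x i = 0" for i by (cases "i \<in> Poly_Mapping.keys x") (blast, simp add: in_keys_iff)
    then show ?thesis by (intro poly_mapping_eqI) simp
  qed
  show "C \<subseteq> G" if G: "C.submod G" "?j ` carrier (W_top \<mu> k) \<subseteq> G" for G
  proof -
    have "u n j \<in> G" if "j < k" for n j
    proof -
      have "?j (Poly_Mapping.single (n, j) 1) \<in> G" using G(2) that by (auto simp: W_top_simps)
      then show ?thesis by (simp add: lin_ext_single[OF vs])
    qed
    then show ?thesis using C.jordan_basisD(2)[OF jordan G(1)] by blast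
  qed
qed

section \<open>Passing from module records to subspaces\<close>

text \<open>The vectors v' are lifts of the generators v along \<Psi>; the relations of a step hold
  for them modulo Y because Y is the kernel.\<close>

lemma (in bg_space) simple_step_from_hom:
  fixes s :: "complex \<Rightarrow> 'c::ab_group_add \<Rightarrow> 'c"
  assumes X: "submod X" and Y: "submod Y" "Y \<subseteq> X" and "bg_space s T A" and std: "bg_space.standard s T A \<mu> v"
    and \<Psi>: "\<And>x y. x \<in> X \<Longrightarrow> y \<in> X \<Longrightarrow> \<Psi> (x + y) = \<Psi> x + \<Psi> y"
      "\<And>c x. x \<in> X \<Longrightarrow> \<Psi> (c *s x) = s c (\<Psi> x)"
      "\<And>g x. x \<in> X \<Longrightarrow> \<Psi> (act g x) = A (bg_sigma (- m) g) (\<Psi> x)"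
      "\<Psi> ` X = T" "\<And>x. x \<in> X \<Longrightarrow> \<Psi> x = 0 \<longleftrightarrow> x \<in> Y"
  obtains v' where "simple_step m \<mu> v' Y X"
proof -
  interpret T: bg_space s T A by fact
  have "v n \<in> T" for n using std by (simp add: T.standard_def)
  then have "\<exists>x\<in>X. \<Psi> x = v n" for n unfolding \<Psi>(4)[symmetric] by (metis imageE)
  then obtain v' where v': "\<And>n. v' n \<in> X" "\<And>n. \<Psi> (v' n) = v n" by metis
  note Xs = submod_subspace[OF X]
  have \<Psi>d: "\<Psi> (x - y) = \<Psi> x - \<Psi> y" if "x \<in> X" "y \<in> X" for x y
    using \<Psi>(1)[of "x - y" y] that subspace_diff[OF Xs] by simp
  have act: "\<Psi> (act (bg_sigma m g) x) = A g (\<Psi> x)" if "x \<in> X" for g x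
    using \<Psi>(3)[OF that] by (simp add: bg_sigma_inverse)
  have mem: "x - y \<in> Y" if "x \<in> X" "y \<in> X" "\<Psi> x = \<Psi> y" for x y
    using \<Psi>d[OF that(1,2)] \<Psi>(5)[of "x - y"] that subspace_diff[OF Xs] by simp
  have "simple_step m \<mu> v' Y X"
    unfolding simple_step_def
  proof (intro conjI allI impI)
    fix n
    have std': "\<mu> \<notin> \<int> \<or> n \<ge> 0 \<Longrightarrow> A (Gamma 0) (v n) = v (n + 1)"
      "A (Beta 0) (v n) = s (\<mu> - of_int n) (v (n - 1))" "mode g > 0 \<Longrightarrow> A g (v n) = 0" for g
      using std by (simp_all add: T.standard_def)
    show "act (bg_sigma m (Gamma 0)) (v' n) - v' (n + 1) \<in> Y" if "\<mu> \<notin> \<int> \<or> n \<ge> 0"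
      by (intro mem submod_act[OF X] v') (simp only: act[OF v'(1)] v'(2) std'(1)[OF that])
    show "act (bg_sigma m (Beta 0)) (v' n) - (\<mu> - of_int n) *s v' (n - 1) \<in> Y"
      by (intro mem submod_act[OF X] v' subspace_scale[OF Xs]) (simp only: act[OF v'(1)] v'(2) std'(2) \<Psi>(2)[OF v'(1)])
    show "act (bg_sigma m g) (v' n) \<in> Y" if "mode g > 0" for g
    proof -
      have "\<Psi> (act (bg_sigma m g) (v' n)) = 0" by (simp only: act[OF v'(1)] v'(2) std'(3)[OF that])
      then show ?thesis using \<Psi>(5)[OF submod_act[OF X v'(1)]] by blast
    qed
  next
    show "\<mu> \<notin> \<int> \<or> \<mu> = 0 \<and> (\<forall>n<0. v' n \<in> Y)"
      using std \<Psi>(5)[OF v'(1)] by (auto simp: T.standard_def v')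
    fix Z assume Z: "submod Z" "Y \<subseteq> Z" "range v' \<subseteq> Z"
    note ZX = submod_Int[OF Z(1) X]
    note ZXs = submod_subspace[OF ZX]
    have \<Psi>ZX: "\<Psi> (x + y) = \<Psi> x + \<Psi> y" "\<Psi> (c *s x) = s c (\<Psi> x)" if "x \<in> Z \<inter> X" "y \<in> Z \<inter> X" for x y c
      using \<Psi>(1,2) that by auto
    \<comment> \<open>This image contains the generators of T, hence is all of T; as Z contains the
      kernel Y, it then contains X.\<close>
    have "T.submod (\<Psi> ` (Z \<inter> X))"
      unfolding T.submod_def
    proof (intro conjI allI ballI)
      show "T.subspace (\<Psi> ` (Z \<inter> X))"
      proof (rule T.subspaceI)
        have "\<Psi> 0 = 0" using \<Psi>(2)[OF subspace_0[OF Xs], of 0] by simp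
        then show "0 \<in> \<Psi> ` (Z \<inter> X)" using subspace_0[OF ZXs] by (metis imageI)
      next
        fix a b assume "a \<in> \<Psi> ` (Z \<inter> X)" "b \<in> \<Psi> ` (Z \<inter> X)"
        then obtain x y where "x \<in> Z \<inter> X" "y \<in> Z \<inter> X" "a = \<Psi> x" "b = \<Psi> y" by blast
        then show "a + b \<in> \<Psi> ` (Z \<inter> X)"
          using \<Psi>ZX(1)[of x y] subspace_add[OF ZXs, of x y] by (metis imageI)
      next
        fix c a assume "a \<in> \<Psi> ` (Z \<inter> X)"
        then obtain x where "x \<in> Z \<inter> X" "a = \<Psi> x" by blast
        then show "s c a \<in> \<Psi> ` (Z \<inter> X)"
          using \<Psi>ZX(2)[of x x c] subspace_scale[OF ZXs, of x c] by (metis imageI)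
      qed
      show "\<Psi> ` (Z \<inter> X) \<subseteq> T" using \<Psi>(4) by auto
      fix g a assume "a \<in> \<Psi> ` (Z \<inter> X)"
      then obtain x where "x \<in> Z \<inter> X" "a = \<Psi> x" by blast
      then show "A g a \<in> \<Psi> ` (Z \<inter> X)" using act[of x g] submod_act[OF ZX, of x "bg_sigma m g"] by (metis IntE imageI)
    qed
    moreover have "range v \<subseteq> \<Psi> ` (Z \<inter> X)"
    proof
      fix y assume "y \<in> range v"
      then obtain n where "y = \<Psi> (v' n)" using v' by auto
      moreover have "v' n \<in> Z \<inter> X" using Z(3) v'(1) by auto
      ultimately show "y \<in> \<Psi> ` (Z \<inter> X)" by (rule image_eqI)
    qed
    ultimately have "T.gen (range v) \<subseteq> \<Psi> ` (Z \<inter> X)" by (rule T.gen_minimal)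
    then have T: "T \<subseteq> \<Psi> ` (Z \<inter> X)" using std by (auto simp: T.standard_def)
    show "X \<subseteq> Z"
    proof
      fix x assume x: "x \<in> X"
      then obtain z where z: "z \<in> Z" "z \<in> X" "\<Psi> x = \<Psi> z" using T \<Psi>(4) by blast
      then have "x - z \<in> Z" using mem[of x z] x Z(2) by blast
      then have "x - z + z \<in> Z" using z subspace_add[OF submod_subspace[OF Z(1)]] by blast
      then show "x \<in> Z" by simp
    qed
  qed (use X Y v' in auto)
  then show thesis by (rule that)
qed

lemma (in bg_premodule) minus_eq_zero:
  assumes "x \<in> carrier M" "y \<in> carrier M"
  shows "x \<ominus> y = \<zero> \<longleftrightarrow> x = y"
proof
  assume *: "x \<ominus> y = \<zero>"
  have "x = (x \<ominus> y) \<oplus> y" using assms by (simp add: a_minus_def M.a_assoc M.l_neg)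
  then show "x = y" using * assms by simp
qed (use assms in \<open>simp add: a_minus_def M.r_neg\<close>)

text \<open>Supplies the addition that the underlying type of M lacks. Elements of M become formal
  basis vectors, \<pi> evaluates a formal combination in M, and the copy of M is the image of a
  projection along the kernel of \<pi>.\<close>

lemma bg_module_model:
  fixes M :: "'v bg_rep" (structure)
  assumes "bg_module M"
  obtains C :: "('v \<Rightarrow>\<^sub>0 complex) set" and A f where "bg_space pm_scale C A"
    "f \<in> bg_hom (space_rep pm_scale C A) M" "bij_betw f C (carrier M)"
proof -
  interpret bg_module M by fact
  interpret P: bg_premodule M using assms by (rule bg_module_premodule)
  define X where "X = {p :: 'v \<Rightarrow>\<^sub>0 complex. Poly_Mapping.keys p \<subseteq> carrier M}"
  define a where "a g = lin_ext pm_scale (\<lambda>v. Poly_Mapping.single (act M g v) 1)" for g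
  define \<pi> where "\<pi> p = (\<Oplus>v\<in>Poly_Mapping.keys p. Poly_Mapping.lookup p v \<odot> v)" for p
  have X: "pm.subspace X" unfolding X_def by (rule subspace_keys)
  have a_lin: "a g (p + q) = a g p + a g q" "a g (pm_scale c p) = pm_scale c (a g p)" for g p q c
    by (simp_all add: a_def lin_ext_add[OF pm.vector_space_axioms] lin_ext_scale[OF pm.vector_space_axioms])
  have a_single: "a g (Poly_Mapping.single v c) = Poly_Mapping.single (act M g v) c" for g v c
    by (simp add: a_def lin_ext_single[OF pm.vector_space_axioms])
  have sm: "c \<odot> x \<in> carrier M" if "x \<in> carrier M" for c x using smult_closed[of c x] that by simp
  have aX: "a g p \<in> X" if "p \<in> X" for g p
    unfolding a_def using that act_closed
    by (intro lin_ext_in_subspace[OF pm.vector_space_axioms X]) (auto simp: X_def split: if_splits)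
  have \<pi>_superset: "\<pi> p = (\<Oplus>v\<in>S. Poly_Mapping.lookup p v \<odot> v)"
    if "finite S" "S \<subseteq> carrier M" "Poly_Mapping.keys p \<subseteq> S" for p S
    unfolding \<pi>_def
  proof (rule M.add.finprod_mono_neutral_cong_left[OF that(1,3)])
    fix v assume "v \<in> S - Poly_Mapping.keys p"
    then show "Poly_Mapping.lookup p v \<odot> v = \<zero>" using that(2) smult_l_null[of v] by (auto simp: in_keys_iff)
  qed (use that sm in \<open>auto simp: Pi_def\<close>)
  have \<pi>_closed: "\<pi> p \<in> carrier M" if "p \<in> X" for p
    unfolding \<pi>_def using that by (intro M.finsum_closed) (auto simp: X_def intro!: sm)
  have \<pi>_add: "\<pi> (p + q) = \<pi> p \<oplus> \<pi> q" if "p \<in> X" "q \<in> X" for p q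
  proof -
    let ?S = "Poly_Mapping.keys p \<union> Poly_Mapping.keys q"
    have S: "finite ?S" "?S \<subseteq> carrier M" using that by (auto simp: X_def)
    have "\<pi> (p + q) = (\<Oplus>v\<in>?S. Poly_Mapping.lookup p v \<odot> v \<oplus> Poly_Mapping.lookup q v \<odot> v)"
      unfolding \<pi>_superset[OF S Poly_Mapping.keys_add]
      using S(2) smult_l_distr sm by (intro M.finsum_cong') (auto simp: lookup_add)
    also have "\<dots> = \<pi> p \<oplus> \<pi> q"
      using S by (subst M.finsum_addf) (auto simp: \<pi>_superset[OF S] intro!: sm)
    finally show ?thesis .
  qed
  have smult_finsum: "c \<odot> (\<Oplus>v\<in>S. f v) = (\<Oplus>v\<in>S. c \<odot> f v)" if "finite S" "f \<in> S \<rightarrow> carrier M" for c f and S :: "'v set"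
    using that
  proof (induction S rule: finite_induct)
    case empty
    then show ?case using smult_r_null[of c] by simp
  next
    case (insert v S)
    then have f: "f v \<in> carrier M" "f \<in> S \<rightarrow> carrier M" by auto
    then show ?case using insert smult_r_distr[of c "f v" "\<Oplus>v\<in>S. f v"] sm
      by (simp add: M.finsum_insert Pi_iff)
  qed
  have \<pi>_scale: "\<pi> (pm_scale c p) = c \<odot> \<pi> p" if "p \<in> X" for p c
  proof -
    have S: "finite (Poly_Mapping.keys p)" "Poly_Mapping.keys p \<subseteq> carrier M" using that by (auto simp: X_def)
    have "\<pi> (pm_scale c p) = (\<Oplus>v\<in>Poly_Mapping.keys p. c \<odot> (Poly_Mapping.lookup p v \<odot> v))"
      using S(2) smult_assoc1 sm
      by (subst \<pi>_superset[OF S]) (auto simp: in_keys_iff intro!: M.finsum_cong')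
    also have "\<dots> = c \<odot> \<pi> p" unfolding \<pi>_def using S sm by (intro smult_finsum[symmetric]) auto
    finally show ?thesis .
  qed
  have \<pi>_single: "\<pi> (Poly_Mapping.single v c) = c \<odot> v" if "v \<in> carrier M" for v c
    using that sm by (subst \<pi>_superset[of "{v}"]) (auto simp: M.finsum_insert)
  have singleX: "Poly_Mapping.single v c \<in> X" if "v \<in> carrier M" for v c using that by (auto simp: X_def)
  have \<pi>_0: "\<pi> 0 = \<zero>" by (simp add: \<pi>_def)
  have \<pi>_act: "\<pi> (a g p) = act M g (\<pi> p)" if "p \<in> X" for g p
  proof -
    have "Poly_Mapping.keys p \<subseteq> carrier M" using that by (simp add: X_def)
    then show ?thesis
    proof (induction rule: keys_induct)
      case zero
      have "act M g \<zero> = \<zero>" using act_smult[of \<zero> g 0] act_closed[of \<zero> g] smult_l_null by simp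
      then show ?case using a_lin(2)[of g 0 0] by (simp add: \<pi>_0)
    next
      case (add c v q)
      then have q: "q \<in> X" by (simp add: X_def)
      show ?case using add q aX act_closed sm
        by (simp add: a_lin a_single \<pi>_add \<pi>_single singleX act_add act_smult \<pi>_closed)
    qed
  qed
  have \<pi>_diff: "\<pi> (p - q) = \<pi> p \<ominus> \<pi> q" if "p \<in> X" "q \<in> X" for p q
  proof -
    have "\<pi> (p + pm_scale (- 1) q) = \<pi> p \<oplus> (- 1) \<odot> \<pi> q"
      using that pm.subspace_scale[OF X that(2)] by (simp only: \<pi>_add \<pi>_scale)
    then show ?thesis using that \<pi>_closed by (simp add: P.minus_eq)
  qed
  define Y where "Y = {p \<in> X. \<pi> p = \<zero>}"
  have Yd: "\<pi> p = \<pi> q \<longleftrightarrow> p - q \<in> Y" if "p \<in> X" "q \<in> X" for p q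
    using that \<pi>_closed by (simp add: Y_def \<pi>_diff pm.subspace_diff[OF X] P.minus_eq_zero)
  have Y: "pm.subspace Y"
  proof (rule pm.subspaceI)
    show "0 \<in> Y" using pm.subspace_0[OF X] by (simp add: Y_def \<pi>_0)
  next
    fix p q assume "p \<in> Y" "q \<in> Y"
    then show "p + q \<in> Y" using pm.subspace_add[OF X] by (simp add: Y_def \<pi>_add)
  next
    fix c p assume "p \<in> Y"
    then show "pm_scale c p \<in> Y" using pm.subspace_scale[OF X] smult_r_null[of c] by (simp add: Y_def \<pi>_scale)
  qed
  have Yact: "a g p \<in> Y" if "p \<in> Y" for g p
    using that aX \<pi>_act[of p g] \<pi>_act[of 0 g] pm.subspace_0[OF X] a_lin(2)[of g 0 0] by (simp add: Y_def \<pi>_0)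
  have comm: "a g (a h p) - a h (a g p) - pm_scale (bg_comm g h) p \<in> Y" if "p \<in> X" for g h p
  proof -
    note c = aX[OF aX[OF that]] pm.subspace_scale[OF X that] that aX[OF that]
    have "\<pi> (a g (a h p) - a h (a g p)) = \<pi> (pm_scale (bg_comm g h) p)"
      using c by (simp add: \<pi>_diff \<pi>_act \<pi>_scale act_comm \<pi>_closed)
    then show ?thesis using c pm.subspace_diff[OF X] by (simp add: Yd)
  qed
  obtain q where q: "\<And>x y. q (x + y) = q x + q y" "\<And>c x. q (pm_scale c x) = pm_scale c (q x)"
    "\<And>x. x - q x \<in> Y" "\<And>x. q x = 0 \<longleftrightarrow> x \<in> Y" "bg_space pm_scale (q ` X) (\<lambda>g x. q (a g x))"
    "\<And>g x. q (a g (q x)) = q (a g x)"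
    by (rule quotient_bg_space[OF pm.vector_space_axioms a_lin X aX Y Yact _ comm]) (auto simp: Y_def intro: that)
  have qX: "q p \<in> X" if "p \<in> X" for p
  proof -
    have "p - q p \<in> X" using q(3)[of p] by (simp add: Y_def)
    from pm.subspace_diff[OF X that this] show ?thesis by simp
  qed
  have \<pi>q: "\<pi> (q p) = \<pi> p" if "p \<in> X" for p using Yd[OF that qX[OF that]] q(3) by simp
  have "\<pi> \<in> bg_hom (space_rep pm_scale (q ` X) (\<lambda>g x. q (a g x))) M"
  proof (rule bg_homI)
    show "\<pi> (act (space_rep pm_scale (q ` X) (\<lambda>g x. q (a g x))) g x) = act M g (\<pi> x)"
      if "x \<in> carrier (space_rep pm_scale (q ` X) (\<lambda>g x. q (a g x)))" for g x
      using that qX aX by (auto simp: \<pi>q \<pi>_act)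
  qed (auto simp: \<pi>_closed \<pi>_add \<pi>_scale qX)
  moreover have "bij_betw \<pi> (q ` X) (carrier M)"
    unfolding bij_betw_def
  proof
    show "inj_on \<pi> (q ` X)"
    proof (rule inj_onI, clarify)
      fix x y assume xy: "x \<in> X" "y \<in> X" "\<pi> (q x) = \<pi> (q y)"
      then have "x - y \<in> Y" by (simp add: \<pi>q Yd)
      then have "q (x - y) = 0" by (simp add: q(4))
      then show "q x = q y" using q(1)[of "x - y" y] by simp
    qed
    show "\<pi> ` q ` X = carrier M"
    proof
      show "\<pi> ` q ` X \<subseteq> carrier M" by (auto simp: \<pi>_closed qX)
      show "carrier M \<subseteq> \<pi> ` q ` X"
      proof
        fix v assume v: "v \<in> carrier M"
        then have "\<pi> (q (Poly_Mapping.single v 1)) = v" using smult_one[of v] by (simp add: \<pi>q singleX \<pi>_single)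
        then show "v \<in> \<pi> ` q ` X" using singleX[OF v] by (metis imageI)
      qed
    qed
  qed
  ultimately show thesis using that q(5) by blast
qed

section \<open>The operator \<open>J\<^sub>0\<close>\<close>

context bg_premodule
begin

text \<open>Covers infinite index sets too, where both sums have the default value zero.\<close>

lemma finsum_restrict:
  assumes H: "bg_submodule H M" and f: "\<And>a. a \<in> S \<Longrightarrow> f a \<in> H"
  shows "finsum (M\<lparr>carrier := H\<rparr>) f S = finsum M f S \<and> finsum M f S \<in> H"
proof -
  interpret H: bg_premodule "M\<lparr>carrier := H\<rparr>" by (rule restrict_premodule[OF H])
  note HD = bg_submoduleD[OF H]
  show ?thesis using f
  proof (induction S rule: infinite_finite_induct)
    case (infinite S)
    then show ?case using HD(2) by (simp add: M.finsum_infinite H.M.finsum_infinite)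
  next
    case empty
    then show ?case using HD(2) by simp
  next
    case (insert a S)
    then have "f \<in> S \<rightarrow> H" "f a \<in> H" "f \<in> S \<rightarrow> carrier M" "f a \<in> carrier M" using HD(1) by auto
    then show ?case using insert HD(3) by (simp add: M.finsum_insert H.M.finsum_insert)
  qed
qed

lemma J0_restrict:
  assumes H: "bg_submodule H M" and x: "x \<in> H"
  shows "J0 (M\<lparr>carrier := H\<rparr>) x = J0 M x" "J0 M x \<in> H"
proof -
  note HD = bg_submoduleD[OF H]
  have b: "act M (Gamma (- n)) (act M (Beta n) x) \<in> H" "act M (Beta (- n)) (act M (Gamma n) x) \<in> H" for n
    using HD(5) x by auto
  show "J0 (M\<lparr>carrier := H\<rparr>) x = J0 M x" "J0 M x \<in> H"
    unfolding J0_def using finsum_restrict[OF H, of _ "\<lambda>n. act M (Gamma (- n)) (act M (Beta n) x)"]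
      finsum_restrict[OF H, of _ "\<lambda>n. act M (Beta (- n)) (act M (Gamma n) x)"] b HD(3) by auto
qed

lemma J0_gen_eigenvalue_restrict:
  assumes H: "bg_submodule H M" and c: "J0_gen_eigenvalue (M\<lparr>carrier := H\<rparr>) c"
  shows "J0_gen_eigenvalue M c"
proof -
  interpret H: bg_premodule "M\<lparr>carrier := H\<rparr>" by (rule restrict_premodule[OF H])
  note HD = bg_submoduleD[OF H]
  obtain x m where x: "x \<in> H" "x \<noteq> \<zero>"
    "((\<lambda>y. J0 (M\<lparr>carrier := H\<rparr>) y \<ominus>\<^bsub>M\<lparr>carrier := H\<rparr>\<^esub> (c \<odot>\<^bsub>M\<lparr>carrier := H\<rparr>\<^esub> y)) ^^ m) x = \<zero>"
    using c by (auto simp: J0_gen_eigenvalue_def)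
  have step: "J0 (M\<lparr>carrier := H\<rparr>) y \<ominus>\<^bsub>M\<lparr>carrier := H\<rparr>\<^esub> (c \<odot>\<^bsub>M\<lparr>carrier := H\<rparr>\<^esub> y) = J0 M y \<ominus> (c \<odot> y)"
    "J0 M y \<ominus> (c \<odot> y) \<in> H" if "y \<in> H" for y
    using J0_restrict[OF H that] HD(4)[OF that, of c] HD(1) HD(7)[of "J0 M y" "c \<odot> y"]
      H.minus_eq[of "J0 M y" "c \<odot> y"] minus_eq[of "J0 M y" "c \<odot> y"] by (auto simp: subset_iff)
  have "((\<lambda>y. J0 (M\<lparr>carrier := H\<rparr>) y \<ominus>\<^bsub>M\<lparr>carrier := H\<rparr>\<^esub> (c \<odot>\<^bsub>M\<lparr>carrier := H\<rparr>\<^esub> y)) ^^ m) x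
      = ((\<lambda>y. J0 M y \<ominus> (c \<odot> y)) ^^ m) x \<and> ((\<lambda>y. J0 M y \<ominus> (c \<odot> y)) ^^ m) x \<in> H" for m
    by (induction m) (use x(1) step in auto)
  then show ?thesis using x HD(1) by (auto simp: J0_gen_eigenvalue_def)
qed

lemma finsum_scaled:
  assumes "finite S" "x \<in> carrier M"
  shows "(\<Oplus>n\<in>S. c n \<odot> x) = (\<Sum>n\<in>S. c n) \<odot> x"
  using assms(1)
proof (induction S rule: finite_induct)
  case empty
  then show ?case using smult_l_null[OF assms(2)] by simp
next
  case (insert n S)
  then show ?case using assms(2) smult_closed[of _ x] smult_l_distr[of "c n" "sum c S" x]
    by (simp add: M.finsum_insert)
qed

end

context bg_module
begin

text \<open>J_0 multiplies x by the sum of the h m, lowered by 1 for negative m, over the terms in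
  the two supports. If \<nu> is not an integer, the term for m0 does occur: h m0 is then neither 0
  nor 1, so beta_m0 x (for m0 \<ge> 0) or gamma_(-m0) x (for m0 < 0) is nonzero.\<close>

lemma J0_eigenvalue_class:
  assumes "smooth M" and x: "x \<in> carrier M" "x \<noteq> \<zero>"
    and h: "\<And>m. act M (Gamma (- m)) (act M (Beta m) x) = h m \<odot> x"
    and int: "\<And>m. m \<noteq> m0 \<Longrightarrow> h m \<in> \<int>" "h m0 - \<nu> \<in> \<int>"
  obtains c where "J0_gen_eigenvalue M c" "c - \<nu> \<in> \<int>"
proof -
  interpret P: bg_premodule M by (rule bg_module_premodule) (rule bg_module_axioms)
  define S1 where "S1 = {n. n \<ge> 0 \<and> act M (Beta n) x \<noteq> \<zero>}"
  define S2 where "S2 = {n. n \<ge> 1 \<and> act M (Gamma n) x \<noteq> \<zero>}"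
  obtain B where B: "\<And>n. n \<ge> B \<Longrightarrow> act M (Beta n) x = \<zero> \<and> act M (Gamma n) x = \<zero>"
    using assms(1) x by (auto simp: smooth_def)
  have "S1 \<subseteq> {0..B}" "S2 \<subseteq> {0..B}"
    using B by (auto simp: S1_def S2_def intro!: leI)
  then have fin: "finite S1" "finite S2" by (auto intro: finite_subset)
  have sm: "c \<odot> y \<in> carrier M" if "y \<in> carrier M" for c y using smult_closed[of c y] that by simp
  have act0: "act M g \<zero> = \<zero>" for g using act_smult[of \<zero> g 0] act_closed[of \<zero> g] smult_l_null by simp
  have h': "act M (Beta (- n)) (act M (Gamma n) x) = (h (- n) - 1) \<odot> x" for n
  proof -
    have c: "act M (Beta (- n)) (act M (Gamma n) x) \<in> carrier M" "act M (Gamma n) (act M (Beta (- n)) x) \<in> carrier M"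
      using act_closed x by auto
    have "act M (Beta (- n)) (act M (Gamma n) x) = (act M (Beta (- n)) (act M (Gamma n) x) \<ominus>
        act M (Gamma n) (act M (Beta (- n)) x)) \<oplus> act M (Gamma n) (act M (Beta (- n)) x)"
      using c by (simp add: a_minus_def M.a_assoc M.l_neg)
    also have "\<dots> = (- 1) \<odot> x \<oplus> h (- n) \<odot> x"
      using act_comm[OF x(1), of "Beta (- n)" "Gamma n"] h[of "- n"] by simp
    also have "\<dots> = (h (- n) - 1) \<odot> x" using smult_l_distr[of "- 1" "h (- n)" x] x by simp
    finally show ?thesis .
  qed
  define c where "c = (\<Sum>n\<in>S1. h n) + (\<Sum>n\<in>S2. h (- n) - 1)"
  have "J0 M x = c \<odot> x"
    unfolding J0_def h h' S1_def[symmetric] S2_def[symmetric] P.finsum_scaled[OF fin(1) x(1)] P.finsum_scaled[OF fin(2) x(1)]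
    using smult_l_distr[of "\<Sum>n\<in>S1. h n" "\<Sum>n\<in>S2. h (- n) - 1" x] x by (simp add: c_def)
  then have "J0 M x \<ominus> (c \<odot> x) = \<zero>" using sm[OF x(1)] by (simp add: P.minus_eq_zero)
  then have J: "J0_gen_eigenvalue M c"
    unfolding J0_gen_eigenvalue_def using x by (intro bexI[of _ x] conjI exI[of _ 1]) auto
  have "c - \<nu> \<in> \<int>"
  proof (cases "\<nu> \<in> \<int>")
    case True
    have "h m0 = (h m0 - \<nu>) + \<nu>" by simp
    also have "\<dots> \<in> \<int>" using int(2) True by (rule Ints_add)
    finally have "h m \<in> \<int>" for m using int(1)[of m] by (cases "m = m0") auto
    then have "c \<in> \<int>" unfolding c_def by (intro Ints_add Ints_sum Ints_diff) auto
    then show ?thesis using True by (rule Ints_diff)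
  next
    case False
    have hm0: "h m0 \<noteq> d" if "d \<in> \<int>" for d
    proof
      assume "h m0 = d"
      then have "\<nu> = d - (h m0 - \<nu>)" by simp
      also have "\<dots> \<in> \<int>" using that int(2) by (rule Ints_diff)
      finally show False using False by blast
    qed
    have nz: "e \<odot> x \<noteq> \<zero>" if "e \<noteq> 0" for e
    proof
      assume "e \<odot> x = \<zero>"
      then have "(1 / e) \<odot> (e \<odot> x) = \<zero>" using smult_r_null[of "1 / e"] by simp
      then show False using smult_assoc1[of "1 / e" e x] smult_one[OF x(1)] that x by simp
    qed
    show ?thesis
    proof (cases "m0 \<ge> 0")
      case True
      have "act M (Beta m0) x \<noteq> \<zero>" using nz[OF hm0[of 0]] h[of m0] act0 by auto
      then have m0: "m0 \<in> S1" using True by (simp add: S1_def)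
      have "c - \<nu> = (h m0 - \<nu>) + (\<Sum>n\<in>S1 - {m0}. h n) + (\<Sum>n\<in>S2. h (- n) - 1)"
        unfolding c_def by (simp add: sum.remove[OF fin(1) m0])
      also have "\<dots> \<in> \<int>"
        using True by (intro Ints_add Ints_sum int(2)) (auto simp: S2_def intro!: Ints_diff int(1))
      finally show ?thesis .
    next
      case m0: False
      have "h m0 - 1 \<noteq> 0" using hm0[of 1] by simp
      then have "act M (Gamma (- m0)) x \<noteq> \<zero>" using nz[of "h m0 - 1"] h'[of "- m0"] act0 by auto
      then have "- m0 \<in> S2" using m0 by (simp add: S2_def)
      then have "c - \<nu> = (h m0 - \<nu>) - 1 + (\<Sum>n\<in>S1. h n) + (\<Sum>n\<in>S2 - {- m0}. h (- n) - 1)"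
        unfolding c_def by (simp add: sum.remove[OF fin(2)])
      also have "\<dots> \<in> \<int>"
        using m0 by (intro Ints_add Ints_sum Ints_diff[OF int(2) Ints_1]) (auto simp: S1_def intro!: Ints_diff int(1))
      finally show ?thesis .
    qed
  qed
  with J show thesis by (rule that)
qed

end

section \<open>Submodules of objects of the category\<close>

lemma bg_simple_generator_iso: "bg_iso S S' \<Longrightarrow> bg_simple_generator S' \<Longrightarrow> bg_simple_generator S"
  unfolding bg_simple_generator_def by (meson bg_iso_trans)

locale bg_model = bg_module M for M :: "'v bg_rep" (structure) +
  fixes C :: "('v \<Rightarrow>\<^sub>0 complex) set" and A :: "bg_gen \<Rightarrow> ('v \<Rightarrow>\<^sub>0 complex) \<Rightarrow> ('v \<Rightarrow>\<^sub>0 complex)"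
    and f :: "('v \<Rightarrow>\<^sub>0 complex) \<Rightarrow> 'v"
  assumes space: "bg_space pm_scale C A"
    and hom: "f \<in> bg_hom (space_rep pm_scale C A) M"
    and bij: "bij_betw f C (carrier M)"
begin

sublocale P: bg_premodule M
  by (rule bg_module_premodule) (rule bg_module_axioms)

sublocale S: bg_space pm_scale C A
  by (rule space)

lemma f_simps:
  "x \<in> C \<Longrightarrow> f x \<in> carrier M" "x \<in> C \<Longrightarrow> y \<in> C \<Longrightarrow> f (x + y) = f x \<oplus> f y"
  "x \<in> C \<Longrightarrow> f (pm_scale c x) = c \<odot> f x" "x \<in> C \<Longrightarrow> f (A g x) = act M g (f x)"
  using bg_homD[OF hom] by auto

lemma f_zero: "f 0 = \<zero>"
  using f_simps(3)[of 0 0] f_simps(1)[of 0] pm.subspace_0[OF S.subspace_C] smult_l_null by simp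

lemma f_diff: "x \<in> C \<Longrightarrow> y \<in> C \<Longrightarrow> f (x - y) = f x \<ominus> f y"
proof -
  assume xy: "x \<in> C" "y \<in> C"
  have "f (x + pm_scale (- 1) y) = f x \<oplus> (- 1) \<odot> f y"
    using xy pm.subspace_scale[OF S.subspace_C xy(2)] by (simp only: f_simps)
  then show ?thesis using xy f_simps(1) by (simp add: P.minus_eq)
qed

lemma f_inj: "x \<in> C \<Longrightarrow> y \<in> C \<Longrightarrow> f x = f y \<Longrightarrow> x = y"
  using bij by (auto simp: bij_betw_def dest: inj_onD)

lemma f_surj: "x \<in> carrier M \<Longrightarrow> \<exists>y\<in>C. x = f y"
  using bij by (auto simp: bij_betw_def)

definition preimage :: "'v set \<Rightarrow> ('v \<Rightarrow>\<^sub>0 complex) set" where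
  "preimage H = {x \<in> C. f x \<in> H}"

lemma submod_preimage:
  assumes "bg_submodule H M"
  shows "S.submod (preimage H)"
proof -
  note HD = P.bg_submoduleD[OF assms]
  have "pm.subspace (preimage H)"
    using pm.subspace_0[OF S.subspace_C] pm.subspace_add[OF S.subspace_C] pm.subspace_scale[OF S.subspace_C] HD
    by (intro pm.subspaceI) (auto simp: preimage_def f_zero f_simps)
  then show ?thesis using HD(5) by (auto simp: S.submod_def preimage_def S.act_closed f_simps)
qed

lemma bg_submodule_image:
  assumes Z: "S.submod Z"
  shows "bg_submodule (f ` Z) M"
proof (rule P.bg_submoduleI)
  note ZC = S.submod_subset[OF Z] and Zs = S.submod_subspace[OF Z]
  show "f ` Z \<subseteq> carrier M" using ZC f_simps(1) by auto
  show "\<zero> \<in> f ` Z" using f_zero pm.subspace_0[OF Zs] by (metis imageI)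
  fix x assume "x \<in> f ` Z"
  then obtain z where z: "z \<in> Z" "x = f z" by auto
  show "c \<odot> x \<in> f ` Z" for c
    using z f_simps(3)[OF ZC[OF z(1)], of c] pm.subspace_scale[OF Zs z(1), of c] by (metis imageI)
  show "act M g x \<in> f ` Z" for g
    using z f_simps(4)[OF ZC[OF z(1)], of g] S.submod_act[OF Z z(1), of g] by (metis imageI)
  fix y assume "y \<in> f ` Z"
  then obtain w where w: "w \<in> Z" "y = f w" by auto
  show "x \<oplus> y \<in> f ` Z"
    using z w f_simps(2)[OF ZC[OF z(1)] ZC[OF w(1)]] pm.subspace_add[OF Zs z(1) w(1)] by (metis imageI)
qed

lemma simple_step_of_iso:
  fixes s :: "complex \<Rightarrow> 'c::ab_group_add \<Rightarrow> 'c"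
  assumes X: "bg_submodule X M" and Y: "bg_submodule Y M" "Y \<subseteq> X" and T: "bg_space s T B"
    and std: "bg_space.standard s T B \<mu> v"
    and iso: "bg_iso (bg_quot (M\<lparr>carrier := X\<rparr>) Y) (space_rep s T (\<lambda>g. B (bg_sigma (- n) g)))"
  shows "\<exists>v'. S.simple_step n \<mu> v' (preimage Y) (preimage X)"
proof -
  interpret X: bg_premodule "M\<lparr>carrier := X\<rparr>" by (rule P.restrict_premodule[OF X])
  interpret T: bg_space s T B by fact
  note Y' = P.restrict_submodule[OF X Y]
  let ?\<kappa> = "\<lambda>x. Y +>\<^bsub>M\<lparr>carrier := X\<rparr>\<^esub> x"
  obtain \<psi> where \<psi>: "\<psi> \<in> bg_hom (bg_quot (M\<lparr>carrier := X\<rparr>) Y) (space_rep s T (\<lambda>g. B (bg_sigma (- n) g)))"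
    "bij_betw \<psi> (carrier (bg_quot (M\<lparr>carrier := X\<rparr>) Y)) T"
    using iso by (auto simp: bg_iso_def)
  define \<Psi> where "\<Psi> = (\<psi> \<circ> ?\<kappa>) \<circ> f"
  have hom\<Psi>: "\<psi> \<circ> ?\<kappa> \<in> bg_hom (M\<lparr>carrier := X\<rparr>) (space_rep s T (\<lambda>g. B (bg_sigma (- n) g)))"
    by (rule bg_hom_comp[OF X.bg_quot_hom(1)[OF Y'] \<psi>(1)])
  have eq: "(\<psi> \<circ> ?\<kappa>) x = (\<psi> \<circ> ?\<kappa>) y \<longleftrightarrow> x \<ominus>\<^bsub>M\<lparr>carrier := X\<rparr>\<^esub> y \<in> Y" if "x \<in> X" "y \<in> X" for x y
  proof -
    have "?\<kappa> x \<in> carrier (bg_quot (M\<lparr>carrier := X\<rparr>) Y)" "?\<kappa> y \<in> carrier (bg_quot (M\<lparr>carrier := X\<rparr>) Y)"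
      using X.bg_quot_hom(2)[OF Y'] that by auto
    then have "\<psi> (?\<kappa> x) = \<psi> (?\<kappa> y) \<longleftrightarrow> ?\<kappa> x = ?\<kappa> y"
      using \<psi>(2) by (auto simp: bij_betw_def inj_on_eq_iff)
    then show ?thesis using X.bg_quot_hom(3)[OF Y', of x y] that by simp
  qed
  have surj: "(\<psi> \<circ> ?\<kappa>) ` X = T"
  proof -
    have "T = \<psi> ` carrier (bg_quot (M\<lparr>carrier := X\<rparr>) Y)" using \<psi>(2) by (simp add: bij_betw_def)
    also have "\<dots> = \<psi> ` ?\<kappa> ` X" using X.bg_quot_hom(2)[OF Y'] by simp
    finally show ?thesis by (simp only: image_comp)
  qed
  have sub: "S.submod (preimage X)" "S.submod (preimage Y)" "preimage Y \<subseteq> preimage X"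
    using submod_preimage X Y by (auto simp: preimage_def)
  have fX: "f ` preimage X = X"
    using f_surj P.bg_submoduleD(1)[OF X] by (auto simp: preimage_def image_iff)
  note Xs = S.submod_subspace[OF sub(1)]
  have b: "x \<in> C" "f x \<in> X" if "x \<in> preimage X" for x using that by (auto simp: preimage_def)
  have zero: "f 0 \<in> X" "(\<psi> \<circ> ?\<kappa>) (f 0) = 0"
  proof -
    show "f 0 \<in> X" using f_zero P.bg_submoduleD(2)[OF X] by simp
    then show "(\<psi> \<circ> ?\<kappa>) (f 0) = 0"
      using bg_homD(3)[OF hom\<Psi>, of "f 0" 0] X.smult_l_null[of "f 0"] by (simp add: f_zero)
  qed
  have "\<exists>v'. S.simple_step n \<mu> v' (preimage Y) (preimage X)"
  proof (rule S.simple_step_from_hom[OF sub T std, where \<Psi> = \<Psi> and m = n])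
    show "\<Psi> (x + y) = \<Psi> x + \<Psi> y" if "x \<in> preimage X" "y \<in> preimage X" for x y
      using bg_homD(2)[OF hom\<Psi>, of "f x" "f y"] b[OF that(1)] b[OF that(2)] by (simp add: \<Psi>_def f_simps)
    show "\<Psi> (pm_scale c x) = s c (\<Psi> x)" if "x \<in> preimage X" for c x
      using bg_homD(3)[OF hom\<Psi>, of "f x" c] b[OF that] by (simp add: \<Psi>_def f_simps)
    show "\<Psi> (A g x) = B (bg_sigma (- n) g) (\<Psi> x)" if "x \<in> preimage X" for g x
      using bg_homD(4)[OF hom\<Psi>, of "f x" g] b[OF that] by (simp add: \<Psi>_def f_simps)
    show "\<Psi> ` preimage X = T" unfolding \<Psi>_def using surj fX by (metis image_comp)
    show "\<Psi> x = 0 \<longleftrightarrow> x \<in> preimage Y" if "x \<in> preimage X" for x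
    proof -
      have "\<Psi> x = 0 \<longleftrightarrow> f x \<ominus>\<^bsub>M\<lparr>carrier := X\<rparr>\<^esub> f 0 \<in> Y"
        using eq[OF b(2)[OF that] zero(1)] zero(2) by (simp add: \<Psi>_def)
      also have "f x \<ominus>\<^bsub>M\<lparr>carrier := X\<rparr>\<^esub> f 0 = f x"
        using X.minus_eq[of "f x" "f 0"] b[OF that] zero(1) f_zero smult_r_null[of "- 1"] f_simps(1)[of x] by simp
      finally show ?thesis using that by (simp add: preimage_def)
    qed
  qed blast
  then show ?thesis .
qed

lemma simple_step_of_generator:
  assumes X: "bg_submodule X M" and Y: "bg_submodule Y M" "Y \<subseteq> X"
    and gen: "bg_simple_generator (bg_quot (M\<lparr>carrier := X\<rparr>) Y)"
  shows "\<exists>m \<mu> v. S.simple_step m \<mu> v (preimage Y) (preimage X)"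
  using gen unfolding bg_simple_generator_def
proof (elim disjE exE conjE)
  fix n assume *: "bg_iso (bg_quot (M\<lparr>carrier := X\<rparr>) Y) (bg_flow n bg_V)"
  have "bg_iso (bg_flow n bg_V) (space_rep pm_scale V.ind_carrier (\<lambda>g. V.ind_act (bg_sigma (- n) g)))"
    using bg_iso_flow[OF V.bg_ind_iso_space, of n] by (simp add: bg_V_def bg_flow_space_rep)
  from simple_step_of_iso[OF X Y V.bg_space_ind V_standard bg_iso_trans[OF * this]]
  show ?thesis by blast
next
  fix n \<mu> assume *: "bg_iso (bg_quot (M\<lparr>carrier := X\<rparr>) Y) (bg_flow n (bg_W \<mu> 1))" and \<mu>: "\<mu> \<notin> \<int>"
  have "bg_iso (bg_flow n (bg_W \<mu> 1)) (space_rep pm_scale (W.ind_carrier \<mu> 1) (\<lambda>g. W.ind_act \<mu> 1 (bg_sigma (- n) g)))"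
    using bg_iso_flow[OF W.bg_ind_iso_space[of \<mu> 1], of n] by (simp add: bg_W_def bg_flow_space_rep)
  from simple_step_of_iso[OF X Y W.bg_space_ind W_standard[OF \<mu>] bg_iso_trans[OF * this]]
  show ?thesis by blast
qed

section \<open>Filtrations of the copy and of submodules\<close>

lemma filtered_chain:
  assumes "bg_filtered M"
  obtains F r where "S.composition_chain F r"
proof -
  obtain r G where G: "G 0 = {\<zero>}" "G r = carrier M" "\<And>i. i \<le> r \<Longrightarrow> bg_submodule (G i) M"
    "\<And>i. i < r \<Longrightarrow> G i \<subseteq> G (Suc i) \<and> bg_simple_generator (bg_quot (M\<lparr>carrier := G (Suc i)\<rparr>) (G i))"
    using assms by (auto simp: bg_filtered_def)
  have "preimage (G 0) = {0}"
    using f_inj[of _ 0] pm.subspace_0[OF S.subspace_C] by (auto simp: preimage_def G(1) f_zero)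
  moreover have "preimage (G r) = C" using f_simps(1) by (auto simp: preimage_def G(2))
  moreover have "\<exists>m \<mu> v. S.simple_step m \<mu> v (preimage (G i)) (preimage (G (Suc i)))" if "i < r" for i
    using G(3)[of i] G(3)[of "Suc i"] G(4)[OF that] that by (intro simple_step_of_generator) auto
  ultimately have "S.composition_chain (\<lambda>i. preimage (G i)) r" by (simp add: S.composition_chain_def)
  then show thesis by (rule that)
qed

text \<open>The filtration is intersected with H. By simplicity each new factor is zero or the full
  old factor; zero factors are skipped, so the length r' has to be found along with G in the
  induction.\<close>

lemma filtered_restrict:
  assumes "bg_filtered M" and H: "bg_submodule H M"
  shows "bg_filtered (M\<lparr>carrier := H\<rparr>)"
proof -
  obtain r F where F: "F 0 = {\<zero>}" "F r = carrier M" "\<And>i. i \<le> r \<Longrightarrow> bg_submodule (F i) M"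
    "\<And>i. i < r \<Longrightarrow> F i \<subseteq> F (Suc i) \<and> bg_simple_generator (bg_quot (M\<lparr>carrier := F (Suc i)\<rparr>) (F i))"
    using assms by (auto simp: bg_filtered_def)
  note HD = P.bg_submoduleD[OF H]
  have "\<exists>r' G. G 0 = {\<zero>} \<and> G r' = F i \<inter> H \<and> (\<forall>j\<le>r'. bg_submodule (G j) M \<and> G j \<subseteq> H) \<and>
      (\<forall>j<r'. G j \<subseteq> G (Suc j) \<and> bg_simple_generator (bg_quot (M\<lparr>carrier := G (Suc j)\<rparr>) (G j)))"
    if "i \<le> r" for i
    using that
  proof (induction i)
    case 0
    have "F 0 \<inter> H = {\<zero>}" using F(1) HD(2) by auto
    moreover have "bg_submodule {\<zero>} M" using F(3)[of 0] F(1) by simp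
    ultimately show ?case using HD(2) by (intro exI[of _ 0] exI[of _ "\<lambda>_. {\<zero>}"]) auto
  next
    case (Suc i)
    then obtain r' G where G: "G 0 = {\<zero>}" "G r' = F i \<inter> H" "\<forall>j\<le>r'. bg_submodule (G j) M \<and> G j \<subseteq> H"
      "\<forall>j<r'. G j \<subseteq> G (Suc j) \<and> bg_simple_generator (bg_quot (M\<lparr>carrier := G (Suc j)\<rparr>) (G j))" by auto
    have sub: "bg_submodule (F i) M" "bg_submodule (F (Suc i)) M" "F i \<subseteq> F (Suc i)"
      "bg_simple_generator (bg_quot (M\<lparr>carrier := F (Suc i)\<rparr>) (F i))"
      using F(3)[of i] F(3)[of "Suc i"] F(4)[of i] Suc.prems by auto
    obtain m \<mu> v where st: "S.simple_step m \<mu> v (preimage (F i)) (preimage (F (Suc i)))"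
      using simple_step_of_generator[OF sub(2,1,3,4)] by blast
    have subH: "bg_submodule (F (Suc i) \<inter> H) M" by (rule P.bg_submodule_Int[OF sub(2) H])
    \<comment> \<open>The sum of the intersection and the lower term lies between two consecutive
      terms, so by simplicity it equals one of them.\<close>
    let ?Z = "{x + y | x y. x \<in> preimage (F (Suc i) \<inter> H) \<and> y \<in> preimage (F i)}"
    have b: "S.submod (preimage (F (Suc i) \<inter> H))" "S.submod (preimage (F i))" "S.submod (preimage (F (Suc i)))"
      using submod_preimage subH sub by auto
    have inc: "preimage (F (Suc i) \<inter> H) \<subseteq> ?Z" "preimage (F i) \<subseteq> ?Z"
    proof -
      show "preimage (F (Suc i) \<inter> H) \<subseteq> ?Z"
        using pm.subspace_0[OF S.submod_subspace[OF b(2)]] by (force intro: exI[of _ 0])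
      show "preimage (F i) \<subseteq> ?Z"
        using pm.subspace_0[OF S.submod_subspace[OF b(1)]] by (force intro: exI[of _ 0])
    qed
    have "preimage (F (Suc i) \<inter> H) \<subseteq> preimage (F (Suc i))" "preimage (F i) \<subseteq> preimage (F (Suc i))"
      using sub(3) by (auto simp: preimage_def)
    then have "?Z \<subseteq> preimage (F (Suc i))" using pm.subspace_add[OF S.submod_subspace[OF b(3)]] by auto
    then have "?Z = preimage (F i) \<or> ?Z = preimage (F (Suc i))"
      using inc(2) by (intro S.simple_step_simple[OF st] S.submod_sum b)
    then show ?case
    proof
      assume "?Z = preimage (F i)"
      then have *: "preimage (F (Suc i) \<inter> H) \<subseteq> preimage (F i)" using inc(1) by simp
      have "F (Suc i) \<inter> H \<subseteq> F i"
      proof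
        fix x assume x: "x \<in> F (Suc i) \<inter> H"
        then obtain y where "y \<in> C" "x = f y" using f_surj HD(1) by blast
        then show "x \<in> F i" using x * by (auto simp: preimage_def)
      qed
      then have "F (Suc i) \<inter> H = F i \<inter> H" using sub(3) by auto
      then show ?thesis using G by auto
    next
      assume Z: "?Z = preimage (F (Suc i))"
      \<comment> \<open>Here the intersection maps onto the old factor, so the second isomorphism
        theorem applies.\<close>
      have "bg_iso (bg_quot (M\<lparr>carrier := F (Suc i) \<inter> H\<rparr>) (F i \<inter> H)) (bg_quot (M\<lparr>carrier := F (Suc i)\<rparr>) (F i))"
      proof (rule P.bg_quot_Int_iso[OF sub(2,1,3) H])
        fix x assume x: "x \<in> F (Suc i)"
        then obtain y where y: "y \<in> C" "x = f y" using f_surj P.bg_submoduleD(1)[OF sub(2)] by blast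
        then have "y \<in> ?Z" using x unfolding Z by (simp add: preimage_def)
        then obtain a e where ae: "y = a + e" "a \<in> preimage (F (Suc i) \<inter> H)" "e \<in> preimage (F i)" by blast
        then have "f (y - a) \<in> F i" "a \<in> C" "f a \<in> F (Suc i) \<inter> H" by (auto simp: preimage_def)
        then show "\<exists>a\<in>F (Suc i) \<inter> H. x \<ominus> a \<in> F i" using y f_diff by (intro bexI[of _ "f a"]) auto
      qed
      then have gen: "bg_simple_generator (bg_quot (M\<lparr>carrier := F (Suc i) \<inter> H\<rparr>) (F i \<inter> H))"
        using sub(4) by (rule bg_simple_generator_iso)
      define G' where "G' = G(Suc r' := F (Suc i) \<inter> H)"
      have "G' 0 = {\<zero>}" "G' (Suc r') = F (Suc i) \<inter> H" using G(1) by (auto simp: G'_def)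
      moreover have "\<forall>j\<le>Suc r'. bg_submodule (G' j) M \<and> G' j \<subseteq> H"
        using G(3) subH by (auto simp: G'_def le_Suc_eq)
      moreover have "\<forall>j<Suc r'. G' j \<subseteq> G' (Suc j) \<and> bg_simple_generator (bg_quot (M\<lparr>carrier := G' (Suc j)\<rparr>) (G' j))"
        using G(2,4) gen sub(3) by (auto simp: G'_def less_Suc_eq)
      ultimately show ?thesis by blast
    qed
  qed
  from this[of r] obtain r' G where G: "G 0 = {\<zero>}" "G r' = F r \<inter> H" "\<forall>j\<le>r'. bg_submodule (G j) M \<and> G j \<subseteq> H"
    "\<forall>j<r'. G j \<subseteq> G (Suc j) \<and> bg_simple_generator (bg_quot (M\<lparr>carrier := G (Suc j)\<rparr>) (G j))" by auto
  have "G r' = H" using G(2) F(2) HD(1) by auto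
  then show ?thesis
    unfolding bg_filtered_def using G P.restrict_submodule[OF H]
    by (intro exI[of _ r'] exI[of _ G]) simp
qed

text \<open>Any decomposition into submodules is thereby a decomposition within the category, which
  is the form in which indecomposability is used.\<close>

lemma bg_cat_at_restrict:
  assumes "bg_cat_at \<Lambda> M" and H: "bg_submodule H M"
  shows "bg_cat_at \<Lambda> (M\<lparr>carrier := H\<rparr>)"
proof -
  interpret H: bg_premodule "M\<lparr>carrier := H\<rparr>" by (rule P.restrict_premodule[OF H])
  note HD = P.bg_submoduleD[OF H]
  have minus: "x \<ominus>\<^bsub>M\<lparr>carrier := H\<rparr>\<^esub> y = x \<ominus> y" if "x \<in> H" "y \<in> H" for x y
    using that subsetD[OF HD(1)] H.minus_eq[of x y] P.minus_eq[of x y] by simp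
  have "bg_module (M\<lparr>carrier := H\<rparr>)"
  proof unfold_locales
    fix x g h assume "x \<in> carrier (M\<lparr>carrier := H\<rparr>)"
    then show "act (M\<lparr>carrier := H\<rparr>) g (act (M\<lparr>carrier := H\<rparr>) h x) \<ominus>\<^bsub>M\<lparr>carrier := H\<rparr>\<^esub>
        act (M\<lparr>carrier := H\<rparr>) h (act (M\<lparr>carrier := H\<rparr>) g x) = bg_comm g h \<odot>\<^bsub>M\<lparr>carrier := H\<rparr>\<^esub> x"
      using act_comm[of x g h] HD(1,5) by (auto simp: minus)
  qed (use H.act_closed H.act_add H.act_smult in auto)
  moreover have "smooth (M\<lparr>carrier := H\<rparr>)"
    using assms(1) HD(1) by (auto simp: bg_cat_at_def bg_cat_def smooth_def)
  moreover have "bg_filtered (M\<lparr>carrier := H\<rparr>)"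
    using assms by (intro filtered_restrict) (auto simp: bg_cat_at_def bg_cat_def)
  ultimately show ?thesis
    using assms P.J0_gen_eigenvalue_restrict[OF H] by (auto simp: bg_cat_at_def bg_cat_def)
qed

end

section \<open>Indecomposable objects\<close>

text \<open>With Y = 0 the relations hold for v k itself and not only modulo Y. This provides a
  joint eigenvector of all \<open>H m\<close>, on which J_0 can be computed.\<close>

lemma (in bg_space) simple_step_bottom:
  assumes st: "simple_step n \<nu> v {0} X" and "X \<noteq> {0}"
  obtains k where "v k \<noteq> 0" "v k \<in> X"
    "\<And>m. H m (v k) = (if m = - n then \<nu> - of_int k else if m > - n then 0 else 1) *s v k"
proof -
  have X: "submod X" using st by (simp add: simple_step_def)
  interpret F: bg_space scale X "\<lambda>g. act (bg_sigma n g)"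
    by (rule bg_space.bg_space_flow[OF submod_bg_space[OF X]])
  have v: "v k \<in> X" for k using st by (simp add: simple_step_def)
  have "submod (gen (range v))" using v submod_subset[OF X] by (intro submod_gen) auto
  have "\<exists>k. v k \<noteq> 0"
  proof (rule ccontr)
    assume "\<nexists>k. v k \<noteq> 0"
    then have "X \<subseteq> {0}" using st submod_zero by (auto simp: simple_step_def)
    then show False using \<open>X \<noteq> {0}\<close> subspace_0[OF submod_subspace[OF X]] by auto
  qed
  then obtain k where k: "v k \<noteq> 0" by blast
  have FX: "bg_space.submod scale C (\<lambda>g. act (bg_sigma n g)) Z" if "F.submod Z" for Z
    using that submod_subset[OF X] by (auto simp: F.submod_def bg_space.submod_def[OF bg_space_flow])
  have std: "F.standard \<nu> v"
    unfolding F.standard_def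
  proof (intro conjI)
    have "F.submod (F.gen (range v))" using v by (intro F.submod_gen) auto
    then have "submod (F.gen (range v))" using FX submod_flow by blast
    moreover have "range v \<subseteq> F.gen (range v)" by (auto intro: F.gen_base)
    moreover have "{0} \<subseteq> F.gen (range v)" using subspace_0[OF submod_subspace[OF calculation(1)]] by simp
    ultimately show "X \<subseteq> F.gen (range v)" using st unfolding simple_step_def by blast
  qed (use st in \<open>auto simp: simple_step_def\<close>)
  have top: "v k \<in> X" "\<And>g. mode g > 0 \<Longrightarrow> act (bg_sigma n g) (v k) = 0" using std by (simp_all add: F.standard_def)
  have H: "H m = F.H (m + n)" for m using H_flow[of n "m + n"] by simp
  have "H m (v k) = (if m = - n then \<nu> - of_int k else if m > - n then 0 else 1) *s v k" for m
  proof (cases "m = - n")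
    case True
    then show ?thesis using F.standard_H0[OF std, of k] by (simp add: H)
  next
    case False
    then show ?thesis using F.H_top[OF top, of "m + n"] by (auto simp: H)
  qed
  then show thesis using that k v by blast
qed

context bg_model
begin

lemma indecomposable_image:
  assumes ind: "bg_indecomposable_at \<Lambda> M"
    and Y: "S.submod Y" and Z: "S.submod Z" and disj: "Y \<inter> Z = {0}"
    and sum: "\<And>x. x \<in> C \<Longrightarrow> \<exists>y\<in>Y. x - y \<in> Z"
  shows "Y = {0} \<or> Z = {0}"
proof -
  have zero: "f ` K = {\<zero>} \<Longrightarrow> K = {0}" if "S.submod K" for K
    using that f_inj[of _ 0] S.submod_subset[OF that] f_zero pm.subspace_0[OF S.subspace_C]
      pm.subspace_0[OF S.submod_subspace[OF that]] by auto
  note sub = bg_submodule_image[OF Y] bg_submodule_image[OF Z]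
  have cat: "bg_cat_at \<Lambda> M" using ind by (simp add: bg_indecomposable_at_def)
  have "f ` Y \<inter> f ` Z = {\<zero>}"
  proof
    show "f ` Y \<inter> f ` Z \<subseteq> {\<zero>}"
    proof
      fix x assume "x \<in> f ` Y \<inter> f ` Z"
      then obtain y z where yz: "y \<in> Y" "z \<in> Z" "x = f y" "f y = f z" by auto
      then have "y = z" using f_inj S.submod_subset[OF Y] S.submod_subset[OF Z] by blast
      then have "y = 0" using yz disj by blast
      then show "x \<in> {\<zero>}" using yz f_zero by simp
    qed
    show "{\<zero>} \<subseteq> f ` Y \<inter> f ` Z" using P.bg_submoduleD(2)[OF sub(1)] P.bg_submoduleD(2)[OF sub(2)] by simp
  qed
  moreover have "f ` Y <+>\<^bsub>M\<^esub> f ` Z = carrier M"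
  proof
    show "f ` Y <+>\<^bsub>M\<^esub> f ` Z \<subseteq> carrier M"
      using P.bg_submoduleD(1)[OF sub(1)] P.bg_submoduleD(1)[OF sub(2)] by (auto simp: set_add_def')
    show "carrier M \<subseteq> f ` Y <+>\<^bsub>M\<^esub> f ` Z"
    proof
      fix x assume "x \<in> carrier M"
      then obtain c where c: "c \<in> C" "x = f c" using f_surj by blast
      then obtain y where y: "y \<in> Y" "c - y \<in> Z" using sum by blast
      have "x = f y \<oplus> f (c - y)"
        using f_simps(2)[OF S.submod_subset[OF Y y(1)] S.submod_subset[OF Z y(2)]] c by simp
      then show "x \<in> f ` Y <+>\<^bsub>M\<^esub> f ` Z" using y by (auto simp: set_add_def')
    qed
  qed
  ultimately have "f ` Y = {\<zero>} \<or> f ` Z = {\<zero>}"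
    using ind sub bg_cat_at_restrict[OF cat] unfolding bg_indecomposable_at_def by blast
  then show ?thesis using zero Y Z by blast
qed

lemma single_weight_class:
  assumes ind: "bg_indecomposable_at \<Lambda> M" and \<Lambda>: "\<Lambda> = {\<mu> + c | c. c \<in> \<int>}"
  obtains n where "C \<subseteq> S.H.geig (- n) \<Lambda>"
proof (cases "C = {0}")
  case True
  then have "C \<subseteq> S.H.geig (- 0) \<Lambda>" using pm.subspace_0[OF S.H.subspace_geig] by auto
  then show thesis by (rule that)
next
  case False
  have cat: "bg_filtered M" "smooth M" "\<And>c. J0_gen_eigenvalue M c \<Longrightarrow> c \<in> \<Lambda>"
    using ind by (auto simp: bg_indecomposable_at_def bg_cat_at_def bg_cat_def)
  obtain F r where ch: "S.composition_chain F r" using filtered_chain[OF cat(1)] by blast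
  \<comment> \<open>Steps of a chain may be trivial, so the bottom factor is the first term that is
    not zero.\<close>
  have "\<exists>i<r. F i = {0} \<and> F (Suc i) \<noteq> {0}"
  proof (rule ccontr)
    assume "\<not> ?thesis"
    then have "F i = {0}" if "i \<le> r" for i
      using that by (induction i) (use ch in \<open>auto simp: S.composition_chain_def\<close>)
    then show False using False ch by (auto simp: S.composition_chain_def)
  qed
  then obtain i n \<nu> v where X: "F (Suc i) \<noteq> {0}" "S.simple_step n \<nu> v {0} (F (Suc i))"
    using ch by (fastforce simp: S.composition_chain_def)
  obtain k where k: "v k \<noteq> 0" "v k \<in> F (Suc i)"
    "\<And>m. S.H m (v k) = pm_scale (if m = - n then \<nu> - of_int k else if m > - n then 0 else 1) (v k)"
    using S.simple_step_bottom[OF X(2,1)] by blast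
  have vC: "v k \<in> C" using X(2) k(2) by (auto simp: S.simple_step_def dest: S.submod_subset)
  obtain c where c: "J0_gen_eigenvalue M c" "c - \<nu> \<in> \<int>"
  proof (rule J0_eigenvalue_class[OF cat(2) f_simps(1)[OF vC]])
    show "f (v k) \<noteq> \<zero>" using f_inj[OF vC, of 0] k(1) pm.subspace_0[OF S.subspace_C] f_zero by auto
    show "act M (Gamma (- m)) (act M (Beta m) (f (v k)))
        = (if m = - n then \<nu> - of_int k else if m > - n then 0 else 1) \<odot> f (v k)" for m
    proof -
      have "act M (Gamma (- m)) (act M (Beta m) (f (v k))) = f (S.H m (v k))"
        by (simp add: S.H_def f_simps(4) S.act_closed vC)
      then show ?thesis by (simp only: k(3) f_simps(3)[OF vC])
    qed
    show "(if m = - n then \<nu> - of_int k else if m > - n then 0 else 1) \<in> \<int>" if "m \<noteq> - n" for m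
      using that by auto
  qed (use that in auto)
  obtain d where d: "c = \<mu> + d" "d \<in> \<int>" using cat(3)[OF c(1)] \<Lambda> by auto
  have "\<nu> - of_int k = \<mu> + (d - (c - \<nu>) - of_int k)" using d by simp
  moreover have "d - (c - \<nu>) - of_int k \<in> \<int>" by (rule Ints_diff[OF Ints_diff[OF d(2) c(2)] Ints_of_int])
  ultimately have "\<nu> - of_int k \<in> \<Lambda>" unfolding \<Lambda> by blast
  then have vg: "v k \<in> S.H.geig (- n) \<Lambda>" using k(3)[of "- n"] by (intro S.H.geig_eigenvector) auto
  have inv: "c + e \<in> \<Lambda> \<longleftrightarrow> c \<in> \<Lambda>" if "e \<in> \<int>" for c e
  proof
    assume "c + e \<in> \<Lambda>"
    then obtain d where "c + e = \<mu> + d" "d \<in> \<int>" by (auto simp: \<Lambda>)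
    then have "c = \<mu> + (d - e)" "d - e \<in> \<int>" using that by (auto simp: algebra_simps)
    then show "c \<in> \<Lambda>" by (auto simp: \<Lambda>)
  next
    assume "c \<in> \<Lambda>"
    then obtain d where "c = \<mu> + d" "d \<in> \<int>" by (auto simp: \<Lambda>)
    then have "c + e = \<mu> + (d + e)" "d + e \<in> \<int>" using that by auto
    then show "c + e \<in> \<Lambda>" by (auto simp: \<Lambda>)
  qed
  \<comment> \<open>The complement of \<Lambda> is also stable under adding integers, so both weight
    parts are submodules.\<close>
  have sub: "S.submod (C \<inter> S.H.geig (- n) \<Lambda>)" "S.submod (C \<inter> S.H.geig (- n) (- \<Lambda>))"
    using inv by (auto intro!: S.submod_geig)
  have "C \<inter> S.H.geig (- n) \<Lambda> = {0} \<or> C \<inter> S.H.geig (- n) (- \<Lambda>) = {0}"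
  proof (rule indecomposable_image[OF ind sub])
    show "C \<inter> S.H.geig (- n) \<Lambda> \<inter> (C \<inter> S.H.geig (- n) (- \<Lambda>)) = {0}"
      using S.H.geig_disjoint[of \<Lambda> "- \<Lambda>" _ "- n"] pm.subspace_0[OF S.submod_subspace[OF sub(1)]]
        pm.subspace_0[OF S.submod_subspace[OF sub(2)]] by auto
    fix x assume x: "x \<in> C"
    then have "x \<in> S.H.geig (- n) (\<Lambda> \<union> - \<Lambda>)" using S.composition_chain_geig[OF ch] by auto
    then obtain y z where "x = y + z" "y \<in> C" "y \<in> S.H.geig (- n) \<Lambda>" "z \<in> C" "z \<in> S.H.geig (- n) (- \<Lambda>)"
      using S.H.geig_split[OF S.subspace_C S.H_closed x, of "- n" \<Lambda> "- \<Lambda>"] by blast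
    then show "\<exists>y\<in>C \<inter> S.H.geig (- n) \<Lambda>. x - y \<in> C \<inter> S.H.geig (- n) (- \<Lambda>)"
      by (intro bexI[of _ y]) auto
  qed
  \<comment> \<open>The part for \<Lambda> contains the nonzero vector v k, so the other part is the
    one that vanishes.\<close>
  then have zero: "C \<inter> S.H.geig (- n) (- \<Lambda>) = {0}" using vg vC k(1) by auto
  have "C \<subseteq> S.H.geig (- n) \<Lambda>"
  proof
    fix x assume x: "x \<in> C"
    then have "x \<in> S.H.geig (- n) (\<Lambda> \<union> - \<Lambda>)" using S.composition_chain_geig[OF ch] by auto
    then obtain y z where "x = y + z" "y \<in> S.H.geig (- n) \<Lambda>" "z \<in> C" "z \<in> S.H.geig (- n) (- \<Lambda>)"
      using S.H.geig_split[OF S.subspace_C S.H_closed x, of "- n" \<Lambda> "- \<Lambda>"] by blast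
    moreover from this zero have "z = 0" by blast
    ultimately show "x \<in> S.H.geig (- n) \<Lambda>" by simp
  qed
  then show thesis by (rule that)
qed

text \<open>Undoing the flow by n moves the weight condition from index -n to index 0 and turns a
  step of flow m into one of flow m - n. Smoothness leaves finitely many positive modes, since the
  flow changes a mode by at most the absolute value of n.\<close>

lemma bg_weight_space_flow:
  assumes "smooth M" and ch: "S.composition_chain F r" and \<mu>: "\<mu> \<notin> \<int>"
    and geig: "C \<subseteq> S.H.geig (- n) {\<mu> + c | c. c \<in> \<int>}"
  shows "bg_weight_space pm_scale C (\<lambda>g. A (bg_sigma n g)) \<mu> r"
proof -
  interpret T: bg_space pm_scale C "\<lambda>g. A (bg_sigma n g)" by (rule S.bg_space_flow)
  have H: "T.H j = S.H (j - n)" for j by (rule S.H_flow)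
  have "S.simple_step m \<nu> v Y X \<Longrightarrow> T.simple_step (m - n) \<nu> v Y X" for m \<nu> v Y X
  proof -
    have "bg_sigma n (bg_sigma (m - n) g) = bg_sigma m g" for g by (cases g) auto
    then show "S.simple_step m \<nu> v Y X \<Longrightarrow> T.simple_step (m - n) \<nu> v Y X"
      by (simp only: S.simple_step_def T.simple_step_def S.submod_flow) blast
  qed
  then have chT: "T.composition_chain F r"
    using ch unfolding S.composition_chain_def T.composition_chain_def by blast
  have geigT: "C \<subseteq> T.H.geig 0 {\<mu> + c | c. c \<in> \<int>}"
    using geig by (simp add: H)
  have disj: "{\<mu> + c | c. c \<in> \<int>} \<inter> \<int> = {}"
  proof -
    have "\<mu> + c \<notin> \<int>" if "c \<in> \<int>" for c
    proof
      assume "\<mu> + c \<in> \<int>"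
      then have "\<mu> + c - c \<in> \<int>" using that by (rule Ints_diff)
      then show False using \<mu> by simp
    qed
    then show ?thesis by auto
  qed
  show ?thesis
  proof unfold_locales
    show "\<mu> \<notin> \<int>" by (rule \<mu>)
    show "C \<subseteq> T.H.geig 0 {\<mu> + c | c. c \<in> \<int>}" by (rule geigT)
    show "\<exists>k. ((\<lambda>x. A (bg_sigma n g) x) ^^ k) x = 0" if "mode g > 0" "x \<in> C" for g x
      using T.composition_chain_nilpotent[OF chT geigT disj that] by blast
    show "(T.H.shift 0 c ^^ r) x = 0" if "x \<in> C" "x \<in> T.H.geig 0 {c}" for x c
      by (rule T.composition_chain_bounded[OF chT that])
    show "finite {g. mode g > 0 \<and> A (bg_sigma n g) x \<noteq> 0}" if x: "x \<in> C" for x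
    proof -
      obtain B where B: "\<And>m. m \<ge> B \<Longrightarrow> act M (Beta m) (f x) = \<zero> \<and> act M (Gamma m) (f x) = \<zero>"
        using assms(1) f_simps(1)[OF x] by (auto simp: smooth_def)
      have zero: "A g x = 0" if "mode g \<ge> B" for g
      proof -
        have "f (A g x) = f 0" using B[of "mode g"] that by (cases g) (auto simp: f_simps(4)[OF x] f_zero)
        then show ?thesis using f_inj[OF S.act_closed[OF x] pm.subspace_0[OF S.subspace_C]] by blast
      qed
      have "{g. mode g > 0 \<and> A (bg_sigma n g) x \<noteq> 0} \<subseteq> Beta ` {0..B + \<bar>n\<bar>} \<union> Gamma ` {0..B + \<bar>n\<bar>}"
      proof
        fix g assume g: "g \<in> {g. mode g > 0 \<and> A (bg_sigma n g) x \<noteq> 0}"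
        then have "mode (bg_sigma n g) < B" using zero[of "bg_sigma n g"] by force
        then show "g \<in> Beta ` {0..B + \<bar>n\<bar>} \<union> Gamma ` {0..B + \<bar>n\<bar>}" using g by (cases g) auto
      qed
      then show ?thesis by (rule finite_subset) simp
    qed
  qed
qed

text \<open>The isomorphism is built from \<open>bg_W\<close> to the copy with the flow undone.
  Flowing by n restores the action because \<open>bg_flow n\<close> precomposes with
  \<open>bg_sigma (- n)\<close>, the inverse of the twist in \<open>A'\<close>.\<close>

lemma indecomposable_iso:
  assumes ind: "bg_indecomposable_at \<Lambda> M" and \<Lambda>: "\<Lambda> = {\<mu> + c | c. c \<in> \<int>}" and \<mu>: "\<mu> \<notin> \<int>"
  shows "\<exists>n k. bg_iso M (bg_flow n (bg_W \<mu> k))"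
proof -
  have cat: "bg_filtered M" "smooth M"
    using ind by (auto simp: bg_indecomposable_at_def bg_cat_at_def bg_cat_def)
  obtain F r where ch: "S.composition_chain F r" using filtered_chain[OF cat(1)] by blast
  obtain n where n: "C \<subseteq> S.H.geig (- n) \<Lambda>" using single_weight_class[OF ind \<Lambda>] by blast
  define A' where "A' g = A (bg_sigma n g)" for g
  interpret T: bg_weight_space pm_scale C A' \<mu> r
    unfolding A'_def by (rule bg_weight_space_flow[OF cat(2) ch \<mu> n[unfolded \<Lambda>]])
  have submodT: "T.submod Z \<longleftrightarrow> S.submod Z" for Z unfolding A'_def by (rule S.submod_flow)
  have "\<exists>k u. T.jordan_basis \<mu> k u"
  proof (rule T.jordan_basis_exists)
    show "Y = {0} \<or> Z = {0}" if "T.submod Y" "T.submod Z" "Y \<inter> Z = {0}" "\<And>x. x \<in> C \<Longrightarrow> \<exists>y\<in>Y. x - y \<in> Z" for Y Z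
      by (rule indecomposable_image[OF ind that(1,2)[unfolded submodT] that(3,4)])
  qed
  then obtain k u where u: "T.jordan_basis \<mu> k u" by blast
  have iso: "bg_iso (bg_W \<mu> k) (space_rep pm_scale C A')"
    by (rule bg_W_iso[OF T.bg_space_axioms u])
  have flow: "bg_flow n (space_rep pm_scale C A') = space_rep pm_scale C A"
    by (simp add: bg_flow_space_rep A'_def bg_sigma_inverse)
  have closedW: "bg_closed (bg_flow n (bg_W \<mu> k))"
  proof -
    have "bg_closed (bg_ind (W_top \<mu> k))"
      unfolding bg_ind_def by (rule bg_premodule.bg_closed_quot[OF W.bg_premodule_free W.bg_submodule_rel_span])
    then show ?thesis by (simp add: bg_closed_def bg_W_def)
  qed
  have "bg_iso (bg_flow n (bg_W \<mu> k)) (space_rep pm_scale C A)"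
    using bg_iso_flow[OF iso, of n] unfolding flow .
  then have W: "bg_iso (space_rep pm_scale C A) (bg_flow n (bg_W \<mu> k))"
    by (rule bg_iso_sym[OF closedW])
  have "bg_iso (space_rep pm_scale C A) M" using hom bij by (auto simp: bg_iso_def)
  then have "bg_iso M (space_rep pm_scale C A)"
    by (rule bg_iso_sym[OF bg_premodule.bg_closed[OF S.bg_premodule_space_rep]])
  from bg_iso_trans[OF this W] show ?thesis by blast
qed

end

theorem theorem2p3:
  fixes \<Lambda> :: "complex set" and \<mu> :: complex and M :: "'v bg_rep"
  assumes "\<Lambda> \<in> C_mod_Z" and "\<Lambda> \<noteq> \<int>" and "\<mu> \<in> \<Lambda>"
    and "bg_indecomposable_at \<Lambda> M"
  shows "\<exists>(n::int) (k::nat). bg_iso M (bg_flow n (bg_W \<mu> k))"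
proof -
  have M: "bg_module M"
    using assms(4) by (simp add: bg_indecomposable_at_def bg_cat_at_def bg_cat_def)
  obtain \<nu> where \<nu>: "\<Lambda> = {b. \<nu> - b \<in> \<int>}"
    using assms(1) by (auto simp: C_mod_Z_def quotient_def)
  have \<Lambda>: "\<Lambda> = {\<mu> + c | c. c \<in> \<int>}"
  proof (intro equalityI subsetI)
    fix x assume "x \<in> \<Lambda>"
    then have "\<nu> - x \<in> \<int>" "\<nu> - \<mu> \<in> \<int>" using assms(3) by (auto simp: \<nu>)
    from Ints_diff[OF this(2,1)] show "x \<in> {\<mu> + c | c. c \<in> \<int>}" by (auto intro!: exI[of _ "x - \<mu>"])
  next
    fix x assume "x \<in> {\<mu> + c | c. c \<in> \<int>}"
    then obtain c where c: "x = \<mu> + c" "c \<in> \<int>" by blast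
    have "\<nu> - \<mu> \<in> \<int>" using assms(3) by (simp add: \<nu>)
    from Ints_diff[OF this c(2)] show "x \<in> \<Lambda>" by (simp add: \<nu> c(1) algebra_simps)
  qed
  have \<mu>: "\<mu> \<notin> \<int>"
  proof
    assume \<mu>: "\<mu> \<in> \<int>"
    have "\<Lambda> = \<int>"
    proof (intro equalityI subsetI)
      fix x :: complex assume "x \<in> \<int>"
      then have "x = \<mu> + (x - \<mu>)" "x - \<mu> \<in> \<int>" using \<mu> by auto
      then show "x \<in> \<Lambda>" unfolding \<Lambda> by blast
    qed (use \<mu> in \<open>auto simp: \<Lambda>\<close>)
    then show False using assms(2) by blast
  qed
  obtain C :: "('v \<Rightarrow>\<^sub>0 complex) set" and A f where "bg_space pm_scale C A"
    "f \<in> bg_hom (space_rep pm_scale C A) M" "bij_betw f C (carrier M)"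
    using bg_module_model[OF M] by blast
  then interpret bg_model M C A f
    by (intro bg_model.intro M bg_model_axioms.intro)
  show ?thesis by (rule indecomposable_iso[OF assms(4) \<Lambda> \<mu>])
qed

end
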